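(* Let $G=(V,E_G)$ be a weighted graph (the communication network) and let $T=(V,E_T)$ be a rooted spanning tree of $G$. There exists a deterministic $\tilde O(1)$-round Minor-Aggregation algorithm that computes $\mathrm{Cut}_{T,G}(e)$ for all $e\in E_T$, where each tree edge learns its cut value.
   Context: Minor-Aggregation model. The communication network is a connected undirected graph $G=(V,E)$ with $n=|V|$ nodes; both nodes and edges are computational units with private memory. Initially nodes know only their unique $\tilde O(1)$-bit ID (and inputs) and edges know the IDs of their endpoints. Computation proceeds in synchronous rounds, each of three steps: (i) Contraction: each edge $e$ chooses $c_e\in\{\bot,\top\}$, defining the minor $G'=G/\{e:c_e=\top\}$ (self-loops removed), whose vertices (supernodes) are identified with the sets of nodes they contain. (ii) Consensus: each node $v$ chooses an $\tilde O(1)$-bit value $x_v$; for each supernode $s$ all nodes of $s$ learn $y_s=\bigoplus_{v\in s}x_v$ for a predefined aggregation operator $\bigoplus$. (iii) Aggregation: each edge $e$ of $G'$ joining supernodes $a,b$ learns $y_a,y_b$ and chooses $\tilde O(1)$-bit values $z_{e,a},z_{e,b}$; all nodes of each supernode $s$ learn the same aggregate $\bigotimes_{e \text{ incident to } s} z_{e,s}$ for a predefined aggregation operator $\bigotimes$. An aggregation operator maps two $B$-bit messages ($B=\tilde O(1)$) to one $B$-bit message, applied pairwise in arbitrary order to aggregate several messages. $\tilde O(\cdot)$ hides $\mathrm{poly}(\log n)$ factors. Inputs are distributedly stored: each edge knows its weight (positive integers bounded by $\mathrm{poly}(n)$), each edge knows whether it belongs to $T$, and each tree edge knows which endpoint is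 closer to the root. For a tree edge $e$, $\mathrm{Cut}_{T,G}(e)$ is the total weight of the edges $\{u,v\}\in E_G$ whose unique $u$–$v$ path in $T$ contains $e$. *)

theory Defs
  imports Complex_Main "HOL-Library.Landau_Symbols" "HOL-Library.Multiset"
begin

(* Nodes are identified with their unique IDs, which are bit strings; an edge is the set of
   its two endpoints. *)
type_synonym bits = "bool list"
type_synonym node = bits
type_synonym edge = "node set"

definition soft_O1 :: "(nat \<Rightarrow> nat) \<Rightarrow> bool" where
  "soft_O1 f \<longleftrightarrow> (\<exists>k::nat. (\<lambda>n. real (f n)) \<in> O(\<lambda>n. ln (real n) ^ k))"

definition poly_bounded :: "(nat \<Rightarrow> nat) \<Rightarrow> bool" where
  "poly_bounded f \<longleftrightarrow> (\<exists>k::nat. (\<lambda>n. real (f n)) \<in> O(\<lambda>n. real n ^ k))"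


subsection \<open>Graphs and spanning trees\<close>

definition simple_graph :: "node set \<Rightarrow> edge set \<Rightarrow> bool" where
  "simple_graph V E \<longleftrightarrow> finite V \<and> V \<noteq> {} \<and> (\<forall>e\<in>E. e \<subseteq> V \<and> card e = 2)"

definition adj :: "edge set \<Rightarrow> (node \<times> node) set" where
  "adj F = {(u, v). {u, v} \<in> F}"

definition connected_graph :: "node set \<Rightarrow> edge set \<Rightarrow> bool" where
  "connected_graph V E \<longleftrightarrow> (\<forall>u\<in>V. \<forall>v\<in>V. (u, v) \<in> (adj E)\<^sup>*)"

definition is_path :: "edge set \<Rightarrow> node \<Rightarrow> node list \<Rightarrow> node \<Rightarrow> bool" where
  "is_path F u p v \<longleftrightarrow> p \<noteq> [] \<and> hd p = u \<and> last p = v \<and> distinct p \<and>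
     successively (\<lambda>a b. {a, b} \<in> F) p"

definition path_edges :: "node list \<Rightarrow> edge set" where
  "path_edges p = {{p ! i, p ! Suc i} |i. Suc i < length p}"

definition is_cycle :: "edge set \<Rightarrow> node list \<Rightarrow> bool" where
  "is_cycle F p \<longleftrightarrow> 3 \<le> length p \<and> distinct p \<and>
     successively (\<lambda>a b. {a, b} \<in> F) p \<and> {last p, hd p} \<in> F"

definition spanning_tree :: "node set \<Rightarrow> edge set \<Rightarrow> edge set \<Rightarrow> bool" where
  "spanning_tree V E T \<longleftrightarrow> T \<subseteq> E \<and> connected_graph V T \<and> (\<nexists>p. is_cycle T p)"

definition tree_path :: "edge set \<Rightarrow> node \<Rightarrow> node \<Rightarrow> node list" where
  "tree_path T u v = (THE p. is_path T u p v)"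

definition tree_dist :: "edge set \<Rightarrow> node \<Rightarrow> node \<Rightarrow> nat" where
  "tree_dist T u v = length (tree_path T u v) - 1"

definition upper_end :: "edge set \<Rightarrow> node \<Rightarrow> edge \<Rightarrow> node" where
  "upper_end T r e = (THE u. u \<in> e \<and> (\<forall>v\<in>e - {u}. tree_dist T r u < tree_dist T r v))"

definition Cut :: "edge set \<Rightarrow> edge set \<Rightarrow> (edge \<Rightarrow> nat) \<Rightarrow> edge \<Rightarrow> nat" where
  "Cut T E w e =
     (\<Sum>f\<in>{f \<in> E. \<exists>u v. f = {u, v} \<and> e \<in> path_edges (tree_path T u v)}. w f)"


subsection \<open>Deterministic Minor-Aggregation algorithms\<close>

record edge_input =
  ends :: edge
  weight :: nat
  in_tree :: bool
  closer_to_root :: "node option"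

definition edge_input_of :: "(edge \<Rightarrow> nat) \<Rightarrow> edge set \<Rightarrow> node \<Rightarrow> edge \<Rightarrow> edge_input" where
  "edge_input_of w T r e =
     \<lparr>ends = e, weight = w e, in_tree = (e \<in> T),
      closer_to_root = (if e \<in> T then Some (upper_end T r e) else None)\<rparr>"

(* The private memory of a node or an edge is everything it has learned so far, in
   chronological order: its initial knowledge and one entry for each completed round.
   A node learns the consensus value of its supernode and the aggregate over the incident
   edges (None if there are none). An edge learns, for each of its endpoints, the
   consensus value of the supernode containing that endpoint; an edge that is not in the
   minor learns nothing (the empty map). *)
type_synonym node_entry = "bits \<times> bits option"
type_synonym edge_entry = "node \<Rightarrow> bits option"
type_synonym node_view = "node \<times> node_entry list"
type_synonym edge_view = "edge_input \<times> edge_entry list"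

(* The operators may depend on the (commonly known) round number. Local computation is
   unrestricted. The function edge_val gives the values sent by an edge towards each of its
   endpoints, after learning the consensus values of the current round. The output
   of an edge is None as long as it has not decided. *)
record ma_algorithm =
  contract :: "edge_view \<Rightarrow> bool"
  node_val :: "node_view \<Rightarrow> bits"
  consensus_op :: "nat \<Rightarrow> bits \<Rightarrow> bits \<Rightarrow> bits"
  edge_val :: "edge_view \<Rightarrow> edge_entry \<Rightarrow> node \<Rightarrow> bits"
  aggregation_op :: "nat \<Rightarrow> bits \<Rightarrow> bits \<Rightarrow> bits"
  edge_output :: "edge_view \<Rightarrow> nat option"

definition aggregation_operator :: "(bits \<Rightarrow> bits \<Rightarrow> bits) \<Rightarrow> bool" where
  "aggregation_operator f \<longleftrightarrow>
     (\<forall>B x y. length x \<le> B \<and> length y \<le> B \<longrightarrow> length (f x y) \<le> B)"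

definition valid_algorithm :: "ma_algorithm \<Rightarrow> bool" where
  "valid_algorithm A \<longleftrightarrow>
     (\<forall>t. aggregation_operator (consensus_op A t) \<and> aggregation_operator (aggregation_op A t))"

(* Possible results of combining a nonempty multiset of messages pairwise in arbitrary order.
   Operators need not be associative or commutative, so there may be several results. *)
inductive aggregates :: "(bits \<Rightarrow> bits \<Rightarrow> bits) \<Rightarrow> bits multiset \<Rightarrow> bits \<Rightarrow> bool"
  for f where
  single: "aggregates f {#x#} x"
| merge: "aggregates f M x \<Longrightarrow> aggregates f N y \<Longrightarrow> aggregates f (M + N) (f x y)"

definition aggregates_opt ::
    "(bits \<Rightarrow> bits \<Rightarrow> bits) \<Rightarrow> bits multiset \<Rightarrow> bits option \<Rightarrow> bool" where
  "aggregates_opt f M a \<longleftrightarrow>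
     (case a of None \<Rightarrow> M = {#} | Some x \<Rightarrow> aggregates f M x)"

definition supernode :: "edge set \<Rightarrow> node \<Rightarrow> node set" where
  "supernode F v = (adj F)\<^sup>* `` {v}"

definition supernodes :: "node set \<Rightarrow> edge set \<Rightarrow> node set set" where
  "supernodes V F = supernode F ` V"

definition minor_edges :: "node set \<Rightarrow> edge set \<Rightarrow> edge set \<Rightarrow> edge set" where
  "minor_edges V E F = {e \<in> E. \<not> (\<exists>s\<in>supernodes V F. e \<subseteq> s)}"

definition learned :: "node set \<Rightarrow> edge set \<Rightarrow> edge set \<Rightarrow> (node set \<Rightarrow> bits) \<Rightarrow> edge \<Rightarrow> edge_entry"
  where
  "learned V E F y e =
     (\<lambda>v. if e \<in> minor_edges V E F \<and> v \<in> e then Some (y (supernode F v)) else None)"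

type_synonym config = "(node \<Rightarrow> node_entry list) \<times> (edge \<Rightarrow> edge_entry list)"

definition contracted ::
    "ma_algorithm \<Rightarrow> edge set \<Rightarrow> (edge \<Rightarrow> edge_input) \<Rightarrow> (edge \<Rightarrow> edge_entry list) \<Rightarrow> edge set" where
  "contracted A E inp H = {e \<in> E. contract A (inp e, H e)}"

(* The consensus results y and the aggregation results a of the supernodes are arbitrary
   among those that some aggregation order yields. An edge e of the minor incident to a
   supernode s is represented by the pair (e, v) where v is its endpoint in s. *)
definition ma_round ::
    "ma_algorithm \<Rightarrow> node set \<Rightarrow> edge set \<Rightarrow> (edge \<Rightarrow> edge_input) \<Rightarrow> nat \<Rightarrow>
     config \<Rightarrow> (node set \<Rightarrow> bits) \<Rightarrow> (node set \<Rightarrow> bits option) \<Rightarrow> config \<Rightarrow> bool" where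
  "ma_round A V E inp t c y a c' \<longleftrightarrow>
     (let N = fst c; H = snd c; F = contracted A E inp H in
       (\<forall>s\<in>supernodes V F.
          aggregates (consensus_op A t)
            (image_mset (\<lambda>v. node_val A (v, N v)) (mset_set s)) (y s)) \<and>
       (\<forall>s\<in>supernodes V F.
          aggregates_opt (aggregation_op A t)
            (image_mset (\<lambda>(e, v). edge_val A (inp e, H e) (learned V E F y e) v)
              (mset_set {(e, v). e \<in> minor_edges V E F \<and> v \<in> e \<inter> s})) (a s)) \<and>
       (\<forall>v\<in>V. fst c' v = N v @ [(y (supernode F v), a (supernode F v))]) \<and>
       (\<forall>e\<in>E. snd c' e = H e @ [learned V E F y e]))"

definition round_bounded ::
    "ma_algorithm \<Rightarrow> node set \<Rightarrow> edge set \<Rightarrow> (edge \<Rightarrow> edge_input) \<Rightarrow> nat \<Rightarrow>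
     config \<Rightarrow> (node set \<Rightarrow> bits) \<Rightarrow> bool" where
  "round_bounded A V E inp B c y \<longleftrightarrow>
     (let N = fst c; H = snd c; F = contracted A E inp H in
       (\<forall>v\<in>V. length (node_val A (v, N v)) \<le> B) \<and>
       (\<forall>e\<in>minor_edges V E F. \<forall>v\<in>e.
          length (edge_val A (inp e, H e) (learned V E F y e) v) \<le> B))"

definition ma_execution ::
    "ma_algorithm \<Rightarrow> node set \<Rightarrow> edge set \<Rightarrow> (edge \<Rightarrow> edge_input) \<Rightarrow>
     (nat \<Rightarrow> config) \<Rightarrow> (nat \<Rightarrow> node set \<Rightarrow> bits) \<Rightarrow> (nat \<Rightarrow> node set \<Rightarrow> bits option) \<Rightarrow> bool" where
  "ma_execution A V E inp c y a \<longleftrightarrow>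
     c 0 = (\<lambda>_. [], \<lambda>_. []) \<and> (\<forall>t. ma_round A V E inp t (c t) (y t) (a t) (c (Suc t)))"

(* The first value an edge outputs is its irrevocable decision. *)
definition decides ::
    "ma_algorithm \<Rightarrow> (edge \<Rightarrow> edge_input) \<Rightarrow> (nat \<Rightarrow> config) \<Rightarrow> edge \<Rightarrow> nat \<Rightarrow> nat \<Rightarrow> bool" where
  "decides A inp c e t x \<longleftrightarrow>
     edge_output A (inp e, snd (c t) e) = Some x \<and>
     (\<forall>t'<t. edge_output A (inp e, snd (c t') e) = None)"

end

theory Submission imports Defs begin

text \<open>
  All supernodes formed by the algorithm are connected pieces of the tree, so a contraction is given
  by the set of nodes whose parent edge is contracted. The proof combines three ideas.

  \<^item> Clustering. Clusters are named by their topmost node. In a step for digit position \<open>i\<close> and digit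
    \<open>b\<close>, every cluster whose name has digit \<open>b\<close> at \<open>i\<close>, while the name of its parent cluster has not,
    joins its parent cluster. These merges form stars, and one sweep through all \<open>(i, b)\<close> halves the
    number of clusters on each root path, so polylogarithmically many steps leave a single cluster.

  \<^item> Subtree sums. Going through the steps backwards, the edge along which a cluster was merged learns
    its subtree sum as the sum over that cluster plus the already known sums of the edges leaving it
    downwards.

  \<^item> Cuts. The nodes whose subtree size lies in \<open>[2 ^ j, 2 ^ (j + 1))\<close> form disjoint vertical paths. Merge
    every smaller hanging subtree into its path node, and let each graph edge charge its weight to the
    path nodes of both endpoints, negatively to the upper one if both lie on the same path. The cut value
    of a path edge is then the sum of the charges on the path below it.

  Nodes do not know \<open>n\<close>; a bound on all numbers involved is obtained from the longest
  identifier and the largest weight.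
\<close>

text \<open>Subtree sums cannot climb a deep tree level by level, so polylogarithmically many merges
  have to produce a hierarchy. If chains of clusters merged in one step, sums needed at one edge of
  a chain would be due only in that same step; demanding different digits forbids chains, and since
  distinct identifiers differ somewhere, this symmetry breaking is deterministic. Adding up the
  weights at all nodes of a subtree counts an edge inside it twice, where the cut needs zero. The
  usual correction at the lowest common ancestor is not locally available. Within a size class it
  becomes easy: two disjoint subtrees of at least \<open>2 ^ j\<close> nodes do not fit below a
  class node, so the class nodes below it form a chain, and subtree sizes tell which of two chain
  nodes is the upper one. Its negative charge makes an edge visible exactly between its two path
  nodes. Operators may neither lengthen messages nor rely on an order, so all sums are taken modulo
  \<open>2 ^ D\<close>; the final values are small enough to be exact.\<close>

lemma adj_sym: "(u, v) \<in> adj F \<Longrightarrow> (v, u) \<in> adj F"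
  by (simp add: adj_def insert_commute)

lemma adj_rtrancl_sym: "(u, v) \<in> (adj F)\<^sup>* \<Longrightarrow> (v, u) \<in> (adj F)\<^sup>*"
  by (meson adj_sym symI sym_rtrancl symD)

section \<open>Rooted trees given by a parent function\<close>

locale rooted_tree =
  fixes V :: "node set" and r :: node and par :: "node \<Rightarrow> node" and dep :: "node \<Rightarrow> nat"
  assumes finite_V: "finite V" and root_in: "r \<in> V"
    and par_in: "\<And>z. z \<in> V - {r} \<Longrightarrow> par z \<in> V"
    and dep_par: "\<And>z. z \<in> V - {r} \<Longrightarrow> dep (par z) < dep z"
begin

definition parent_rel :: "(node \<times> node) set" where
  "parent_rel = {(z, par z) |z. z \<in> V - {r}}"

definition desc :: "node \<Rightarrow> node set" where
  "desc x = {v \<in> V. (v, x) \<in> parent_rel\<^sup>*}"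

text \<open>Well-founded because \<open>dep\<close> strictly decreases along \<open>par\<close>;
  inductions along upward walks use this rule.\<close>

lemma parent_induct [consumes 1, case_names root step]:
  assumes "v \<in> V" "P r" "\<And>z. z \<in> V - {r} \<Longrightarrow> P (par z) \<Longrightarrow> P z"
  shows "P v"
  using assms(1)
proof (induction "dep v" arbitrary: v rule: less_induct)
  case less
  show ?case
  proof (cases "v = r")
    case False
    then show ?thesis using less assms(3)[of v] par_in[of v] dep_par[of v] by simp
  qed (use assms(2) in simp)
qed

lemma desc_subset: "desc x \<subseteq> V"
  by (auto simp: desc_def)

lemma finite_desc [simp]: "finite (desc x)"
  using desc_subset finite_V by (rule finite_subset)

lemma desc_self [simp]: "v \<in> V \<Longrightarrow> v \<in> desc v"
  by (simp add: desc_def)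

text \<open>\<open>parent_rel\<close> is single-valued, so a nontrivial walk up from
  \<open>v\<close> must start with \<open>par v\<close>.\<close>

lemma desc_step:
  assumes "v \<in> V - {r}"
  shows "v \<in> desc x \<longleftrightarrow> v = x \<or> par v \<in> desc x"
proof -
  have "(v, x) \<in> parent_rel\<^sup>* \<longleftrightarrow> v = x \<or> (par v, x) \<in> parent_rel\<^sup>*"
    using assms by (subst rtrancl_eq_or_trancl)
      (auto simp: parent_rel_def dest!: tranclD intro: rtrancl_into_trancl2)
  then show ?thesis using assms par_in by (auto simp: desc_def)
qed

lemma desc_root_iff: "r \<in> desc x \<longleftrightarrow> x = r"
proof -
  have "(r, x) \<in> parent_rel\<^sup>* \<Longrightarrow> x = r"
    by (erule converse_rtranclE) (auto simp: parent_rel_def)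
  then show ?thesis using root_in by (auto simp: desc_def)
qed

lemma desc_trans: "a \<in> desc b \<Longrightarrow> b \<in> desc c \<Longrightarrow> a \<in> desc c"
  by (auto simp: desc_def)

lemma desc_mono: "a \<in> desc b \<Longrightarrow> desc a \<subseteq> desc b"
  using desc_trans by blast

lemma desc_imp_in: "a \<in> desc b \<Longrightarrow> b \<in> V"
proof -
  have "(a, b) \<in> parent_rel\<^sup>* \<Longrightarrow> a \<in> V \<Longrightarrow> b \<in> V"
    by (induction rule: rtrancl_induct) (auto simp: parent_rel_def par_in)
  then show "a \<in> desc b \<Longrightarrow> b \<in> V" by (auto simp: desc_def)
qed

lemma desc_dep: "a \<in> desc b \<Longrightarrow> a = b \<or> dep b < dep a"
proof -
  have "a = b \<or> dep b < dep a" if "(a, b) \<in> parent_rel\<^sup>*"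
    using that
  proof (induction rule: rtrancl_induct)
    case (step y z)
    then have "dep z < dep y" using dep_par by (auto simp: parent_rel_def)
    then show ?case using step by auto
  qed simp
  then show "a \<in> desc b \<Longrightarrow> a = b \<or> dep b < dep a" by (auto simp: desc_def)
qed

lemma desc_antisym: "a \<in> desc b \<Longrightarrow> b \<in> desc a \<Longrightarrow> a = b"
  using desc_dep[of a b] desc_dep[of b a] by auto

lemma par_desc: "z \<in> V - {r} \<Longrightarrow> z \<in> desc (par z)"
  using desc_step[of z "par z"] par_in by simp

lemma par_not_desc: "z \<in> V - {r} \<Longrightarrow> par z \<notin> desc z"
  using desc_dep[of "par z" z] dep_par[of z] by auto

text \<open>Upward walks never branch, so the ancestors of one node form a chain. Consequently two
  subtrees are nested or disjoint.\<close>

lemma desc_linear: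
  assumes "v \<in> desc x" "v \<in> desc y"
  shows "x \<in> desc y \<or> y \<in> desc x"
proof -
  have "v \<in> V" using assms desc_subset by blast
  then show ?thesis using assms
  proof (induction v rule: parent_induct)
    case root
    then show ?case by (simp add: desc_root_iff)
  next
    case (step z)
    then show ?case by (metis desc_step)
  qed
qed

lemma desc_root: "desc r = V"
proof -
  have "v \<in> desc r" if "v \<in> V" for v
    using that by (induction v rule: parent_induct) (auto simp: root_in desc_step)
  then show ?thesis using desc_subset by auto
qed

text \<open>Membership in \<open>desc x\<close> changes only across the deleted edge. Conversely
  both sides stay connected: nodes inside reach \<open>x\<close>, nodes outside reach
  \<open>r\<close>.\<close>

lemma connected_iff_desc:
  assumes "x \<in> V - {r}" "u \<in> V" "v \<in> V"
  defines "F \<equiv> (\<lambda>z. {z, par z}) ` (V - {r}) - {{x, par x}}"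
  shows "(u, v) \<in> (adj F)\<^sup>* \<longleftrightarrow> (u \<in> desc x \<longleftrightarrow> v \<in> desc x)"
proof
  assume "(u, v) \<in> (adj F)\<^sup>*"
  then show "u \<in> desc x \<longleftrightarrow> v \<in> desc x"
  proof (induction rule: rtrancl_induct)
    case (step a b)
    then obtain z where z: "z \<in> V - {r}" "{a, b} = {z, par z}" "z \<noteq> x"
      by (auto simp: adj_def F_def)
    then have "z \<in> desc x \<longleftrightarrow> par z \<in> desc x" by (simp add: desc_step)
    then show ?case using step z by (auto simp: doubleton_eq_iff)
  qed simp
next
  have edge: "{z, par z} \<in> F" if "z \<in> V - {r}" "z \<noteq> x" for z
  proof -
    have "{z, par z} \<noteq> {x, par x}"
      using that assms(1) dep_par[of z] dep_par[of x] by (auto simp: doubleton_eq_iff)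
    then show ?thesis using that by (auto simp: F_def)
  qed
  have inside: "(a, x) \<in> (adj F)\<^sup>*" if "a \<in> V" "a \<in> desc x" for a
    using that
  proof (induction a rule: parent_induct)
    case root
    then show ?case using assms by (simp add: desc_root_iff)
  next
    case (step z)
    show ?case
    proof (cases "z = x")
      case False
      then have "(z, par z) \<in> adj F" "par z \<in> desc x"
        using step edge by (auto simp: adj_def desc_step)
      then show ?thesis using step by (meson converse_rtrancl_into_rtrancl)
    qed simp
  qed
  have outside: "(a, r) \<in> (adj F)\<^sup>*" if "a \<in> V" "a \<notin> desc x" for a
    using that
  proof (induction a rule: parent_induct)
    case (step z)
    then have "(z, par z) \<in> adj F" "par z \<notin> desc x"
      using edge[of z] assms(1) by (auto simp: adj_def desc_step)
    then show ?case using step by (meson converse_rtrancl_into_rtrancl)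
  qed simp
  assume "u \<in> desc x \<longleftrightarrow> v \<in> desc x"
  then show "(u, v) \<in> (adj F)\<^sup>*"
    using inside outside adj_rtrancl_sym assms(2,3) by (meson rtrancl_trans)
qed

end

subsection \<open>Paths in trees\<close>

text \<open>Loop erasure: when a walk returns to a visited node, the path is cut back to that node,
  which keeps it \<open>distinct\<close>.\<close>

lemma reachable_imp_path:
  assumes "(u, v) \<in> (adj F)\<^sup>*"
  shows "\<exists>p. is_path F u p v"
  using assms
proof (induction rule: rtrancl_induct)
  case base
  have "is_path F u [u] u" by (simp add: is_path_def)
  then show ?case by blast
next
  case (step v w)
  then obtain p where p: "is_path F u p v" by blast
  show ?case
  proof (cases "w \<in> set p")
    case True
    then obtain p1 p2 where "p = p1 @ w # p2" by (meson split_list)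
    then have "is_path F u (p1 @ [w]) w"
      using p by (auto simp: is_path_def successively_append_iff hd_append split: if_splits)
    then show ?thesis by blast
  next
    case False
    then have "is_path F u (p @ [w]) w"
      using p step by (auto simp: is_path_def successively_append_iff adj_def)
    then show ?thesis by blast
  qed
qed

lemma path_reachable:
  assumes "p \<noteq> []" "successively (\<lambda>a b. {a, b} \<in> F) p"
  shows "(hd p, last p) \<in> (adj F)\<^sup>*"
  using assms
proof (induction p rule: induct_list012)
  case (3 a b p)
  then have "(a, b) \<in> adj F" "(b, last (b # p)) \<in> (adj F)\<^sup>*" by (auto simp: adj_def)
  then show ?case by (simp add: converse_rtrancl_into_rtrancl)
qed auto

lemma path_edges_simps:
  "path_edges [] = {}" "path_edges [a] = {}"
  "path_edges (a # b # p) = insert {a, b} (path_edges (b # p))"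
proof -
  show "path_edges (a # b # p) = insert {a, b} (path_edges (b # p))" (is "?L = ?R")
  proof (intro equalityI subsetI)
    fix e assume "e \<in> ?L"
    then obtain i where "Suc i < length (a # b # p)" "e = {(a # b # p) ! i, (a # b # p) ! Suc i}"
      by (auto simp: path_edges_def)
    then show "e \<in> ?R" by (cases i) (auto simp: path_edges_def)
  next
    fix e assume "e \<in> ?R"
    then consider "e = {a, b}"
      | i where "Suc i < length (b # p)" "e = {(b # p) ! i, (b # p) ! Suc i}"
      by (auto simp: path_edges_def)
    then show "e \<in> ?L"
    proof cases
      case 1
      then show ?thesis by (auto simp: path_edges_def intro!: exI[of _ 0])
    next
      case 2
      then show ?thesis by (auto simp: path_edges_def intro!: exI[of _ "Suc i"])
    qed
  qed
qed (auto simp: path_edges_def)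

lemma successively_path_edges:
  "successively (\<lambda>a b. {a, b} \<in> F) p \<longleftrightarrow> path_edges p \<subseteq> F"
  by (induction p rule: induct_list012) (auto simp: path_edges_simps)

lemma path_edges_subset_nodes: "e \<in> path_edges p \<Longrightarrow> e \<subseteq> set p"
  by (auto simp: path_edges_def)

section \<open>Acyclic edge sets: bridges and unique paths\<close>

locale acyclic_edges =
  fixes T :: "edge set"
  assumes no_cycle: "\<nexists>p. is_cycle T p" and card_edge: "\<And>e. e \<in> T \<Longrightarrow> card e = 2"
begin

text \<open>A simple path around the edge has at least three nodes, so the edge would close it to a
  cycle.\<close>

lemma edge_is_bridge:
  assumes "{a, b} \<in> T"
  shows "(a, b) \<notin> (adj (T - {{a, b}}))\<^sup>*"
proof
  assume "(a, b) \<in> (adj (T - {{a, b}}))\<^sup>*"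
  then obtain p where p: "is_path (T - {{a, b}}) a p b" using reachable_imp_path by blast
  have ab: "a \<noteq> b" using card_edge[OF assms] by auto
  obtain q where q: "p = a # q" using p by (cases p) (auto simp: is_path_def)
  then obtain c q' where q': "q = c # q'" using p ab by (cases q) (auto simp: is_path_def)
  have "q' \<noteq> []" using p q q' by (auto simp: is_path_def)
  moreover have "successively (\<lambda>a b. {a, b} \<in> T) p"
    using p unfolding is_path_def successively_path_edges by auto
  ultimately have "is_cycle T p"
    using p q q' assms by (cases q') (auto simp: is_cycle_def is_path_def insert_commute)
  then show False using no_cycle by blast
qed

lemma path_unique:
  assumes "is_path T u p v" "is_path T u q v"
  shows "p = q"
  using assms
proof (induction p arbitrary: u q)
  case (Cons x p)
  then have x: "x = u" by (simp add: is_path_def)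
  obtain q' where q: "q = u # q'" using Cons by (cases q) (auto simp: is_path_def)
  show ?case
  proof (cases "p = [] \<or> q' = []")
    case True
    then show ?thesis using Cons.prems q x
      by (metis distinct.simps(2) is_path_def last.simps last_in_set)
  next
    case False
    then obtain a p' b q'' where ab: "p = a # p'" "q' = b # q''" by (meson neq_Nil_conv)
    have 1: "is_path T a p v" "is_path T b q' v"
      using Cons.prems q x ab by (auto simp: is_path_def)
    show ?thesis
    proof (cases "a = b")
      case True
      then show ?thesis using Cons.IH 1 q x by blast
    next
      case False
      \<comment> \<open>Both remaining paths reach \<open>v\<close> without the edge
        \<open>{u, a}\<close>; joined with the edge \<open>{u, b}\<close> they bypass it, although
        it is a bridge.\<close>
      let ?F = "T - {{u, a}}"
      have nu: "u \<notin> set p" "u \<notin> set q'" using Cons.prems q x by (auto simp: is_path_def)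
      have "path_edges p \<subseteq> ?F" "path_edges q' \<subseteq> ?F"
        using 1 nu path_edges_subset_nodes[of "{u, a}"]
        unfolding is_path_def successively_path_edges by auto
      then have "(a, v) \<in> (adj ?F)\<^sup>*" "(b, v) \<in> (adj ?F)\<^sup>*"
        using 1 path_reachable[of p ?F] path_reachable[of q' ?F]
        unfolding successively_path_edges is_path_def by auto
      moreover have "{u, b} \<in> ?F"
        using Cons.prems(2) q ab False by (auto simp: is_path_def doubleton_eq_iff)
      then have "(u, b) \<in> adj ?F" by (simp add: adj_def)
      ultimately have "(u, a) \<in> (adj ?F)\<^sup>*"
        by (meson adj_rtrancl_sym converse_rtrancl_into_rtrancl rtrancl_trans)
      moreover have "{u, a} \<in> T" using Cons.prems(1) x ab by (auto simp: is_path_def)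
      ultimately show ?thesis using edge_is_bridge by blast
    qed
  qed
qed (simp add: is_path_def)

lemma tree_path_eq: "is_path T u p v \<Longrightarrow> tree_path T u v = p"
  unfolding tree_path_def using path_unique by (intro the_equality) auto

text \<open>By uniqueness a path avoiding \<open>e\<close> would be the tree path itself. From here
  on, separation replaces explicit paths.\<close>

lemma in_tree_path_iff:
  assumes "(u, v) \<in> (adj T)\<^sup>*"
  shows "e \<in> path_edges (tree_path T u v) \<longleftrightarrow> (u, v) \<notin> (adj (T - {e}))\<^sup>*"
proof
  assume e: "e \<in> path_edges (tree_path T u v)"
  show "(u, v) \<notin> (adj (T - {e}))\<^sup>*"
  proof
    assume "(u, v) \<in> (adj (T - {e}))\<^sup>*"
    then obtain p where p: "is_path (T - {e}) u p v" using reachable_imp_path by blast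
    then have "is_path T u p v" unfolding is_path_def successively_path_edges by auto
    then have "tree_path T u v = p" by (rule tree_path_eq)
    then show False using p e unfolding is_path_def successively_path_edges by auto
  qed
next
  assume n: "(u, v) \<notin> (adj (T - {e}))\<^sup>*"
  obtain p where p: "is_path T u p v" using assms reachable_imp_path by blast
  have "e \<in> path_edges p"
  proof (rule ccontr)
    assume "e \<notin> path_edges p"
    then have "successively (\<lambda>a b. {a, b} \<in> T - {e}) p"
      using p unfolding is_path_def successively_path_edges by auto
    then show False using n p path_reachable[of p "T - {e}"] by (auto simp: is_path_def)
  qed
  then show "e \<in> path_edges (tree_path T u v)" using p by (simp add: tree_path_eq)
qed

end

text \<open>Bridge between the path-based definitions and the parent function used afterwards: an
  edge counts for the cut at \<open>{z, par z}\<close> iff exactly one of its ends lies in the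
  subtree of \<open>z\<close>.\<close>

lemma spanning_tree_rooted:
  assumes G: "simple_graph V E" and tree: "spanning_tree V E T" and r: "r \<in> V"
  obtains par where "rooted_tree V r par (tree_dist T r)"
    and "T = (\<lambda>z. {z, par z}) ` (V - {r})"
    and "\<And>z. z \<in> V - {r} \<Longrightarrow> upper_end T r {z, par z} = par z"
    and "\<And>z w. z \<in> V - {r} \<Longrightarrow> Cut T E w {z, par z} =
           (\<Sum>f\<in>{f \<in> E. card (f \<inter> rooted_tree.desc V r par z) = 1}. w f)"
proof -
  have TE: "T \<subseteq> E" and conn: "connected_graph V T" and nc: "\<nexists>p. is_cycle T p"
    using tree by (auto simp: spanning_tree_def)
  have E: "e \<subseteq> V" "card e = 2" if "e \<in> E" for e using G that by (auto simp: simple_graph_def)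
  interpret acyclic_edges T using nc E TE by unfold_locales auto
  let ?P = "tree_path T r"
  let ?d = "tree_dist T r"
  have path: "is_path T r (?P v) v" if "v \<in> V" for v
  proof -
    have "(r, v) \<in> (adj T)\<^sup>*" using conn that r by (simp add: connected_graph_def)
    then obtain p where "is_path T r p v" using reachable_imp_path by blast
    then show ?thesis using tree_path_eq by metis
  qed
  define par where "par v = last (butlast (?P v))" for v
  \<comment> \<open>By uniqueness, exhibiting any path whose last step goes from \<open>u\<close> to
    \<open>v\<close> suffices to identify the parent of \<open>v\<close>.\<close>
  have ext: "par v = u \<and> ?P v = ?P u @ [v]" if "is_path T r (q @ [u, v]) v" for q u v
  proof -
    have "?P v = q @ [u, v]" using that by (rule tree_path_eq)
    moreover have "is_path T r (q @ [u]) u"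
      using that by (auto simp: is_path_def successively_append_iff hd_append split: if_splits)
    then have "?P u = q @ [u]" by (rule tree_path_eq)
    ultimately show ?thesis by (simp add: par_def butlast_append)
  qed
  have step: "{v, par v} \<in> T \<and> par v \<in> V \<and> ?P v = ?P (par v) @ [v]" if "v \<in> V - {r}" for v
  proof -
    have p: "is_path T r (?P v) v" using path that by simp
    then obtain p' where p': "?P v = p' @ [v]" by (metis append_butlast_last_id is_path_def)
    then have "p' \<noteq> []" using p that by (auto simp: is_path_def)
    then obtain q u where q: "?P v = q @ [u, v]" using p'
      by (metis append.assoc append_Cons append_Nil append_butlast_last_id)
    then have "{u, v} \<in> T" using p by (auto simp: is_path_def successively_append_iff)
    moreover have "u \<in> V" using \<open>{u, v} \<in> T\<close> TE E by blast
    ultimately show ?thesis using ext[of q u v] p q by (auto simp: insert_commute)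
  qed
  have Pne: "?P v \<noteq> []" if "v \<in> V" for v using path[OF that] by (simp add: is_path_def)
  have dist: "?d v = Suc (?d (par v))" if "v \<in> V - {r}" for v
    using step[OF that] Pne[of "par v"] by (cases "?P (par v)") (auto simp: tree_dist_def)
  have rt: "rooted_tree V r par ?d"
    using G r step dist by unfold_locales (auto simp: simple_graph_def)
  then interpret rt: rooted_tree V r par ?d .
  \<comment> \<open>Either \<open>b\<close> is off the root path of \<open>a\<close> and prolongs
    it, or it is on that path, which can then be cut at \<open>b\<close> and continued directly to
    \<open>a\<close>.\<close>
  have ends: "(b \<noteq> r \<and> par b = a) \<or> (a \<noteq> r \<and> par a = b)" if e: "{a, b} \<in> T" for a b
  proof -
    have ab: "a \<in> V" "b \<in> V" "a \<noteq> b" using e TE E[of "{a, b}"] by auto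
    have p: "is_path T r (?P a) a" using path ab by simp
    show ?thesis
    proof (cases "b \<in> set (?P a)")
      case False
      obtain q where q: "?P a = q @ [a]" using p by (metis append_butlast_last_id is_path_def)
      have "is_path T r (q @ [a, b]) b"
        using p False e ab unfolding q by (auto simp: is_path_def successively_append_iff hd_append split: if_splits)
      moreover have "b \<noteq> r" using False p by (metis hd_in_set is_path_def)
      ultimately show ?thesis using ext by blast
    next
      case True
      then obtain q1 q2 where q: "?P a = q1 @ b # q2" by (meson split_list)
      have "a \<noteq> r"
      proof
        assume "a = r"
        then have "is_path T r [a] a" by (simp add: is_path_def)
        then have "?P a = [a]" by (rule tree_path_eq)
        then show False using True ab by simp
      qed
      have "a \<notin> set (q1 @ [b])"
        using p ab unfolding q by (cases q2 rule: rev_cases) (auto simp: is_path_def)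
      then have "is_path T r (q1 @ [b, a]) a"
        using p e ab unfolding q
        by (auto simp: is_path_def successively_append_iff hd_append insert_commute split: if_splits)
      then show ?thesis using ext \<open>a \<noteq> r\<close> by blast
    qed
  qed
  have T: "T = (\<lambda>z. {z, par z}) ` (V - {r})"
  proof (intro equalityI subsetI)
    fix e assume e: "e \<in> T"
    then have "card e = 2" "e \<subseteq> V" using TE E by auto
    then obtain a b where ab: "e = {a, b}" "a \<in> V" "b \<in> V" by (auto simp: card_2_iff)
    then show "e \<in> (\<lambda>z. {z, par z}) ` (V - {r})"
      using ends[of a b] e by (auto simp: insert_commute)
  qed (use step in auto)
  have up: "upper_end T r {z, par z} = par z" if "z \<in> V - {r}" for z
    using dist[OF that] unfolding upper_end_def by (intro the_equality) auto
  have cut: "Cut T E w {z, par z} = (\<Sum>f\<in>{f \<in> E. card (f \<inter> rt.desc z) = 1}. w f)"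
    if z: "z \<in> V - {r}" for z w
  proof -
    have iff: "{z, par z} \<in> path_edges (tree_path T u v) \<longleftrightarrow> card ({u, v} \<inter> rt.desc z) = 1"
      if "{u, v} \<in> E" for u v
    proof -
      have uv: "u \<in> V" "v \<in> V" "u \<noteq> v" using E[OF that] by auto
      then have "(u, v) \<in> (adj T)\<^sup>*" using conn by (simp add: connected_graph_def)
      then have "{z, par z} \<in> path_edges (tree_path T u v) \<longleftrightarrow>
          \<not> (u \<in> rt.desc z \<longleftrightarrow> v \<in> rt.desc z)"
        using in_tree_path_iff[of u v "{z, par z}"] rt.connected_iff_desc[OF z uv(1,2)]
        by (simp add: T)
      then show ?thesis using uv by (auto simp: Int_insert_left)
    qed
    have "{f \<in> E. \<exists>u v. f = {u, v} \<and> {z, par z} \<in> path_edges (tree_path T u v)} =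
        {f \<in> E. card (f \<inter> rt.desc z) = 1}"
    proof (intro Collect_cong conj_cong refl)
      fix f assume f: "f \<in> E"
      then obtain a b where "f = {a, b}" using E[OF f] by (auto simp: card_2_iff)
      then show "(\<exists>u v. f = {u, v} \<and> {z, par z} \<in> path_edges (tree_path T u v)) \<longleftrightarrow>
          card (f \<inter> rt.desc z) = 1"
        using iff f by blast
    qed
    then show ?thesis by (simp add: Cut_def)
  qed
  show ?thesis using that[OF rt T up cut] .
qed

context rooted_tree
begin

subsection \<open>Contracting parent edges\<close>

text \<open>Canonical name of the supernode of \<open>v\<close> once the parent edges of
  \<open>Z\<close> are contracted.\<close>

definition topmost :: "node set \<Rightarrow> node \<Rightarrow> node" where
  "topmost Z v = (par ^^ (LEAST k. (par ^^ k) v \<notin> Z)) v"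

abbreviation parent_edges :: "node set \<Rightarrow> edge set" where
  "parent_edges Z \<equiv> (\<lambda>z. {z, par z}) ` Z"

lemma topmost_outside: "v \<notin> Z \<Longrightarrow> topmost Z v = v"
  by (simp add: topmost_def Least_eq_0)

lemma topmost_inside:
  assumes Z: "Z \<subseteq> V - {r}" and v: "v \<in> Z"
  shows "topmost Z v = topmost Z (par v)"
proof -
  have "\<exists>k. (par ^^ k) v \<notin> Z" if "v \<in> V" for v
    using that
  proof (induction v rule: parent_induct)
    case root
    then show ?case using Z by (auto intro: exI[of _ 0])
  next
    case (step z)
    then obtain k where "(par ^^ k) (par z) \<notin> Z" by blast
    then show ?case by (intro exI[of _ "Suc k"]) (simp add: funpow_swap1)
  qed
  then obtain k where "(par ^^ k) v \<notin> Z" using Z v by blast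
  then have "(LEAST k. (par ^^ k) v \<notin> Z) = Suc (LEAST k. (par ^^ Suc k) v \<notin> Z)"
    using v by (intro Least_Suc) auto
  then show ?thesis by (simp add: topmost_def funpow_swap1)
qed

lemma topmost_induct [consumes 2, case_names outside inside]:
  assumes "Z \<subseteq> V - {r}" "v \<in> V"
    and "\<And>v. v \<in> V \<Longrightarrow> v \<notin> Z \<Longrightarrow> P v" "\<And>v. v \<in> Z \<Longrightarrow> P (par v) \<Longrightarrow> P v"
  shows "P v"
  using assms(2)
proof (induction v rule: parent_induct)
  case root
  then show ?case using assms(1) root_in by (intro assms(3)) auto
next
  case (step z)
  then show ?case using assms(3,4)[of z] by (cases "z \<in> Z") auto
qed

lemma topmost_props:
  assumes Z: "Z \<subseteq> V - {r}" and v: "v \<in> V"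
  shows "topmost Z v \<in> V" "topmost Z v \<notin> Z" "v \<in> desc (topmost Z v)"
proof -
  have "topmost Z v \<in> V \<and> topmost Z v \<notin> Z \<and> v \<in> desc (topmost Z v)"
    using assms
  proof (induction v rule: topmost_induct)
    case (inside v)
    then show ?case using Z topmost_inside[OF Z] desc_step[of v] by auto
  qed (simp add: topmost_outside)
  then show "topmost Z v \<in> V" "topmost Z v \<notin> Z" "v \<in> desc (topmost Z v)" by auto
qed

text \<open>An upward walk leaves \<open>desc x\<close> only through \<open>x\<close>, and there it
  stops because \<open>x \<notin> Z\<close>.\<close>

lemma topmost_in_desc:
  assumes Z: "Z \<subseteq> V - {r}" and "v \<in> desc x" "x \<notin> Z"
  shows "topmost Z v \<in> desc x"
proof -
  have "v \<in> V" using assms desc_subset by blast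
  with Z show ?thesis using assms(2,3)
  proof (induction v rule: topmost_induct)
    case (inside v)
    then have "par v \<in> desc x" using Z desc_step[of v x] by auto
    then show ?case using inside topmost_inside[OF Z] by auto
  qed (simp add: topmost_outside)
qed

lemma topmost_subset:
  assumes "Z \<subseteq> Z'" "Z' \<subseteq> V - {r}" "v \<in> V"
  shows "topmost Z' (topmost Z v) = topmost Z' v"
proof -
  have Z: "Z \<subseteq> V - {r}" using assms by auto
  show ?thesis using Z assms(3)
  proof (induction v rule: topmost_induct)
    case (inside v)
    then show ?case using topmost_inside[OF Z] topmost_inside[OF assms(2)] assms(1) by auto
  qed (simp add: topmost_outside)
qed

lemma topmost_par_neq:
  assumes Z: "Z \<subseteq> V - {r}" and z: "z \<in> V - {r}" "z \<notin> Z"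
  shows "topmost Z (par z) \<noteq> topmost Z z"
  using topmost_props(3)[OF Z par_in[OF z(1)]] par_not_desc[OF z(1)] topmost_outside[OF z(2)] by metis

text \<open>A contracted edge joins nodes of equal name, and every node is connected to its own name
  by contracted edges.\<close>

lemma supernode_parent_edges:
  assumes Z: "Z \<subseteq> V - {r}" and v: "v \<in> V"
  shows "supernode (parent_edges Z) v = {u \<in> V. topmost Z u = topmost Z v}"
proof -
  let ?R = "(adj (parent_edges Z))\<^sup>*"
  have "u \<in> V \<and> topmost Z u = topmost Z v" if "(v, u) \<in> ?R" for u
    using that
  proof (induction rule: rtrancl_induct)
    case (step a b)
    then obtain z where z: "z \<in> Z" "{a, b} = {z, par z}" by (auto simp: adj_def)
    then have "topmost Z z = topmost Z (par z)" "z \<in> V" "par z \<in> V"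
      using Z par_in[of z] topmost_inside[OF Z] by auto
    then show ?case using step z by (auto simp: doubleton_eq_iff)
  qed (use v in simp)
  moreover have to_top: "(u, topmost Z u) \<in> ?R" if "u \<in> V" for u
    using Z that
  proof (induction u rule: topmost_induct)
    case (inside u)
    then have "(u, par u) \<in> adj (parent_edges Z)" by (auto simp: adj_def)
    then show ?case using inside topmost_inside[OF Z] by (simp add: converse_rtrancl_into_rtrancl)
  qed (simp add: topmost_outside)
  moreover have "(v, u) \<in> ?R" if "u \<in> V" "topmost Z u = topmost Z v" for u
    using to_top[OF v] adj_rtrancl_sym[OF to_top[OF that(1)]] unfolding that(2) by (rule rtrancl_trans)
  ultimately show ?thesis unfolding supernode_def by blast
qed

definition in_minor :: "node set \<Rightarrow> edge \<Rightarrow> bool" where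
  "in_minor Z e \<longleftrightarrow> (\<exists>u\<in>e. \<exists>v\<in>e. topmost Z u \<noteq> topmost Z v)"

lemma minor_edges_parent_edges:
  assumes Z: "Z \<subseteq> V - {r}" and E: "\<And>e. e \<in> E \<Longrightarrow> e \<subseteq> V \<and> e \<noteq> {}"
  shows "minor_edges V E (parent_edges Z) = {e \<in> E. in_minor Z e}"
proof -
  have "(\<exists>s\<in>supernodes V (parent_edges Z). e \<subseteq> s) \<longleftrightarrow> \<not> in_minor Z e" if e: "e \<in> E" for e
  proof
    assume "\<exists>s\<in>supernodes V (parent_edges Z). e \<subseteq> s"
    then obtain v where "v \<in> V" "e \<subseteq> supernode (parent_edges Z) v" by (auto simp: supernodes_def)
    then have "topmost Z u = topmost Z v" if "u \<in> e" for u
      using that supernode_parent_edges[OF Z] by auto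
    then show "\<not> in_minor Z e" by (simp add: in_minor_def)
  next
    assume n: "\<not> in_minor Z e"
    obtain v where v: "v \<in> e" "v \<in> V" using E[OF e] by auto
    then have "e \<subseteq> supernode (parent_edges Z) v"
      using n E[OF e] unfolding supernode_parent_edges[OF Z v(2)] in_minor_def by blast
    then show "\<exists>s\<in>supernodes V (parent_edges Z). e \<subseteq> s" using v by (auto simp: supernodes_def)
  qed
  then show ?thesis by (auto simp: minor_edges_def)
qed

subsection \<open>Subtree sums along a contraction\<close>

text \<open>The subtree of \<open>z\<close> consists of its cluster and the disjoint subtrees
  hanging below it on uncontracted parent edges; each hanging sum is attributed to the cluster node
  it is attached to.\<close>

lemma sum_desc_split:
  fixes f :: "node \<Rightarrow> 'a::comm_monoid_add"
  assumes Z: "Z \<subseteq> V - {r}" and z: "z \<in> V" "z \<notin> Z"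
  shows "sum f (desc z) =
    (\<Sum>u\<in>{u \<in> V. topmost Z u = z}. f u + (\<Sum>c\<in>{c \<in> V - {r}. par c = u \<and> c \<notin> Z}. sum f (desc c)))"
proof -
  define C where "C = {u \<in> V. topmost Z u = z}"
  define Bd where "Bd = {c \<in> V - {r}. c \<notin> Z \<and> par c \<in> C}"
  have fin: "finite C" "finite Bd" using finite_V by (auto simp: C_def Bd_def)
  have C_desc: "C \<subseteq> desc z" using topmost_props(3)[OF Z] by (auto simp: C_def)
  have cover: "v \<in> C \<or> (\<exists>c\<in>Bd. v \<in> desc c)" if "v \<in> V" "v \<in> desc z" for v
    using that
  proof (induction v rule: parent_induct)
    case root
    then show ?case using z by (auto simp: C_def desc_root_iff root_in topmost_outside)
  next
    case (step v)
    show ?case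
    proof (cases "v = z")
      case True
      then show ?thesis using z by (simp add: C_def topmost_outside)
    next
      case False
      then have "par v \<in> desc z" using step by (simp add: desc_step)
      then consider "par v \<in> C" | c where "c \<in> Bd" "par v \<in> desc c" using step by blast
      then show ?thesis
      proof cases
        case 1
        show ?thesis
        proof (cases "v \<in> Z")
          case True
          then show ?thesis using 1 step topmost_inside[OF Z] by (auto simp: C_def)
        next
          case False
          then show ?thesis using 1 step by (intro disjI2 bexI[of _ v]) (auto simp: Bd_def)
        qed
      next
        case 2
        then show ?thesis using step desc_step by blast
      qed
    qed
  qed
  \<comment> \<open>A hanging subtree containing a cluster node would contain \<open>z\<close>, and
    with it its own attachment point.\<close>
  have below: "x \<notin> desc c" if "c \<in> Bd" "x \<in> C" for c x
  proof
    assume "x \<in> desc c"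
    then have "z \<in> desc c" using that topmost_in_desc[OF Z] by (auto simp: C_def Bd_def)
    moreover have "par c \<in> desc z" using that C_desc by (auto simp: Bd_def)
    ultimately have "par c \<in> desc c" using desc_trans by blast
    then show False using par_not_desc that by (auto simp: Bd_def)
  qed
  have disj: "desc c \<inter> desc c' = {}" if c: "c \<in> Bd" "c' \<in> Bd" "c \<noteq> c'" for c c'
  proof -
    have "c \<notin> desc c'" if "c \<in> Bd" "c' \<in> Bd" "c \<noteq> c'" for c c'
      using that desc_step[of c c'] below[of c' "par c"] by (auto simp: Bd_def)
    then show ?thesis using c desc_linear by blast
  qed
  have "c \<in> desc z" if "c \<in> Bd" for c
    using that C_desc desc_step[of c z] by (auto simp: Bd_def)
  then have "(\<Union>c\<in>Bd. desc c) \<subseteq> desc z" by (simp add: UN_subset_iff desc_mono)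
  moreover have "desc z \<subseteq> C \<union> (\<Union>c\<in>Bd. desc c)" using cover desc_subset[of z] by blast
  ultimately have "desc z = C \<union> (\<Union>c\<in>Bd. desc c)" using C_desc by blast
  moreover have "C \<inter> (\<Union>c\<in>Bd. desc c) = {}" using below by blast
  ultimately have "sum f (desc z) = sum f C + sum f (\<Union>c\<in>Bd. desc c)"
    using fin by (simp add: sum.union_disjoint)
  also have "sum f (\<Union>c\<in>Bd. desc c) = (\<Sum>c\<in>Bd. sum f (desc c))"
    using fin disj by (intro sum.UNION_disjoint) auto
  also have "\<dots> = (\<Sum>u\<in>C. \<Sum>c\<in>{c \<in> Bd. par c = u}. sum f (desc c))"
    using fin by (intro sum.group[symmetric]) (auto simp: Bd_def)
  also have "\<dots> = (\<Sum>u\<in>C. \<Sum>c\<in>{c \<in> V - {r}. par c = u \<and> c \<notin> Z}. sum f (desc c))"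
    by (intro sum.cong refl) (auto simp: Bd_def)
  finally show ?thesis by (simp add: sum.distrib C_def)
qed

end

subsection \<open>Hierarchical clustering by identifier bits\<close>

text \<open>Identifiers may have different lengths; a third digit value marks positions past the
  end, so that distinct identifiers always differ in some digit.\<close>

definition id_digit :: "nat \<Rightarrow> node \<Rightarrow> nat" where
  "id_digit i x = (if i < length x then if x ! i then 1 else 2 else 0)"

lemma id_digit_less: "id_digit i x < 3"
  by (simp add: id_digit_def)

lemma id_digit_differ:
  assumes "x \<noteq> y" "length x \<le> D" "length y \<le> D"
  shows "\<exists>i<D. id_digit i x \<noteq> id_digit i y"
proof (cases "length x = length y")
  case True
  then obtain i where "i < length x" "x ! i \<noteq> y ! i" using assms(1) by (auto simp: list_eq_iff_nth_eq)
  then show ?thesis using True assms by (intro exI[of _ i]) (auto simp: id_digit_def)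
next
  case False
  then show ?thesis using assms
    by (intro exI[of _ "min (length x) (length y)"]) (auto simp: id_digit_def min_def)
qed

text \<open>A step number encodes a position and a digit: within a sweep of \<open>3 * D\<close>
  steps the quotient by 3 is the position, and \<open>k mod 3\<close> is the digit.\<close>

definition digit_index :: "nat \<Rightarrow> nat \<Rightarrow> nat" where
  "digit_index D k = k mod (3 * D) div 3"

definition joins :: "nat \<Rightarrow> nat \<Rightarrow> node \<Rightarrow> node \<Rightarrow> bool" where
  "joins D k x q \<longleftrightarrow>
     id_digit (digit_index D k) x = k mod 3 \<and> id_digit (digit_index D k) q \<noteq> k mod 3"

context rooted_tree
begin

primrec merged :: "nat \<Rightarrow> nat \<Rightarrow> node set" where
  "merged D 0 = {}"
| "merged D (Suc k) = merged D k \<union>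
     {z \<in> V - {r}. z \<notin> merged D k \<and> joins D k z (topmost (merged D k) (par z))}"

lemma merged_subset: "merged D k \<subseteq> V - {r}"
  by (induction k) auto

lemma merged_mono: "k \<le> l \<Longrightarrow> merged D k \<subseteq> merged D l"
  by (rule lift_Suc_mono_le) auto

definition merge_time :: "nat \<Rightarrow> node \<Rightarrow> nat" where
  "merge_time D z = (LEAST k. z \<in> merged D (Suc k))"

lemma merged_iff_merge_time:
  assumes "z \<in> merged D l"
  shows "z \<in> merged D k \<longleftrightarrow> merge_time D z < k"
proof
  assume z: "z \<in> merged D k"
  then obtain k' where k': "k = Suc k'" by (cases k) auto
  then have "merge_time D z \<le> k'" unfolding merge_time_def using z by (intro Least_le) auto
  then show "merge_time D z < k" using k' by simp
next
  assume less: "merge_time D z < k"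
  obtain l' where "l = Suc l'" using assms by (cases l) auto
  then have "z \<in> merged D (Suc (merge_time D z))"
    unfolding merge_time_def using assms by (intro LeastI[where P = "\<lambda>k. z \<in> merged D (Suc k)" and k = l']) blast
  then show "z \<in> merged D k" using less merged_mono[of "Suc (merge_time D z)" k] by auto
qed

lemma merge_time_joins:
  assumes "z \<in> merged D l"
  defines "k \<equiv> merge_time D z"
  shows "z \<notin> merged D k" "joins D k z (topmost (merged D k) (par z))"
  using merged_iff_merge_time[OF assms(1), of k] merged_iff_merge_time[OF assms(1), of "Suc k"]
  by (auto simp: k_def)

text \<open>Simultaneous merges form stars: the receiving cluster has the wrong digit to move itself.\<close>

lemma merge_star:
  assumes "c \<in> merged D l" "z \<in> merged D l" "merge_time D c = merge_time D z"
  shows "topmost (merged D (merge_time D z)) (par c) \<noteq> z"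
  using merge_time_joins[OF assms(1)] merge_time_joins[OF assms(2)] assms(3)
  by (auto simp: joins_def)

text \<open>The split at the clusters just before the step that merges \<open>z\<close>. By
  \<open>merge_star\<close> no uncontracted edge below this cluster is merged in the same step, so
  all of them are strictly later and their sums are known when time runs backwards.\<close>

lemma sum_desc_merge:
  fixes f :: "node \<Rightarrow> 'a::comm_monoid_add"
  assumes all: "merged D l = V - {r}" and z: "z \<in> V - {r}"
  defines "k \<equiv> merge_time D z"
  shows "sum f (desc z) = (\<Sum>u\<in>{u \<in> V. topmost (merged D k) u = z}.
    f u + (\<Sum>c\<in>{c \<in> V - {r}. par c = u \<and> k < merge_time D c}. sum f (desc c)))"
proof -
  have "z \<notin> merged D k" using merge_time_joins(1)[of z D l] z all by (simp add: k_def)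
  then have "sum f (desc z) = (\<Sum>u\<in>{u \<in> V. topmost (merged D k) u = z}.
    f u + (\<Sum>c\<in>{c \<in> V - {r}. par c = u \<and> c \<notin> merged D k}. sum f (desc c)))"
    using z by (intro sum_desc_split merged_subset) auto
  also have "\<dots> = (\<Sum>u\<in>{u \<in> V. topmost (merged D k) u = z}.
    f u + (\<Sum>c\<in>{c \<in> V - {r}. par c = u \<and> k < merge_time D c}. sum f (desc c)))"
  proof -
    have "c \<notin> merged D k \<longleftrightarrow> k < merge_time D c"
      if "c \<in> V - {r}" "topmost (merged D k) (par c) = z" for c
    proof -
      have "merge_time D c \<noteq> k" using merge_star[of c D l z] that all z by (auto simp: k_def)
      moreover have "c \<in> merged D k \<longleftrightarrow> merge_time D c < k"
        using that(1) by (intro merged_iff_merge_time[of c D l]) (simp add: all)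
      ultimately show ?thesis by linarith
    qed
    then show ?thesis by (intro sum.cong refl arg_cong2[where f = "(+)"] Collect_cong) auto
  qed
  finally show ?thesis .
qed

text \<open>If \<open>z\<close> and the name \<open>q\<close> of its parent cluster both survived,
  that cluster would be called \<open>q\<close> during the entire sweep, and \<open>z\<close> would
  join it in the step for its own digit at a position where the two identifiers differ.\<close>

lemma merge_sweep:
  assumes len: "\<And>v. v \<in> V \<Longrightarrow> length v \<le> D"
    and z: "z \<in> V - {r}" "z \<notin> merged D (3 * D * Suc s)"
  shows "topmost (merged D (3 * D * s)) (par z) \<in> merged D (3 * D * Suc s)"
proof (rule ccontr)
  define q where "q = topmost (merged D (3 * D * s)) (par z)"
  assume "topmost (merged D (3 * D * s)) (par z) \<notin> merged D (3 * D * Suc s)"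
  then have q: "q \<notin> merged D (3 * D * Suc s)" by (simp add: q_def)
  have q_anc: "par z \<in> desc q" "q \<in> V"
    using topmost_props[OF merged_subset par_in[OF z(1)]] by (auto simp: q_def)
  then have "z \<noteq> q" using par_not_desc z by blast
  then obtain i where i: "i < D" "id_digit i z \<noteq> id_digit i q"
    using id_digit_differ[of z q D] len z q_anc by auto
  define b where "b = id_digit i z"
  define k where "k = 3 * D * s + (3 * i + b)"
  have b: "b < 3" by (simp add: b_def id_digit_less)
  have lt: "3 * i + b < 3 * D" using i b by linarith
  then have k: "3 * D * s \<le> k" "Suc k \<le> 3 * D * Suc s" by (auto simp: k_def)
  have "k mod (3 * D) = 3 * i + b" using lt by (simp add: k_def)
  then have "digit_index D k = i" using b by (simp add: digit_index_def)
  moreover have "k mod 3 = b"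
  proof -
    have "k = b + 3 * (D * s + i)" by (simp add: k_def algebra_simps)
    then show ?thesis using b by (simp only: mod_mult_self2 mod_less)
  qed
  ultimately have "joins D k z q" using i by (simp add: joins_def b_def)
  moreover have "q \<notin> merged D k" using q k merged_mono[of k "3 * D * Suc s"] by auto
  then have "topmost (merged D k) (par z) = q"
    using topmost_subset[OF merged_mono[OF k(1)] merged_subset par_in[OF z(1)], of D]
    by (simp add: topmost_outside flip: q_def)
  ultimately have "z \<in> merged D (Suc k)" using z by auto
  then show False using z k merged_mono[of "Suc k" "3 * D * Suc s"] by blast
qed

definition unmerged_anc :: "nat \<Rightarrow> nat \<Rightarrow> node \<Rightarrow> node set" where
  "unmerged_anc D k v = {x \<in> V. v \<in> desc x \<and> x \<notin> merged D k}"

text \<open>By the previous lemma, the next surviving ancestor of a survivor of a sweep does not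
  survive it, so a sweep halves the number of clusters met by a root path.\<close>

lemma unmerged_anc_halved:
  assumes len: "\<And>v. v \<in> V \<Longrightarrow> length v \<le> D" and v: "v \<in> V"
  shows "2 * (card (unmerged_anc D (3 * D * Suc s) v) - 1) \<le> card (unmerged_anc D (3 * D * s) v) - 1"
proof -
  let ?k0 = "3 * D * s" and ?k1 = "3 * D * Suc s"
  let ?A0 = "unmerged_anc D ?k0 v" and ?A1 = "unmerged_anc D ?k1 v"
  let ?pr = "\<lambda>x. topmost (merged D ?k0) (par x)"
  have le: "?k0 \<le> ?k1" by simp
  have fin: "finite ?A0" "finite ?A1" using finite_V by (auto simp: unmerged_anc_def)
  have sub: "?A1 \<subseteq> ?A0" using merged_mono[OF le] by (auto simp: unmerged_anc_def)
  \<comment> \<open>The root survives forever; the terms \<open>- 1\<close> leave it out of the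
    count.\<close>
  have rA: "r \<in> unmerged_anc D k v" for k
    using v merged_subset root_in by (auto simp: unmerged_anc_def desc_root)
  have anc: "par x \<in> desc (?pr x)" "?pr x \<in> V" "?pr x \<notin> merged D ?k0" if "x \<in> V - {r}" for x
    using topmost_props[OF merged_subset par_in[OF that]] by auto
  have "?pr ` (?A1 - {r}) \<subseteq> ?A0 - ?A1"
  proof
    fix q assume "q \<in> ?pr ` (?A1 - {r})"
    then obtain x where x: "x \<in> V - {r}" "v \<in> desc x" "x \<notin> merged D ?k1" "q = ?pr x"
      by (auto simp: unmerged_anc_def)
    have "v \<in> desc q" using anc[OF x(1)] x par_desc[OF x(1)] desc_trans by metis
    moreover have "q \<in> merged D ?k1" using merge_sweep[OF len x(1,3)] x by simp
    ultimately show "q \<in> ?A0 - ?A1" using anc[OF x(1)] x by (auto simp: unmerged_anc_def)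
  qed
  moreover have "inj_on ?pr (?A1 - {r})"
  proof (rule inj_onI, rule ccontr)
    \<comment> \<open>If \<open>y\<close> lies below \<open>x\<close>, the climb from
      \<open>par y\<close> stops at \<open>x\<close> or below it, whereas the climb from
      \<open>par x\<close> starts strictly above \<open>x\<close>.\<close>
    have no: False if x: "x \<in> V - {r}" "x \<notin> merged D ?k1" and y: "y \<in> V - {r}"
      and eq: "?pr x = ?pr y" and yx: "y \<in> desc x" "x \<noteq> y" for x y
    proof -
      have "x \<notin> merged D ?k0" using x merged_mono[OF le] by blast
      moreover have "par y \<in> desc x" using yx desc_step[OF y] by auto
      ultimately have "?pr y \<in> desc x" using topmost_in_desc[OF merged_subset] by blast
      then have "par x \<in> desc x" using anc[OF x(1)] eq desc_trans by metis
      then show False using par_not_desc x by blast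
    qed
    fix x y assume "x \<in> ?A1 - {r}" "y \<in> ?A1 - {r}" "?pr x = ?pr y" "x \<noteq> y"
    then show False using no[of x y] no[of y x] desc_linear[of v x y]
      by (auto simp: unmerged_anc_def)
  qed
  ultimately have "card (?A1 - {r}) \<le> card (?A0 - ?A1)" using fin by (metis card_inj_on_le finite_Diff)
  then have "card ?A1 - 1 \<le> card ?A0 - card ?A1"
    using rA fin sub by (simp add: card_Diff_subset)
  moreover have "card ?A1 \<le> card ?A0" using sub fin by (simp add: card_mono)
  ultimately show ?thesis by linarith
qed

text \<open>\<open>D\<close> sweeps of \<open>3 * D\<close> steps divide the number of surviving
  non-root ancestors by \<open>2 ^ D\<close>, which brings it below 1.\<close>

lemma all_merged:
  assumes len: "\<And>v. v \<in> V \<Longrightarrow> length v \<le> D" and card: "card V \<le> 2 ^ D"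
  shows "merged D (3 * D * D) = V - {r}"
proof -
  have "v \<in> merged D (3 * D * D)" if v: "v \<in> V - {r}" for v
  proof (rule ccontr)
    let ?c = "\<lambda>s. card (unmerged_anc D (3 * D * s) v) - 1"
    assume n: "v \<notin> merged D (3 * D * D)"
    have "2 ^ s * ?c s \<le> ?c 0" for s
    proof (induction s)
      case (Suc s)
      have "2 ^ Suc s * ?c (Suc s) = 2 ^ s * (2 * ?c (Suc s))" by simp
      also have "\<dots> \<le> 2 ^ s * ?c s" using unmerged_anc_halved[OF len, of v s] v by (intro mult_left_mono) auto
      also note Suc
      finally show ?case .
    qed simp
    then have "2 ^ D * ?c D \<le> ?c 0" .
    also have "\<dots> < card V"
    proof -
      have "card (unmerged_anc D (3 * D * 0) v) \<le> card V"
        using finite_V by (intro card_mono) (auto simp: unmerged_anc_def)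
      moreover have "0 < card V" using root_in finite_V by (auto simp: card_gt_0_iff)
      ultimately show ?thesis by linarith
    qed
    finally have "?c D = 0" using card by (cases "?c D") auto
    moreover have "{v, r} \<subseteq> unmerged_anc D (3 * D * D) v"
      using v n merged_subset root_in by (auto simp: unmerged_anc_def desc_root)
    then have "card {v, r} \<le> card (unmerged_anc D (3 * D * D) v)"
      using finite_V by (intro card_mono) (auto simp: unmerged_anc_def)
    ultimately show False using v by simp
  qed
  then show ?thesis using merged_subset by blast
qed

subsection \<open>Cut values via size classes\<close>

text \<open>The root gets the dummy size 0, which keeps it out of all size classes.\<close>

definition subtree_size :: "node \<Rightarrow> nat" where
  "subtree_size v = (if v = r then 0 else card (desc v))"

definition in_class :: "nat \<Rightarrow> node \<Rightarrow> bool" where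
  "in_class j v \<longleftrightarrow> 2 ^ j \<le> subtree_size v \<and> subtree_size v < 2 ^ Suc j"

text \<open>Contracting these edges turns each maximal non-root subtree of size below
  \<open>2 ^ Suc j\<close> into one supernode and leaves all other nodes alone.\<close>

definition small_parent :: "nat \<Rightarrow> node set" where
  "small_parent j = {z \<in> V - {r}. 0 < subtree_size (par z) \<and> subtree_size (par z) < 2 ^ Suc j}"

text \<open>Inside such a maximal subtree the nodes left uncontracted are its class \<open>j\<close>
  nodes, or just its top if it has none.\<close>

definition hanging :: "nat \<Rightarrow> node set" where
  "hanging j = {z \<in> small_parent j. subtree_size z < 2 ^ j}"

lemma small_parent_subset: "small_parent j \<subseteq> V - {r}"
  by (auto simp: small_parent_def)

lemma hanging_subset: "hanging j \<subseteq> V - {r}"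
  by (auto simp: hanging_def small_parent_def)

lemma in_class_not_root: "in_class j v \<Longrightarrow> v \<noteq> r"
  by (auto simp: in_class_def subtree_size_def)

lemma desc_not_root: "v \<in> desc x \<Longrightarrow> x \<noteq> r \<Longrightarrow> v \<noteq> r"
  using desc_root_iff by blast

lemma subtree_size_mono: "v \<in> desc x \<Longrightarrow> x \<noteq> r \<Longrightarrow> subtree_size v \<le> subtree_size x"
  using desc_not_root[of v x] by (auto simp: subtree_size_def card_mono desc_mono)

lemma subtree_size_strict_mono:
  assumes "v \<in> desc x" "x \<noteq> r" "v \<noteq> x"
  shows "subtree_size v < subtree_size x"
proof -
  have "x \<in> desc x" using assms desc_imp_in by simp
  then have "desc v \<subset> desc x" using assms desc_mono[of v x] desc_antisym[of v x] by auto
  then show ?thesis using assms desc_not_root[of v x] by (auto simp: subtree_size_def psubset_card_mono)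
qed

lemma subtree_size_pos: "v \<in> V - {r} \<Longrightarrow> 0 < subtree_size v"
  using desc_self[of v] by (auto simp: subtree_size_def card_gt_0_iff simp del: desc_self)

text \<open>Two disjoint subtrees of at least \<open>2 ^ j\<close> nodes do not fit into fewer than
  \<open>2 ^ Suc j\<close> nodes.\<close>

lemma in_class_comparable:
  assumes "in_class j a" "in_class j b" "in_class j q" "a \<in> desc q" "b \<in> desc q"
  shows "a \<in> desc b \<or> b \<in> desc a"
proof (rule ccontr)
  assume "\<not> ?thesis"
  then have "desc a \<inter> desc b = {}" using desc_linear by blast
  then have "card (desc a) + card (desc b) = card (desc a \<union> desc b)"
    by (simp add: card_Un_disjoint)
  also have "\<dots> \<le> card (desc q)" using assms by (intro card_mono) (auto dest: desc_mono)
  finally have "subtree_size a + subtree_size b \<le> subtree_size q" using assms in_class_not_root by (simp add: subtree_size_def)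
  then show False using assms by (auto simp: in_class_def)
qed

text \<open>Every node below \<open>x\<close> that is too small for the class is contracted, so a
  climb from below \<open>x\<close> ends at a class node below \<open>x\<close>. Thus an endpoint
  may be replaced by its path node.\<close>

lemma in_desc_iff_hanging:
  assumes x: "x \<in> V" "in_class j x" and v: "v \<in> V"
  shows "v \<in> desc x \<longleftrightarrow> topmost (hanging j) v \<in> desc x \<and> in_class j (topmost (hanging j) v)"
    (is "_ \<longleftrightarrow> ?t \<in> _ \<and> _")
proof
  assume "?t \<in> desc x \<and> in_class j ?t"
  then show "v \<in> desc x" using topmost_props(3)[OF hanging_subset v] desc_trans by blast
next
  assume vx: "v \<in> desc x"
  have "x \<notin> hanging j" using x by (auto simp: hanging_def in_class_def)
  then have t: "?t \<in> desc x" using topmost_in_desc[OF hanging_subset vx] by blast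
  have xr: "x \<noteq> r" using x in_class_not_root by blast
  have "in_class j ?t"
  proof (cases "?t = x")
    case False
    have tV: "?t \<in> V - {r}" using topmost_props[OF hanging_subset v] t xr desc_not_root by blast
    then have p: "par ?t \<in> desc x" using t False desc_step by blast
    then have "subtree_size (par ?t) \<le> subtree_size x" "0 < subtree_size (par ?t)"
      using xr subtree_size_mono subtree_size_pos desc_not_root desc_subset by blast+
    then have "?t \<in> small_parent j" using x tV by (auto simp: small_parent_def in_class_def)
    then have "2 ^ j \<le> subtree_size ?t" using topmost_props(2)[OF hanging_subset v, of j] unfolding hanging_def[of j] by simp
    then show ?thesis using subtree_size_mono[OF t xr] x by (auto simp: in_class_def)
  qed (use x in simp)
  then show "?t \<in> desc x \<and> in_class j ?t" using t by blast
qed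

text \<open>All parents inside the subtree of \<open>x\<close> have sizes below
  \<open>2 ^ Suc j\<close>, so the subtree stays in one supernode.\<close>

lemma topmost_small_parent_desc:
  assumes x: "x \<in> V" "in_class j x" and v: "v \<in> desc x"
  shows "topmost (small_parent j) v = topmost (small_parent j) x"
proof -
  have "v \<in> V" using v desc_subset by blast
  then show ?thesis using v
  proof (induction v rule: parent_induct)
    case root
    then show ?case by (simp add: desc_root_iff)
  next
    case (step v)
    have xr: "x \<noteq> r" using x in_class_not_root by blast
    show ?case
    proof (cases "v = x")
      case False
      then have p: "par v \<in> desc x" using step desc_step by blast
      then have "subtree_size (par v) \<le> subtree_size x" "0 < subtree_size (par v)"
        using xr subtree_size_mono subtree_size_pos desc_not_root desc_subset by blast+
      then have "v \<in> small_parent j" using x step by (auto simp: small_parent_def in_class_def)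
      then show ?thesis using step p topmost_inside[OF small_parent_subset] by simp
    qed simp
  qed
qed

text \<open>The climb passes only nodes of size below \<open>2 ^ Suc j\<close>, and sizes grow
  upwards, so it ends in the class where it began.\<close>

lemma topmost_small_parent_class:
  assumes x: "x \<in> V" "in_class j x"
  shows "in_class j (topmost (small_parent j) x)"
proof -
  let ?q = "topmost (small_parent j) x"
  have "?q = x \<or> (0 < subtree_size ?q \<and> subtree_size ?q < 2 ^ Suc j)"
    using small_parent_subset[of j] x(1)
  proof (induction x rule: topmost_induct)
    case (inside v)
    then show ?case using topmost_inside[OF small_parent_subset inside(1)]
      by (auto simp: small_parent_def)
  qed (simp add: topmost_outside)
  then show ?thesis
  proof
    assume q: "0 < subtree_size ?q \<and> subtree_size ?q < 2 ^ Suc j"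
    then have "?q \<noteq> r" by (auto simp: subtree_size_def)
    then have "subtree_size x \<le> subtree_size ?q" using subtree_size_mono topmost_props(3)[OF small_parent_subset x(1)] by blast
    then show ?thesis using q x by (simp add: in_class_def)
  qed (use x in simp)
qed

text \<open>Sizes strictly increase up a path, so the larger size marks the upper path node; the
  test with \<open>small_parent\<close> detects endpoints on different paths.\<close>

definition signed_weight :: "(edge \<Rightarrow> nat) \<Rightarrow> nat \<Rightarrow> edge \<Rightarrow> node \<Rightarrow> int" where
  "signed_weight w j e v =
     (if \<not> in_minor (small_parent j) e \<and>
         (\<exists>u\<in>e. subtree_size (topmost (hanging j) u) < subtree_size (topmost (hanging j) v))
      then - int (w e) else int (w e))"

definition class_value :: "edge set \<Rightarrow> (edge \<Rightarrow> nat) \<Rightarrow> nat \<Rightarrow> node \<Rightarrow> int" where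
  "class_value E w j a = (if in_class j a
     then \<Sum>(e, v)\<in>{(e, v). e \<in> E \<and> in_minor (hanging j) e \<and> v \<in> e \<and>
                     topmost (hanging j) v = topmost (hanging j) a}. signed_weight w j e v
     else 0)"

text \<open>With both ends below \<open>x\<close>, distinct path nodes lie on one path and their
  opposite charges cancel. With one end below \<open>x\<close>, the path node of the other end is on
  another path, or strictly above \<open>x\<close>, or is no class node of this path; so the inner
  charge is positive and the edge is not contracted away.\<close>

lemma signed_weight_inside_sum:
  assumes x: "x \<in> V" "in_class j x" and uv: "u \<in> V" "v \<in> V" "u \<noteq> v"
  shows "in_minor (hanging j) {u, v} \<Longrightarrow>
      (\<Sum>a\<in>{u, v} \<inter> desc x. signed_weight w j {u, v} a) =
      (if card ({u, v} \<inter> desc x) = 1 then int (w {u, v}) else 0)"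
    and "card ({u, v} \<inter> desc x) = 1 \<Longrightarrow> in_minor (hanging j) {u, v}"
proof -
  let ?t = "topmost (hanging j)" and ?s = "topmost (small_parent j)" and ?e = "{u, v}"
  have xr: "x \<noteq> r" using x in_class_not_root by blast
  have one: "in_minor (hanging j) {a, b} \<and> signed_weight w j {a, b} a = int (w {a, b})"
    if ab: "a \<in> V" "b \<in> V" "a \<in> desc x" "b \<notin> desc x" for a b
  proof -
    have ta: "?t a \<in> desc x" "in_class j (?t a)" using in_desc_iff_hanging[OF x ab(1)] ab by auto
    have tb: "\<not> (?t b \<in> desc x \<and> in_class j (?t b))" using in_desc_iff_hanging[OF x ab(2)] ab by auto
    have "\<not> subtree_size (?t b) < subtree_size (?t a)" if same: "?s a = ?s b"
    proof -
      let ?q = "?s x"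
      have q: "in_class j ?q" "?q \<in> V" "x \<in> desc ?q"
        using topmost_small_parent_class[OF x] topmost_props[OF small_parent_subset x(1)] by auto
      have "?s b = ?q" using topmost_small_parent_desc[OF x ab(3)] same by simp
      then have "b \<in> desc ?q" using topmost_props(3)[OF small_parent_subset ab(2), of j] by simp
      then have tb': "?t b \<in> desc ?q" "in_class j (?t b)"
        using in_desc_iff_hanging[OF q(2,1) ab(2)] by auto
      then have "x \<in> desc (?t b)"
        using in_class_comparable[OF x(2) tb'(2) q(1,3) tb'(1)] tb by auto
      then have "subtree_size x \<le> subtree_size (?t b)" using subtree_size_mono tb'(2) in_class_not_root by blast
      moreover have "subtree_size (?t a) \<le> subtree_size x" using subtree_size_mono[OF ta(1) xr] .
      ultimately show ?thesis by simp
    qed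
    then have "signed_weight w j {a, b} a = int (w {a, b})"
      by (auto simp: signed_weight_def in_minor_def)
    moreover have "?t a \<noteq> ?t b" using ta tb by auto
    ultimately show ?thesis by (auto simp: in_minor_def)
  qed
  have two: "signed_weight w j ?e u + signed_weight w j ?e v = 0"
    if "u \<in> desc x" "v \<in> desc x" "in_minor (hanging j) ?e"
  proof -
    have "?t u \<noteq> ?t v" using that by (auto simp: in_minor_def)
    moreover have t: "?t u \<in> desc x" "in_class j (?t u)" "?t v \<in> desc x" "in_class j (?t v)"
      using in_desc_iff_hanging[OF x uv(1)] in_desc_iff_hanging[OF x uv(2)] that by auto
    moreover have "?t u \<in> desc (?t v) \<or> ?t v \<in> desc (?t u)"
      using in_class_comparable[OF t(2,4) x(2) t(1,3)] .
    ultimately have "subtree_size (?t u) \<noteq> subtree_size (?t v)"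
      using subtree_size_strict_mono[of "?t u" "?t v"] subtree_size_strict_mono[of "?t v" "?t u"] in_class_not_root
      by auto
    moreover have "\<not> in_minor (small_parent j) ?e"
      using topmost_small_parent_desc[OF x] that by (auto simp: in_minor_def)
    ultimately show ?thesis by (auto simp: signed_weight_def)
  qed
  show "(\<Sum>a\<in>?e \<inter> desc x. signed_weight w j ?e a) = (if card (?e \<inter> desc x) = 1 then int (w ?e) else 0)"
    if "in_minor (hanging j) ?e"
    using one[of u v] one[of v u] two that uv by (auto simp: Int_insert_left insert_commute)
  show "in_minor (hanging j) ?e" if "card (?e \<inter> desc x) = 1"
    using one[of u v] one[of v u] that uv by (auto simp: Int_insert_left insert_commute split: if_splits)
qed

text \<open>The charges of the path nodes below \<open>x\<close> are regrouped by edge; by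
  \<open>in_desc_iff_hanging\<close> the endpoints involved are exactly those in
  \<open>desc x\<close>.\<close>

lemma sum_class_value:
  assumes E: "finite E" "\<And>e. e \<in> E \<Longrightarrow> e \<subseteq> V \<and> card e = 2" and x: "x \<in> V" "in_class j x"
  shows "(\<Sum>a\<in>desc x. class_value E w j a) = int (\<Sum>e\<in>{e \<in> E. card (e \<inter> desc x) = 1}. w e)"
proof -
  let ?t = "topmost (hanging j)"
  let ?g = "\<lambda>(e, v). signed_weight w j e v"
  define M where "M = {e \<in> E. in_minor (hanging j) e}"
  define P where "P = {(e, v). e \<in> M \<and> v \<in> e}"
  define A where "A = {a \<in> desc x. in_class j a}"
  have finM: "finite M" using E by (simp add: M_def)
  have fin_e: "finite e" if "e \<in> M" for e using E that finite_V by (auto simp: M_def intro: finite_subset)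
  have P: "P = Sigma M (\<lambda>e. e)" by (auto simp: P_def)
  have finP: "finite P" unfolding P using finM fin_e by (intro finite_SigmaI)
  have t_self: "?t a = a" if "a \<in> A" for a
    using that by (intro topmost_outside) (auto simp: A_def hanging_def in_class_def)
  have "(\<Sum>a\<in>desc x. class_value E w j a) = (\<Sum>a\<in>A. class_value E w j a)"
    by (intro sum.mono_neutral_right) (auto simp: A_def class_value_def)
  also have "\<dots> = (\<Sum>a\<in>A. \<Sum>p\<in>{p \<in> {p \<in> P. ?t (snd p) \<in> A}. ?t (snd p) = a}. ?g p)"
    using t_self by (intro sum.cong refl) (auto simp: class_value_def A_def P_def M_def intro!: sum.cong)
  also have "\<dots> = (\<Sum>p\<in>{p \<in> P. ?t (snd p) \<in> A}. ?g p)"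
    using finP by (intro sum.group) (auto simp: A_def)
  also have "{p \<in> P. ?t (snd p) \<in> A} = Sigma M (\<lambda>e. e \<inter> desc x)"
    using in_desc_iff_hanging[OF x] E by (fastforce simp: P A_def M_def)
  also have "(\<Sum>p\<in>\<dots>. ?g p) = (\<Sum>e\<in>M. \<Sum>v\<in>e \<inter> desc x. signed_weight w j e v)"
    using finM fin_e by (intro sum.Sigma[symmetric]) auto
  also have "\<dots> = (\<Sum>e\<in>M. if card (e \<inter> desc x) = 1 then int (w e) else 0)"
  proof (intro sum.cong refl)
    fix e assume e: "e \<in> M"
    then obtain u v where "e = {u, v}" "u \<noteq> v" "u \<in> V" "v \<in> V"
      using E(2)[of e] by (auto simp: M_def card_2_iff)
    then show "(\<Sum>v\<in>e \<inter> desc x. signed_weight w j e v) = (if card (e \<inter> desc x) = 1 then int (w e) else 0)"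
      using signed_weight_inside_sum(1)[OF x] e by (auto simp: M_def)
  qed
  also have "\<dots> = (\<Sum>e\<in>{e \<in> M. card (e \<inter> desc x) = 1}. int (w e))"
    using finM by (simp add: sum.inter_filter)
  also have "{e \<in> M. card (e \<inter> desc x) = 1} = {e \<in> E. card (e \<inter> desc x) = 1}"
  proof -
    have "e \<in> M" if e: "e \<in> E" "card (e \<inter> desc x) = 1" for e
    proof -
      obtain u v where "e = {u, v}" "u \<noteq> v" "u \<in> V" "v \<in> V"
        using E(2)[OF e(1)] by (auto simp: card_2_iff)
      then show ?thesis using signed_weight_inside_sum(2)[OF x] e by (auto simp: M_def)
    qed
    then show ?thesis by (auto simp: M_def)
  qed
  finally show ?thesis by simp
qed

end

subsection \<open>Messages and their combination\<close>

text \<open>The low \<open>D\<close> bits in two's complement, least significant first; negative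
  charges thus need no sign.\<close>

definition enc :: "nat \<Rightarrow> int \<Rightarrow> bits" where
  "enc D z = map (bit z) [0..<D]"

definition dec :: "bits \<Rightarrow> int" where
  "dec xs = horner_sum of_bool 2 xs"

lemma length_enc [simp]: "length (enc D z) = D"
  by (simp add: enc_def)

lemma dec_enc: "dec (enc D z) = z mod 2 ^ D"
  by (simp add: dec_def enc_def horner_sum_bit_eq_take_bit take_bit_eq_mod)

lemma enc_mod: "enc D (z mod 2 ^ D) = enc D z"
  by (simp add: enc_def bit_take_bit_iff flip: take_bit_eq_mod)

text \<open>Lengths come first: \<open>[]\<close> is the least message, unary messages compare by
  length, equally long messages by value.\<close>

definition rank_le :: "bits \<Rightarrow> bits \<Rightarrow> bool" where
  "rank_le x y \<longleftrightarrow> length x < length y \<or> length x = length y \<and> dec x \<le> dec y"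

text \<open>A leading \<open>True\<close> marks summands modulo a power of two; all other messages compete for the
  maximum. A single operator thus serves all rounds, although the schedule depends on the input.\<close>

fun combine :: "bits \<Rightarrow> bits \<Rightarrow> bits" where
  "combine (True # x) (True # y) = True # enc (max (length x) (length y)) (dec x + dec y)"
| "combine x y = (if rank_le x y then y else x)"

text \<open>The sum is truncated to the longer argument, dropping the carry; this bound on the
  length is what forces modular sums.\<close>

lemma aggregation_operator_combine: "aggregation_operator combine"
proof -
  have "length (combine x y) \<le> B" if "length x \<le> B" "length y \<le> B" for x y B
    using that by (cases "(x, y)" rule: combine.cases) auto
  then show ?thesis by (simp add: aggregation_operator_def)
qed

lemma combine_sum: "combine (True # enc D a) (True # enc D b) = True # enc D (a + b)"
proof -
  have "enc D (a mod 2 ^ D + b mod 2 ^ D) = enc D (a + b)"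
    by (metis enc_mod mod_add_eq)
  then show ?thesis by (simp add: dec_enc)
qed

text \<open>Modular addition gives the same encoding for every order of aggregation, which removes
  the nondeterminism of the model.\<close>

lemma aggregates_sum:
  assumes "aggregates combine M x" "M = image_mset (\<lambda>p. True # enc D (g p)) N"
  shows "x = True # enc D (\<Sum>p\<in>#N. g p)"
  using assms
proof (induction arbitrary: N rule: aggregates.induct)
  case (single x)
  then have "size N = 1" by (metis size_image_mset size_single)
  then obtain p where "N = {#p#}" by (metis One_nat_def size_1_singleton_mset)
  then show ?case using single by simp
next
  case (merge M x M' y)
  from image_mset_eq_plusD[OF merge.prems[symmetric]]
  obtain N1 N2 where "N = N1 + N2" "M = image_mset (\<lambda>p. True # enc D (g p)) N1"
    "M' = image_mset (\<lambda>p. True # enc D (g p)) N2"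
    by blast
  then show ?case using merge.IH combine_sum by simp
qed

lemma aggregates_sum_set:
  assumes "aggregates combine (image_mset h (mset_set A)) x" "\<And>p. p \<in> A \<Longrightarrow> h p = True # enc D (g p)"
    and "finite A"
  shows "x = True # enc D (sum g A)"
proof -
  have "image_mset h (mset_set A) = image_mset (\<lambda>p. True # enc D (g p)) (mset_set A)"
    using assms(2,3) by (intro image_mset_cong) auto
  then show ?thesis using aggregates_sum[OF assms(1)] unfolding sum_unfold_sum_mset by blast
qed

text \<open>No incident edge means an empty sum, hence the default 0.\<close>

definition received :: "bits option \<Rightarrow> int" where
  "received a = (case a of None \<Rightarrow> 0 | Some x \<Rightarrow> dec (tl x))"

lemma aggregates_opt_sum_set:
  assumes "aggregates_opt combine (image_mset h (mset_set A)) a" "\<And>p. p \<in> A \<Longrightarrow> h p = True # enc D (g p)"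
    and "finite A"
  shows "received a = sum g A mod 2 ^ D"
proof (cases a)
  case None
  then have "A = {}" using assms(1,3) by (simp add: aggregates_opt_def mset_set_empty_iff)
  then show ?thesis using None by (simp add: received_def)
next
  case (Some x)
  then have "aggregates combine (image_mset h (mset_set A)) x"
    using assms(1) by (simp add: aggregates_opt_def)
  then have "x = True # enc D (sum g A)" using assms(2,3) by (rule aggregates_sum_set)
  then show ?thesis using Some by (simp add: received_def dec_enc)
qed

lemma rank_le_linear: "rank_le x y \<or> rank_le y x"
  by (auto simp: rank_le_def)

lemma rank_le_trans: "rank_le x y \<Longrightarrow> rank_le y z \<Longrightarrow> rank_le x z"
  by (auto simp: rank_le_def)

lemma combine_max: "\<not> (x \<noteq> [] \<and> hd x) \<Longrightarrow> combine x y = (if rank_le x y then y else x)"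
  by (cases "(x, y)" rule: combine.cases) auto

lemma aggregates_max:
  assumes "aggregates combine M x" "\<And>m. m \<in># M \<Longrightarrow> m = [] \<or> \<not> hd m"
  shows "x \<in># M \<and> (\<forall>m\<in>#M. rank_le m x)"
  using assms
proof (induction rule: aggregates.induct)
  case (single x)
  then show ?case by (simp add: rank_le_def)
next
  case (merge M x M' y)
  then have IH: "x \<in># M" "\<forall>m\<in>#M. rank_le m x" "y \<in># M'" "\<forall>m\<in>#M'. rank_le m y" by auto
  then have "combine x y = (if rank_le x y then y else x)" using merge.prems by (intro combine_max) auto
  moreover have "rank_le m (if rank_le x y then y else x)" if "m \<in># M + M'" for m
    using that IH rank_le_linear[of x y] rank_le_trans[of m x y] rank_le_trans[of m y x] by auto
  ultimately show ?case using IH by auto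
qed

lemma aggregates_max_set:
  assumes "aggregates combine (image_mset h (mset_set A)) x" "\<And>p. p \<in> A \<Longrightarrow> h p = [] \<or> \<not> hd (h p)"
    and "finite A"
  shows "x \<in> h ` A" "\<And>p. p \<in> A \<Longrightarrow> rank_le (h p) x"
  using aggregates_max[OF assms(1)] assms(2,3) by auto

lemma aggregates_opt_max_set:
  assumes "aggregates_opt combine (image_mset h (mset_set A)) a" "\<And>p. p \<in> A \<Longrightarrow> h p = [] \<or> \<not> hd (h p)"
    and "finite A"
  shows "case a of None \<Rightarrow> A = {} | Some x \<Rightarrow> x \<in> h ` A \<and> (\<forall>p\<in>A. rank_le (h p) x)"
proof (cases a)
  case None
  then show ?thesis using assms(1,3) by (simp add: aggregates_opt_def mset_set_empty_iff)
next
  case (Some x)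
  then have "aggregates combine (image_mset h (mset_set A)) x"
    using assms(1) by (simp add: aggregates_opt_def)
  from aggregates_max_set[OF this assms(2,3)] show ?thesis using Some by simp
qed

subsection \<open>The algorithm\<close>

text \<open>One instruction per round. \<open>Probe\<close>, \<open>Gather\<close> and
  \<open>Announce\<close> settle the width; \<open>Tell_Node\<close> and \<open>Tell_Edge\<close>
  spread the subtree sizes; \<open>Separate\<close>, \<open>Charge\<close>, a summation and
  \<open>Record\<close> treat one size class.\<close>

datatype instr = Probe | Gather | Announce | Merge nat | Push nat | Pull nat
  | Tell_Node | Tell_Edge | Separate nat | Charge nat | Record nat

text \<open>\<open>D\<close> sweeps over \<open>D\<close> positions and 3 digits.\<close>

definition merge_steps :: "nat \<Rightarrow> nat" where
  "merge_steps D = 3 * D * D"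

definition sum_prog :: "nat \<Rightarrow> instr list" where
  "sum_prog K = concat (map (\<lambda>k. [Push k, Pull k]) (rev [0..<K]))"

definition class_prog :: "nat \<Rightarrow> nat \<Rightarrow> instr list" where
  "class_prog D j = [Separate j, Charge j] @ sum_prog (merge_steps D) @ [Record j]"

definition prog :: "nat \<Rightarrow> instr list" where
  "prog D = map Merge [0..<merge_steps D] @ sum_prog (merge_steps D) @ [Tell_Node, Tell_Edge] @
     concat (map (class_prog D) [0..<D])"

lemma sum_prog_Suc: "sum_prog (Suc k) = Push k # Pull k # sum_prog k"
  by (simp add: sum_prog_def)

lemma length_sum_prog: "length (sum_prog k) = 2 * k"
  by (induction k) (simp_all add: sum_prog_Suc, simp add: sum_prog_def)

definition run_length :: "nat \<Rightarrow> nat" where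
  "run_length D = 3 + length (prog D)"

text \<open>The 5 counts the three setup rounds and the two \<open>Tell\<close> rounds; the factor 3
  is one merging and two summation rounds per step.\<close>

lemma run_length_eq: "run_length D = 5 + 3 * merge_steps D + D * (3 + 2 * merge_steps D)"
  by (simp add: run_length_def prog_def class_prog_def length_concat comp_def
      length_sum_prog sum_list_triv algebra_simps)

lemma run_length_mono: "D \<le> D' \<Longrightarrow> run_length D \<le> run_length D'"
  unfolding run_length_eq merge_steps_def by (intro add_mono mult_mono) auto

definition setup_prog :: "instr list" where
  "setup_prog = [Probe, Gather, Announce]"

text \<open>If all identifiers have length at most \<open>m\<close> and all weights are below \<open>2 ^ m\<close>, then the number
  of nodes and all cut values are below \<open>2 ^ width m\<close>.\<close>

definition width :: "nat \<Rightarrow> nat" where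
  "width m = 3 * m + 3"

text \<open>The memory of a unit is folded into a state that carries the rounds still to be played; the
  \<open>Announce\<close> round replaces them by the schedule for the width agreed upon. A subtree sum takes one
  pair of rounds per merge step: \<open>Push k\<close> hands the sums of edges merged later to their upper
  endpoints, \<open>Pull k\<close> evaluates the clusters before step \<open>k\<close>.\<close>

record node_state =
  nid :: node
  nunary :: bits
  ntop :: bool
  nval :: int
  npend :: int
  nsize :: int
  ntodo :: "instr list"

record edge_state =
  einp :: edge_input
  emax :: nat
  etime :: nat
  esum :: int
  esize :: "node \<Rightarrow> int"
  esep :: bool
  eres :: int
  etodo :: "instr list"

definition nwidth :: "node_state \<Rightarrow> nat" where
  "nwidth s = width (length (nunary s))"

definition ewidth :: "edge_state \<Rightarrow> nat" where
  "ewidth s = width (emax s)"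

definition upper :: "edge_state \<Rightarrow> node" where
  "upper s = the (closer_to_root (einp s))"

definition lower :: "edge_state \<Rightarrow> node" where
  "lower s = the_elem (ends (einp s) - {upper s})"

definition bit_length :: "nat \<Rightarrow> nat" where
  "bit_length n = (LEAST b. n < 2 ^ b)"

text \<open>An edge knows its weight and both identifiers, so it can bound the bits of each by their
  total.\<close>

definition probe_length :: "edge_input \<Rightarrow> nat" where
  "probe_length i = bit_length (weight i) + (\<Sum>v\<in>ends i. length v)"

text \<open>In \<open>Merge\<close> only topmost nodes speak, so the maximum over a supernode is its
  name; in \<open>Charge\<close> the maximum is the size of the topmost node.\<close>

fun node_message :: "instr \<Rightarrow> node_state \<Rightarrow> bits" where
  "node_message Gather s = nunary s"
| "node_message Announce s = nunary s"
| "node_message (Merge k) s = (if ntop s then False # nid s else [])"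
| "node_message (Pull k) s = True # enc (nwidth s) (nval s + npend s)"
| "node_message Tell_Edge s = True # enc (nwidth s) (nsize s)"
| "node_message (Charge j) s = False # enc (nwidth s) (nsize s)"
| "node_message _ s = []"

text \<open>In \<open>Merge\<close> all nodes of a joining cluster receive \<open>[False]\<close>,
  but only the topmost one still has a flag to lose.\<close>

fun node_update :: "instr \<Rightarrow> node_entry \<Rightarrow> node_state \<Rightarrow> node_state" where
  "node_update Probe (y, a) s = s\<lparr>nunary := (case a of None \<Rightarrow> [] | Some x \<Rightarrow> x)\<rparr>"
| "node_update Gather (y, a) s = s\<lparr>nunary := y\<rparr>"
| "node_update (Merge k) (y, a) s = s\<lparr>ntop := (ntop s \<and> a \<noteq> Some [False])\<rparr>"
| "node_update (Push k) (y, a) s = s\<lparr>npend := received a\<rparr>"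
| "node_update Tell_Node (y, a) s = s\<lparr>nsize := received a\<rparr>"
| "node_update (Charge j) (y, a) s =
     s\<lparr>nval := (if 2 ^ j \<le> nsize s \<and> nsize s < 2 ^ Suc j then received a else 0)\<rparr>"
| "node_update _ _ s = s"

definition edge_joins :: "nat \<Rightarrow> edge_state \<Rightarrow> edge_entry \<Rightarrow> bool" where
  "edge_joins k s l \<longleftrightarrow> in_tree (einp s) \<and> \<not> etime s < k \<and>
     joins (ewidth s) k (lower s) (tl (the (l (upper s))))"

fun edge_contracts :: "instr \<Rightarrow> edge_state \<Rightarrow> bool" where
  "edge_contracts Gather s = in_tree (einp s)"
| "edge_contracts (Merge k) s = (in_tree (einp s) \<and> etime s < k)"
| "edge_contracts (Pull k) s = (in_tree (einp s) \<and> etime s < k)"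
| "edge_contracts (Separate j) s = (in_tree (einp s) \<and>
     0 < esize s (upper s) \<and> esize s (upper s) < 2 ^ Suc j)"
| "edge_contracts (Charge j) s = (in_tree (einp s) \<and>
     0 < esize s (upper s) \<and> esize s (upper s) < 2 ^ Suc j \<and> esize s (lower s) < 2 ^ j)"
| "edge_contracts _ s = False"

text \<open>In summation rounds an edge with nothing to add sends an encoded zero, so that all
  messages have the form expected by \<open>aggregates_sum\<close>.\<close>

fun edge_message :: "instr \<Rightarrow> edge_state \<Rightarrow> edge_entry \<Rightarrow> node \<Rightarrow> bits" where
  "edge_message Probe s l v = replicate (probe_length (einp s)) False"
| "edge_message (Merge k) s l v = (if edge_joins k s l \<and> v = lower s then [False] else [])"
| "edge_message (Push k) s l v = True # enc (ewidth s)
     (if in_tree (einp s) \<and> v = upper s \<and> k < etime s then esum s else 0)"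
| "edge_message Tell_Node s l v = True # enc (ewidth s)
     (if in_tree (einp s) \<and> v = lower s then esum s else 0)"
| "edge_message (Charge j) s l v = True # enc (ewidth s)
     (if \<not> esep s \<and> (\<exists>u\<in>ends (einp s). dec (tl (the (l u))) < dec (tl (the (l v))))
      then - int (weight (einp s)) else int (weight (einp s)))"
| "edge_message _ s l v = []"

text \<open>\<open>Announce\<close> sets \<open>etime\<close> to a value above all steps, meaning
  not merged yet. Either endpoint may be read there because all nodes announce the same
  length.\<close>

fun edge_update :: "instr \<Rightarrow> edge_entry \<Rightarrow> edge_state \<Rightarrow> edge_state" where
  "edge_update Announce l s = (let m = length (the (l (SOME v. v \<in> ends (einp s))))
     in s\<lparr>emax := m, etime := merge_steps (width m)\<rparr>)"
| "edge_update (Merge k) l s = (if edge_joins k s l then s\<lparr>etime := k\<rparr> else s)"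
| "edge_update (Pull k) l s = (if etime s = k then s\<lparr>esum := dec (tl (the (l (lower s))))\<rparr> else s)"
| "edge_update Tell_Edge l s = s\<lparr>esize := (\<lambda>u. dec (tl (the (l u))))\<rparr>"
| "edge_update (Separate j) l s = s\<lparr>esep := (\<exists>u. l u \<noteq> None)\<rparr>"
| "edge_update (Record j) l s =
     (if 2 ^ j \<le> esize s (lower s) \<and> esize s (lower s) < 2 ^ Suc j then s\<lparr>eres := esum s\<rparr> else s)"
| "edge_update _ l s = s"

definition node_step :: "node_state \<Rightarrow> node_entry \<Rightarrow> node_state" where
  "node_step s x = (case ntodo s of [] \<Rightarrow> s | i # is \<Rightarrow>
     (node_update i x s)\<lparr>ntodo := (if i = Announce then prog (nwidth s) else is)\<rparr>)"

definition edge_step :: "edge_state \<Rightarrow> edge_entry \<Rightarrow> edge_state" where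
  "edge_step s l = (case etodo s of [] \<Rightarrow> s | i # is \<Rightarrow> (let s' = edge_update i l s in
     s'\<lparr>etodo := (if i = Announce then prog (ewidth s') else is)\<rparr>))"

definition node_init :: "node \<Rightarrow> node_state" where
  "node_init v = \<lparr>nid = v, nunary = [], ntop = True, nval = 1, npend = 0, nsize = 0,
     ntodo = setup_prog\<rparr>"

definition edge_init :: "edge_input \<Rightarrow> edge_state" where
  "edge_init i = \<lparr>einp = i, emax = 0, etime = 0, esum = 0, esize = (\<lambda>_. 0), esep = False,
     eres = 0, etodo = setup_prog\<rparr>"

definition node_state_of :: "node_view \<Rightarrow> node_state" where
  "node_state_of = (\<lambda>(v, N). foldl node_step (node_init v) N)"

definition edge_state_of :: "edge_view \<Rightarrow> edge_state" where
  "edge_state_of = (\<lambda>(i, H). foldl edge_step (edge_init i) H)"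

definition cut_algorithm :: ma_algorithm where
  "cut_algorithm = \<lparr>
     contract = (\<lambda>h. let s = edge_state_of h in etodo s \<noteq> [] \<and> edge_contracts (hd (etodo s)) s),
     node_val = (\<lambda>h. let s = node_state_of h in
        if ntodo s = [] then [] else node_message (hd (ntodo s)) s),
     consensus_op = (\<lambda>_. combine),
     edge_val = (\<lambda>h l v. let s = edge_state_of h in
        if etodo s = [] then [] else edge_message (hd (etodo s)) s l v),
     aggregation_op = (\<lambda>_. combine),
     edge_output = (\<lambda>h. let s = edge_state_of h in if etodo s = [] then Some (nat (eres s)) else None)\<rparr>"

lemma valid_cut_algorithm: "valid_algorithm cut_algorithm"
  by (simp add: valid_algorithm_def cut_algorithm_def aggregation_operator_combine)

subsection \<open>Executions\<close>

locale ma_run = rooted_tree V r par dep for V r par dep +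
  fixes E T :: "edge set" and w :: "edge \<Rightarrow> nat"
    and c :: "nat \<Rightarrow> config" and y :: "nat \<Rightarrow> node set \<Rightarrow> bits" and a :: "nat \<Rightarrow> node set \<Rightarrow> bits option"
  assumes edges: "\<And>e. e \<in> E \<Longrightarrow> e \<subseteq> V \<and> card e = 2"
    and tree_edges: "T = parent_edges (V - {r})" and tree_sub: "T \<subseteq> E"
    and upper_end: "\<And>z. z \<in> V - {r} \<Longrightarrow> upper_end T r {z, par z} = par z"
    and exec: "ma_execution cut_algorithm V E (edge_input_of w T r) c y a"
begin

abbreviation inp :: "edge \<Rightarrow> edge_input" where
  "inp \<equiv> edge_input_of w T r"

abbreviation pedge :: "node \<Rightarrow> edge" where
  "pedge z \<equiv> {z, par z}"

definition nst :: "nat \<Rightarrow> node \<Rightarrow> node_state" where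
  "nst t v = node_state_of (v, fst (c t) v)"

definition est :: "nat \<Rightarrow> edge \<Rightarrow> edge_state" where
  "est t e = edge_state_of (inp e, snd (c t) e)"

lemma finite_E: "finite E"
  using edges finite_V by (intro finite_subset[of E "Pow V"]) auto

lemma finite_edge: "e \<in> E \<Longrightarrow> finite e"
  using edges finite_V by (auto intro: finite_subset)

lemma pedge_in: "z \<in> V - {r} \<Longrightarrow> pedge z \<in> E" "z \<in> V - {r} \<Longrightarrow> pedge z \<in> T"
  using tree_edges tree_sub by auto

lemma par_neq: "z \<in> V - {r} \<Longrightarrow> par z \<noteq> z"
  using dep_par[of z] by auto

lemma pedge_inj: "z \<in> V - {r} \<Longrightarrow> z' \<in> V - {r} \<Longrightarrow> pedge z = pedge z' \<longleftrightarrow> z = z'"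
  using dep_par[of z] dep_par[of z'] by (auto simp: doubleton_eq_iff)

lemma pedge_in_parent_edges:
  assumes "Z \<subseteq> V - {r}" "z \<in> V - {r}"
  shows "pedge z \<in> parent_edges Z \<longleftrightarrow> z \<in> Z"
proof
  assume "pedge z \<in> parent_edges Z"
  then obtain z' where "z' \<in> Z" "pedge z = pedge z'" by auto
  then show "z \<in> Z" using pedge_inj[of z z'] assms by auto
qed auto

lemma tree_edge_cases:
  assumes "e \<in> T"
  obtains z where "z \<in> V - {r}" "e = pedge z"
  using assms tree_edges by auto

lemma edge_cases:
  assumes "e \<in> E"
  obtains u v where "u \<in> V" "v \<in> V" "u \<noteq> v" "e = {u, v}"
  using edges[OF assms] by (auto simp: card_2_iff)

lemma inp_simps [simp]: "ends (inp e) = e" "weight (inp e) = w e" "in_tree (inp e) \<longleftrightarrow> e \<in> T"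
  by (simp_all add: edge_input_of_def)

lemma upper_lower:
  assumes "einp s = inp (pedge z)" "z \<in> V - {r}"
  shows "upper s = par z" "lower s = z"
proof -
  show *: "upper s = par z"
    using assms pedge_in upper_end by (simp add: upper_def edge_input_of_def)
  have "pedge z - {par z} = {z}" using par_neq[OF assms(2)] by auto
  then show "lower s = z" using assms * by (simp add: lower_def)
qed

lemma init_states: "nst 0 v = node_init v" "est 0 e = edge_init (inp e)"
  using exec by (auto simp: ma_execution_def nst_def est_def node_state_of_def edge_state_of_def)

lemma round_at: "ma_round cut_algorithm V E inp t (c t) (y t) (a t) (c (Suc t))"
  using exec by (simp add: ma_execution_def)

lemma node_step_ex: "v \<in> V \<Longrightarrow> \<exists>x. nst (Suc t) v = node_step (nst t v) x"
  using round_at[of t] by (auto simp: ma_round_def Let_def nst_def node_state_of_def)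

lemma edge_step_ex: "e \<in> E \<Longrightarrow> \<exists>l. est (Suc t) e = edge_step (est t e) l"
  using round_at[of t] by (auto simp: ma_round_def Let_def est_def edge_state_of_def)

definition incident :: "node set \<Rightarrow> node \<Rightarrow> (edge \<times> node) set" where
  "incident Z v = {(e, u). e \<in> E \<and> in_minor Z e \<and> u \<in> e \<and> topmost Z u = topmost Z v}"

lemma finite_incident [simp]: "finite (incident Z v)"
proof -
  have "incident Z v \<subseteq> E \<times> V" using edges by (auto simp: incident_def)
  then show ?thesis using finite_E finite_V by (meson finite_SigmaI finite_subset)
qed

definition todo :: "nat \<Rightarrow> instr list \<Rightarrow> bool" where
  "todo t is \<longleftrightarrow> (\<forall>v\<in>V. ntodo (nst t v) = is) \<and> (\<forall>e\<in>E. etodo (est t e) = is)"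

text \<open>One round of the model in terms of cluster names, with learned values indexed by nodes
  instead of supernodes. Each instruction only has to supply the set \<open>Z\<close> it
  contracts.\<close>

lemma round_cases:
  assumes Z: "Z \<subseteq> V - {r}" and td: "todo t (i # is)"
    and contr: "\<And>e. e \<in> E \<Longrightarrow> edge_contracts i (est t e) \<longleftrightarrow> e \<in> parent_edges Z"
  obtains Y A L where
    "\<And>v. v \<in> V \<Longrightarrow> aggregates combine
       (image_mset (\<lambda>u. node_message i (nst t u)) (mset_set {u \<in> V. topmost Z u = topmost Z v})) (Y v)"
    "\<And>v. v \<in> V \<Longrightarrow> aggregates_opt combine
       (image_mset (\<lambda>(e, u). edge_message i (est t e) (L e) u) (mset_set (incident Z v))) (A v)"
    "\<And>e u. e \<in> E \<Longrightarrow> L e u = (if in_minor Z e \<and> u \<in> e then Some (Y u) else None)"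
    "\<And>v. v \<in> V \<Longrightarrow> nst (Suc t) v = node_step (nst t v) (Y v, A v)"
    "\<And>e. e \<in> E \<Longrightarrow> est (Suc t) e = edge_step (est t e) (L e)"
proof -
  define F where "F = contracted cut_algorithm E inp (snd (c t))"
  have nt: "ntodo (nst t v) = i # is" if "v \<in> V" for v using td that by (simp add: todo_def)
  have et: "etodo (est t e) = i # is" if "e \<in> E" for e using td that by (simp add: todo_def)
  have "parent_edges Z \<subseteq> E" using Z pedge_in by auto
  moreover have "F = {e \<in> E. edge_contracts i (est t e)}"
    unfolding F_def contracted_def using et
    by (intro Collect_cong conj_cong) (auto simp: cut_algorithm_def Let_def simp flip: est_def)
  ultimately have F: "F = parent_edges Z" using contr by blast
  have ne: "e \<subseteq> V \<and> e \<noteq> {}" if "e \<in> E" for e using edges[OF that] by auto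
  have minor: "minor_edges V E F = {e \<in> E. in_minor Z e}"
    unfolding F using minor_edges_parent_edges[OF Z ne] .
  define Y where "Y v = y t (supernode F v)" for v
  define A where "A v = a t (supernode F v)" for v
  define L where "L = learned V E F (y t)"
  have sn: "supernode F v = {u \<in> V. topmost Z u = topmost Z v}" if "v \<in> V" for v
    unfolding F using supernode_parent_edges[OF Z that] .
  have in_sn: "supernode F v \<in> supernodes V F" if "v \<in> V" for v using that by (simp add: supernodes_def)
  note R = round_at[of t, unfolded ma_round_def Let_def, folded F_def]
  have 1: "aggregates combine
       (image_mset (\<lambda>u. node_message i (nst t u)) (mset_set {u \<in> V. topmost Z u = topmost Z v})) (Y v)"
    if "v \<in> V" for v
  proof -
    have "aggregates (consensus_op cut_algorithm t)
        (image_mset (\<lambda>u. node_val cut_algorithm (u, fst (c t) u)) (mset_set (supernode F v))) (Y v)"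
      using R in_sn[OF that] unfolding Y_def by blast
    moreover have "image_mset (\<lambda>u. node_val cut_algorithm (u, fst (c t) u)) (mset_set (supernode F v)) =
        image_mset (\<lambda>u. node_message i (nst t u)) (mset_set (supernode F v))"
      using nt finite_V by (intro image_mset_cong) (auto simp: sn[OF that] cut_algorithm_def Let_def simp flip: nst_def)
    ultimately show ?thesis by (simp add: cut_algorithm_def sn[OF that])
  qed
  have 2: "aggregates_opt combine
       (image_mset (\<lambda>(e, u). edge_message i (est t e) (L e) u) (mset_set (incident Z v))) (A v)"
    if v: "v \<in> V" for v
  proof -
    let ?P = "{(e, u). e \<in> minor_edges V E F \<and> u \<in> e \<inter> supernode F v}"
    have agg: "aggregates_opt (aggregation_op cut_algorithm t)
        (image_mset (\<lambda>(e, u). edge_val cut_algorithm (inp e, snd (c t) e) (L e) u) (mset_set ?P)) (A v)"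
      using R in_sn[OF that] unfolding A_def L_def by blast
    have P: "?P = incident Z v" using edges by (auto simp: minor sn[OF v] incident_def)
    have eq: "image_mset (\<lambda>(e, u). edge_val cut_algorithm (inp e, snd (c t) e) (L e) u) (mset_set ?P) =
        image_mset (\<lambda>(e, u). edge_message i (est t e) (L e) u) (mset_set ?P)"
      unfolding P
    proof (intro image_mset_cong)
      fix p assume "p \<in># mset_set (incident Z v)"
      then have "p \<in> incident Z v" by simp
      then have "etodo (est t (fst p)) = i # is" using et by (auto simp: incident_def)
      then show "(\<lambda>(e, u). edge_val cut_algorithm (inp e, snd (c t) e) (L e) u) p =
          (\<lambda>(e, u). edge_message i (est t e) (L e) u) p"
        by (cases p) (simp add: cut_algorithm_def Let_def flip: est_def)
    qed
    have op: "aggregation_op cut_algorithm t = combine" by (simp add: cut_algorithm_def)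
    show ?thesis using agg unfolding eq op unfolding P .
  qed
  have 3: "L e u = (if in_minor Z e \<and> u \<in> e then Some (Y u) else None)" if "e \<in> E" for e u
    using that by (simp add: L_def learned_def minor Y_def)
  have 4: "nst (Suc t) v = node_step (nst t v) (Y v, A v)" if "v \<in> V" for v
    using R that by (simp add: nst_def node_state_of_def Y_def A_def)
  have 5: "est (Suc t) e = edge_step (est t e) (L e)" if "e \<in> E" for e
    using R that by (simp add: est_def edge_state_of_def L_def)
  show ?thesis using that[of Y L A] 1 2 3 4 5 by blast
qed

lemma in_minor_empty: "e \<in> E \<Longrightarrow> in_minor {} e"
  by (erule edge_cases) (auto simp: in_minor_def topmost_outside)

lemma incident_empty: "incident {} v = (\<lambda>e. (e, v)) ` {e \<in> E. v \<in> e}"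
  using in_minor_empty by (auto simp: incident_def topmost_outside)

text \<open>Without contraction an edge meets \<open>v\<close> at most once, and tree edges can be
  indexed by their lower endpoints.\<close>

lemma sum_incident_tree:
  fixes g :: "edge \<Rightarrow> int"
  shows "(\<Sum>(e, u)\<in>incident {} v. if e \<in> T \<and> Q e u then g e else 0) =
    (\<Sum>z\<in>{z \<in> V - {r}. v \<in> pedge z \<and> Q (pedge z) v}. g (pedge z))"
proof -
  have "(\<Sum>(e, u)\<in>incident {} v. if e \<in> T \<and> Q e u then g e else 0) =
      (\<Sum>e\<in>{e \<in> E. v \<in> e}. if e \<in> T \<and> Q e v then g e else 0)"
    unfolding incident_empty by (subst sum.reindex) (auto simp: inj_on_def)
  also have "\<dots> = (\<Sum>e\<in>{e \<in> {e \<in> E. v \<in> e}. e \<in> T \<and> Q e v}. g e)"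
    by (intro sum.inter_filter[symmetric]) (simp add: finite_E)
  also have "{e \<in> {e \<in> E. v \<in> e}. e \<in> T \<and> Q e v} =
      pedge ` {z \<in> V - {r}. v \<in> pedge z \<and> Q (pedge z) v}"
    using tree_sub tree_edges by auto
  also have "sum g \<dots> = (\<Sum>z\<in>{z \<in> V - {r}. v \<in> pedge z \<and> Q (pedge z) v}. g (pedge z))"
    using pedge_inj by (subst sum.reindex) (auto simp: inj_on_def)
  finally show ?thesis .
qed

text \<open>Units agree on schedule and width. With no setup instruction left, neither can be
  disturbed by whatever is received later.\<close>

definition ready :: "nat \<Rightarrow> nat \<Rightarrow> instr list \<Rightarrow> bool" where
  "ready D t is \<longleftrightarrow> todo t is \<and> set is \<inter> set setup_prog = {} \<and>
     (\<forall>v\<in>V. nid (nst t v) = v \<and> nwidth (nst t v) = D) \<and>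
     (\<forall>e\<in>E. einp (est t e) = inp e \<and> ewidth (est t e) = D)"

lemma node_step_Cons:
  "ntodo s = i # is \<Longrightarrow> i \<noteq> Announce \<Longrightarrow> node_step s x = (node_update i x s)\<lparr>ntodo := is\<rparr>"
  by (simp add: node_step_def)

lemma edge_step_Cons:
  "etodo s = i # is \<Longrightarrow> i \<noteq> Announce \<Longrightarrow> edge_step s l = (edge_update i l s)\<lparr>etodo := is\<rparr>"
  by (simp add: edge_step_def Let_def)

lemma ready_Suc:
  assumes "ready D t (i # is)"
  shows "ready D (Suc t) is"
proof -
  have i: "i \<notin> {Probe, Gather, Announce}" using assms by (auto simp: ready_def setup_prog_def)
  have nu: "nid (node_update i x s) = nid s \<and> nwidth (node_update i x s) = nwidth s" for x s
    using i by (cases "(i, x, s)" rule: node_update.cases) (auto simp: nwidth_def)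
  have eu: "einp (edge_update i l s) = einp s \<and> ewidth (edge_update i l s) = ewidth s" for l s
    using i by (cases i) (auto simp: ewidth_def)
  have "nid (nst (Suc t) v) = v \<and> nwidth (nst (Suc t) v) = D \<and> ntodo (nst (Suc t) v) = is" if "v \<in> V" for v
  proof -
    have "ntodo (nst t v) = i # is" "nid (nst t v) = v" "nwidth (nst t v) = D"
      using assms that by (auto simp: ready_def todo_def)
    then show ?thesis using node_step_ex[OF that, of t] nu i by (auto simp: node_step_Cons nwidth_def)
  qed
  moreover have "einp (est (Suc t) e) = inp e \<and> ewidth (est (Suc t) e) = D \<and> etodo (est (Suc t) e) = is"
    if "e \<in> E" for e
  proof -
    have "etodo (est t e) = i # is" "einp (est t e) = inp e" "ewidth (est t e) = D"
      using assms that by (auto simp: ready_def todo_def)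
    then show ?thesis using edge_step_ex[OF that, of t] eu i by (auto simp: edge_step_Cons ewidth_def)
  qed
  ultimately show ?thesis using assms by (auto simp: ready_def todo_def)
qed

lemma ready_Nil:
  assumes "ready D t []"
  shows "nst (Suc t) v = nst t v \<or> v \<notin> V" "est (Suc t) e = est t e \<or> e \<notin> E" "ready D (Suc t) []"
proof -
  show n: "nst (Suc t) v = nst t v \<or> v \<notin> V" for v
    using node_step_ex[of v t] assms by (auto simp: ready_def todo_def node_step_def)
  show e: "est (Suc t) e = est t e \<or> e \<notin> E" for e
    using edge_step_ex[of e t] assms by (auto simp: ready_def todo_def edge_step_def)
  show "ready D (Suc t) []" using assms n e by (simp add: ready_def todo_def) metis
qed

lemma ready_drop:
  assumes "ready D t is"
  shows "ready D (t + k) (drop k is)"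
proof (induction k)
  case (Suc k)
  show ?case
  proof (cases "drop k is")
    case Nil
    then show ?thesis using Suc ready_Nil(3) by simp
  next
    case (Cons i js)
    then have "drop (Suc k) is = js" by (metis drop_Suc list.sel(3) tl_drop)
    then show ?thesis using Suc Cons ready_Suc by simp
  qed
qed (use assms in simp)

lemma todo_simps:
  assumes "todo t is"
  shows "v \<in> V \<Longrightarrow> ntodo (nst t v) = is" "e \<in> E \<Longrightarrow> etodo (est t e) = is"
  using assms by (auto simp: todo_def)

lemma ready_simps:
  assumes "ready D t is"
  shows "todo t is"
    and "v \<in> V \<Longrightarrow> ntodo (nst t v) = is" "v \<in> V \<Longrightarrow> nid (nst t v) = v" "v \<in> V \<Longrightarrow> nwidth (nst t v) = D"
    and "e \<in> E \<Longrightarrow> etodo (est t e) = is" "e \<in> E \<Longrightarrow> einp (est t e) = inp e" "e \<in> E \<Longrightarrow> ewidth (est t e) = D"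
  using assms by (auto simp: ready_def todo_def)

subsection \<open>Agreeing on the message width\<close>

text \<open>Numbers are sent in unary as blocks of \<open>False\<close>, so the maximum is the
  longest block; a node without edges keeps length 0.\<close>

lemma after_probe:
  assumes v: "v \<in> V"
  shows "todo 1 [Gather, Announce]"
    and "\<exists>m. nst 1 v = (node_init v)\<lparr>nunary := replicate m False, ntodo := [Gather, Announce]\<rparr> \<and>
      (m = 0 \<or> (\<exists>e\<in>E. m = probe_length (inp e))) \<and> (\<forall>e\<in>E. v \<in> e \<longrightarrow> probe_length (inp e) \<le> m)"
    and "e \<in> E \<Longrightarrow> est 1 e = (edge_init (inp e))\<lparr>etodo := [Gather, Announce]\<rparr>"
proof -
  have td: "todo 0 (Probe # [Gather, Announce])"
    by (simp add: todo_def init_states node_init_def edge_init_def setup_prog_def)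
  obtain Y A L where *: "\<And>v. v \<in> V \<Longrightarrow> aggregates_opt combine
       (image_mset (\<lambda>(e, u). edge_message Probe (est 0 e) (L e) u) (mset_set (incident {} v))) (A v)"
    "\<And>v. v \<in> V \<Longrightarrow> nst (Suc 0) v = node_step (nst 0 v) (Y v, A v)"
    "\<And>e. e \<in> E \<Longrightarrow> est (Suc 0) e = edge_step (est 0 e) (L e)"
    by (rule round_cases[OF _ td, of "{}"]) auto
  have n1: "nst 1 v = (node_init v)\<lparr>nunary := (case A v of None \<Rightarrow> [] | Some x \<Rightarrow> x), ntodo := [Gather, Announce]\<rparr>"
    if "v \<in> V" for v
    using *(2)[OF that] by (simp add: init_states node_step_def node_init_def setup_prog_def)
  show e1: "est 1 e = (edge_init (inp e))\<lparr>etodo := [Gather, Announce]\<rparr>" if "e \<in> E" for e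
    using *(3)[OF that] by (simp add: init_states edge_step_def edge_init_def setup_prog_def)
  show "todo 1 [Gather, Announce]" using n1 e1 by (simp add: todo_def)
  let ?h = "\<lambda>(e, u :: node). replicate (probe_length (inp e)) False"
  have "(\<lambda>(e, u). edge_message Probe (est 0 e) (L e) u) = ?h"
    by (auto simp: fun_eq_iff init_states edge_init_def)
  then have "aggregates_opt combine (image_mset ?h (mset_set (incident {} v))) (A v)"
    using *(1)[OF v] by simp
  then have A: "case A v of None \<Rightarrow> incident {} v = {}
      | Some x \<Rightarrow> x \<in> ?h ` incident {} v \<and> (\<forall>p\<in>incident {} v. rank_le (?h p) x)"
    by (rule aggregates_opt_max_set) (auto simp: hd_replicate)
  show "\<exists>m. nst 1 v = (node_init v)\<lparr>nunary := replicate m False, ntodo := [Gather, Announce]\<rparr> \<and>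
      (m = 0 \<or> (\<exists>e\<in>E. m = probe_length (inp e))) \<and> (\<forall>e\<in>E. v \<in> e \<longrightarrow> probe_length (inp e) \<le> m)"
  proof (cases "A v")
    case None
    then show ?thesis using A n1[OF v] by (intro exI[of _ 0]) (auto simp: incident_empty)
  next
    case (Some x)
    then obtain e where e: "e \<in> E" "x = replicate (probe_length (inp e)) False"
      using A by (auto simp: incident_empty)
    moreover have "probe_length (inp e') \<le> length x" if "e' \<in> E" "v \<in> e'" for e'
      using A Some that by (auto simp: incident_empty rank_le_def)
    ultimately show ?thesis using n1[OF v] Some by (intro exI[of _ "probe_length (inp e)"]) auto
  qed
qed

lemma topmost_all: "v \<in> V \<Longrightarrow> topmost (V - {r}) v = r"
  using topmost_props[of "V - {r}" v] by auto

text \<open>Contracting the entire tree leaves one supernode, which makes the maximum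
  global.\<close>

lemma after_gather:
  obtains m where "m = 0 \<or> (\<exists>e\<in>E. m = probe_length (inp e))"
    and "\<And>e. e \<in> E \<Longrightarrow> probe_length (inp e) \<le> m"
    and "todo 2 [Announce]"
    and "\<And>v. v \<in> V \<Longrightarrow> nst 2 v = (node_init v)\<lparr>nunary := replicate m False, ntodo := [Announce]\<rparr>"
    and "\<And>e. e \<in> E \<Longrightarrow> est 2 e = (edge_init (inp e))\<lparr>etodo := [Announce]\<rparr>"
proof -
  have td: "todo 1 (Gather # [Announce])" using after_probe(1)[OF root_in] .
  obtain M where M: "\<And>v. v \<in> V \<Longrightarrow>
      nst 1 v = (node_init v)\<lparr>nunary := replicate (M v) False, ntodo := [Gather, Announce]\<rparr> \<and>
      (M v = 0 \<or> (\<exists>e\<in>E. M v = probe_length (inp e))) \<and> (\<forall>e\<in>E. v \<in> e \<longrightarrow> probe_length (inp e) \<le> M v)"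
    using after_probe(2) by metis
  have contr: "edge_contracts Gather (est 1 e) \<longleftrightarrow> e \<in> parent_edges (V - {r})" if "e \<in> E" for e
    using after_probe(3)[OF root_in that] by (simp add: edge_init_def flip: tree_edges)
  obtain Y A L where *: "\<And>v. v \<in> V \<Longrightarrow> aggregates combine (image_mset (\<lambda>u. node_message Gather (nst 1 u))
       (mset_set {u \<in> V. topmost (V - {r}) u = topmost (V - {r}) v})) (Y v)"
    "\<And>v. v \<in> V \<Longrightarrow> nst (Suc 1) v = node_step (nst 1 v) (Y v, A v)"
    "\<And>e. e \<in> E \<Longrightarrow> est (Suc 1) e = edge_step (est 1 e) (L e)"
    by (rule round_cases[OF order_refl td contr]) blast+
  have Y: "\<exists>u\<in>V. Y v = replicate (M u) False" "\<And>u. u \<in> V \<Longrightarrow> M u \<le> length (Y v)" if v: "v \<in> V" for v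
  proof -
    have S: "{u \<in> V. topmost (V - {r}) u = topmost (V - {r}) v} = V" using v by (auto simp: topmost_all)
    have "image_mset (\<lambda>u. node_message Gather (nst 1 u)) (mset_set V) =
        image_mset (\<lambda>u. replicate (M u) False) (mset_set V)"
      using M finite_V by (intro image_mset_cong) simp
    then have agg: "aggregates combine (image_mset (\<lambda>u. replicate (M u) False) (mset_set V)) (Y v)"
      using *(1)[OF v] by (simp add: S)
    have "replicate (M p) False = [] \<or> \<not> hd (replicate (M p) False)" for p by (auto simp: hd_replicate)
    note max = aggregates_max_set[OF agg this finite_V]
    show "\<exists>u\<in>V. Y v = replicate (M u) False" using max(1) by auto
    show "M u \<le> length (Y v)" if "u \<in> V" for u using max(2)[OF that] by (auto simp: rank_le_def)
  qed
  define m where "m = length (Y r)"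
  obtain u where u: "u \<in> V" "Y r = replicate (M u) False" using Y(1)[OF root_in] by blast
  \<comment> \<open>\<open>round_cases\<close> does not record that a supernode shares one value;
    equality follows because both values are maxima of the same messages.\<close>
  have Ym: "Y v = replicate m False" if v: "v \<in> V" for v
  proof -
    obtain u' where u': "u' \<in> V" "Y v = replicate (M u') False" using Y(1)[OF v] by blast
    have "M u' = m"
      using Y(2)[OF root_in u'(1)] Y(2)[OF v u(1)] u u' by (simp add: m_def)
    then show ?thesis using u' by simp
  qed
  have n2: "nst 2 v = (node_init v)\<lparr>nunary := replicate m False, ntodo := [Announce]\<rparr>" if "v \<in> V" for v
  proof -
    have "nst 2 v = node_step (nst 1 v) (Y v, A v)" using *(2)[OF that] by (simp add: numeral_2_eq_2)
    then show ?thesis using M[OF that] Ym[OF that] by (simp add: node_step_def node_init_def)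
  qed
  have e2: "est 2 e = (edge_init (inp e))\<lparr>etodo := [Announce]\<rparr>" if "e \<in> E" for e
  proof -
    have "est 2 e = edge_step (est 1 e) (L e)" using *(3)[OF that] by (simp add: numeral_2_eq_2)
    then show ?thesis using after_probe(3)[OF root_in that] by (simp add: edge_step_def edge_init_def)
  qed
  show ?thesis
  proof (rule that)
    show "m = 0 \<or> (\<exists>e\<in>E. m = probe_length (inp e))" using M[OF u(1)] u by (simp add: m_def)
    show "probe_length (inp e) \<le> m" if e: "e \<in> E" for e
    proof -
      obtain x where "x \<in> V" "x \<in> e" using e by (auto elim: edge_cases)
      then show ?thesis using M[of x] Y(2)[OF root_in, of x] e by (auto simp: m_def)
    qed
    show "todo 2 [Announce]" using n2 e2 by (simp add: todo_def)
  qed (use n2 e2 in auto)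
qed

lemma setup_not_in_prog: "set (prog D) \<inter> set setup_prog = {}"
  by (auto simp: prog_def sum_prog_def class_prog_def setup_prog_def)

lemma after_setup:
  obtains m where "m = 0 \<or> (\<exists>e\<in>E. m = probe_length (inp e))"
    and "\<And>e. e \<in> E \<Longrightarrow> probe_length (inp e) \<le> m"
    and "ready (width m) 3 (prog (width m))"
    and "\<And>v. v \<in> V \<Longrightarrow> ntop (nst 3 v) \<and> nval (nst 3 v) = 1"
    and "\<And>e. e \<in> E \<Longrightarrow> etime (est 3 e) = merge_steps (width m)"
    and "\<And>v. v \<in> V \<Longrightarrow> length (nunary (nst 2 v)) = m"
    and "todo 2 [Announce]"
proof -
  obtain m where m: "m = 0 \<or> (\<exists>e\<in>E. m = probe_length (inp e))"
    "\<And>e. e \<in> E \<Longrightarrow> probe_length (inp e) \<le> m" and td: "todo 2 [Announce]"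
    and n2: "\<And>v. v \<in> V \<Longrightarrow> nst 2 v = (node_init v)\<lparr>nunary := replicate m False, ntodo := [Announce]\<rparr>"
    and e2: "\<And>e. e \<in> E \<Longrightarrow> est 2 e = (edge_init (inp e))\<lparr>etodo := [Announce]\<rparr>"
    by (rule after_gather) blast
  obtain Y A L where *: "\<And>v. v \<in> V \<Longrightarrow> aggregates combine (image_mset (\<lambda>u. node_message Announce (nst 2 u))
       (mset_set {u \<in> V. topmost {} u = topmost {} v})) (Y v)"
    "\<And>e u. e \<in> E \<Longrightarrow> L e u = (if in_minor {} e \<and> u \<in> e then Some (Y u) else None)"
    "\<And>v. v \<in> V \<Longrightarrow> nst (Suc 2) v = node_step (nst 2 v) (Y v, A v)"
    "\<And>e. e \<in> E \<Longrightarrow> est (Suc 2) e = edge_step (est 2 e) (L e)"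
    by (rule round_cases[OF _ td, of "{}"]) auto
  have Y: "Y v = replicate m False" if v: "v \<in> V" for v
  proof -
    have S: "{u \<in> V. topmost {} u = topmost {} v} = {v}" using v by (auto simp: topmost_outside)
    have "aggregates combine (image_mset (\<lambda>u. node_message Announce (nst 2 u)) (mset_set {v})) (Y v)"
      using *(1)[OF v] unfolding S .
    then have "Y v \<in> (\<lambda>u. node_message Announce (nst 2 u)) ` {v}"
      by (rule aggregates_max_set) (use n2[OF v] in \<open>auto simp: hd_replicate\<close>)
    then show ?thesis using n2[OF v] by simp
  qed
  let ?D = "width m"
  have n3: "nst 3 v = (node_init v)\<lparr>nunary := replicate m False, ntodo := prog ?D\<rparr>" if "v \<in> V" for v
  proof -
    have "nst 3 v = node_step (nst 2 v) (Y v, A v)" using *(3)[OF that] by (simp add: eval_nat_numeral)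
    then show ?thesis using n2[OF that] by (simp add: node_step_def node_init_def nwidth_def)
  qed
  have e3: "est 3 e = (edge_init (inp e))\<lparr>emax := m, etime := merge_steps ?D, etodo := prog ?D\<rparr>"
    if e: "e \<in> E" for e
  proof -
    have "e \<noteq> {}" using edges[OF e] by auto
    then have x: "(SOME v. v \<in> e) \<in> e" by (simp add: some_in_eq)
    then have "(SOME v. v \<in> e) \<in> V" using edges[OF e] by blast
    then have "the (L e (SOME v. v \<in> e)) = replicate m False"
      using x *(2)[OF e] Y in_minor_empty[OF e] by simp
    moreover have "est 3 e = edge_step (est 2 e) (L e)" using *(4)[OF e] by (simp add: eval_nat_numeral)
    ultimately show ?thesis using e2[OF e] by (simp add: edge_step_def edge_init_def ewidth_def Let_def)
  qed
  show ?thesis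
  proof (rule that[OF m])
    show "ready ?D 3 (prog ?D)"
      using n3 e3 setup_not_in_prog
      by (auto simp: ready_def todo_def nwidth_def ewidth_def node_init_def edge_init_def)
  qed (use n3 e3 n2 td in \<open>auto simp: node_init_def edge_init_def\<close>)
qed

lemma contracts_iff:
  assumes "ready D t (i # is)" "Z \<subseteq> V - {r}"
    and "\<And>z. z \<in> V - {r} \<Longrightarrow> edge_contracts i (est t (pedge z)) \<longleftrightarrow> z \<in> Z"
    and "e \<in> E"
  shows "edge_contracts i (est t e) \<longleftrightarrow> e \<in> parent_edges Z"
proof (cases "e \<in> T")
  case True
  then show ?thesis using assms by (elim tree_edge_cases) (simp add: pedge_in_parent_edges)
next
  case False
  have "edge_contracts i s \<Longrightarrow> in_tree (einp s)" for s by (cases i) auto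
  then have "\<not> edge_contracts i (est t e)" using False ready_simps(6)[OF assms(1,4)] by force
  moreover have "e \<notin> parent_edges Z" using False assms(2) tree_edges by blast
  ultimately show ?thesis by simp
qed

lemma ready_not_Announce: "ready D t (i # is) \<Longrightarrow> i \<noteq> Announce"
  by (auto simp: ready_def setup_prog_def)

lemma node_step_ready:
  assumes "ready D t (i # is)" "v \<in> V"
  shows "node_step (nst t v) x = (node_update i x (nst t v))\<lparr>ntodo := is\<rparr>"
  using assms ready_not_Announce by (intro node_step_Cons) (auto simp: ready_def todo_def)

lemma edge_step_ready:
  assumes "ready D t (i # is)" "e \<in> E"
  shows "edge_step (est t e) l = (edge_update i l (est t e))\<lparr>etodo := is\<rparr>"
  using assms ready_not_Announce by (intro edge_step_Cons) (auto simp: ready_def todo_def)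

lemma upper_lower_ready:
  assumes "ready D t is" "z \<in> V - {r}"
  shows "upper (est t (pedge z)) = par z" "lower (est t (pedge z)) = z" "in_tree (einp (est t (pedge z)))"
  using upper_lower[of "est t (pedge z)" z] ready_simps(6)[OF assms(1) pedge_in(1)[OF assms(2)]]
    assms(2) pedge_in(2) by auto

subsection \<open>The clustering phase\<close>

definition merging :: "nat \<Rightarrow> nat \<Rightarrow> nat \<Rightarrow> bool" where
  "merging D k t \<longleftrightarrow> (\<forall>v\<in>V. ntop (nst t v) \<longleftrightarrow> v \<notin> merged D k) \<and>
     (\<forall>z\<in>V - {r}. etime (est t (pedge z)) =
        (if z \<in> merged D k then merge_time D z else merge_steps D))"

text \<open>An unmerged node names its own cluster, so its parent edge knows both names needed for
  \<open>joins\<close>: its lower endpoint, and the name announced by the upper supernode.\<close>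

lemma merge_round:
  assumes rd: "ready D t (Merge k # is)" and mg: "merging D k t" and k: "k < merge_steps D"
  shows "merging D (Suc k) (Suc t)" and "v \<in> V \<Longrightarrow> nval (nst (Suc t) v) = nval (nst t v)"
proof -
  let ?Z = "merged D k"
  note Z = merged_subset[of D k]
  have etime: "etime (est t (pedge z)) < k \<longleftrightarrow> z \<in> ?Z" if "z \<in> V - {r}" for z
    using mg that k merged_iff_merge_time[of z D k k] by (auto simp: merging_def)
  have "edge_contracts (Merge k) (est t (pedge z)) \<longleftrightarrow> z \<in> ?Z" if "z \<in> V - {r}" for z
    using etime[OF that] upper_lower_ready[OF rd that] by simp
  then have contr: "edge_contracts (Merge k) (est t e) \<longleftrightarrow> e \<in> parent_edges ?Z" if "e \<in> E" for e
    using contracts_iff[OF rd Z] that by blast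
  obtain Y A L where Y: "\<And>v. v \<in> V \<Longrightarrow> aggregates combine (image_mset (\<lambda>u. node_message (Merge k) (nst t u))
       (mset_set {u \<in> V. topmost ?Z u = topmost ?Z v})) (Y v)"
    and A: "\<And>v. v \<in> V \<Longrightarrow> aggregates_opt combine
       (image_mset (\<lambda>(e, u). edge_message (Merge k) (est t e) (L e) u) (mset_set (incident ?Z v))) (A v)"
    and L: "\<And>e u. e \<in> E \<Longrightarrow> L e u = (if in_minor ?Z e \<and> u \<in> e then Some (Y u) else None)"
    and n: "\<And>v. v \<in> V \<Longrightarrow> nst (Suc t) v = node_step (nst t v) (Y v, A v)"
    and e: "\<And>e. e \<in> E \<Longrightarrow> est (Suc t) e = edge_step (est t e) (L e)"
    by (rule round_cases[OF Z ready_simps(1)[OF rd] contr]) blast+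
  have msg: "node_message (Merge k) (nst t u) = (if u \<notin> ?Z then False # u else [])" if "u \<in> V" for u
    using mg that ready_simps(3)[OF rd that] by (simp add: merging_def)
  \<comment> \<open>Only the topmost node of a supernode is unmerged, and its nonempty message beats
    every \<open>[]\<close>.\<close>
  have Y: "Y v = False # topmost ?Z v" if v: "v \<in> V" for v
  proof -
    let ?S = "{u \<in> V. topmost ?Z u = topmost ?Z v}"
    have fin: "finite ?S" using finite_V by simp
    have nh: "node_message (Merge k) (nst t u) = [] \<or> \<not> hd (node_message (Merge k) (nst t u))"
      if "u \<in> ?S" for u using msg that by auto
    have max: "Y v \<in> (\<lambda>u. node_message (Merge k) (nst t u)) ` ?S"
      "\<And>u. u \<in> ?S \<Longrightarrow> rank_le (node_message (Merge k) (nst t u)) (Y v)"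
      using aggregates_max_set[OF Y[OF v] _ fin] nh by blast+
    have top: "topmost ?Z v \<in> ?S" "topmost ?Z v \<notin> ?Z"
      using topmost_props[OF Z v] by (auto simp: topmost_outside)
    have "rank_le (False # topmost ?Z v) (Y v)" using max(2)[OF top(1)] top msg by auto
    then have "Y v \<noteq> []" by (auto simp: rank_le_def)
    moreover obtain u where u: "u \<in> ?S" "Y v = node_message (Merge k) (nst t u)" using max(1) by blast
    ultimately have "u \<notin> ?Z" "Y v = False # u" using msg[of u] by (auto split: if_splits)
    then show ?thesis using u(1) topmost_outside[of u ?Z] by auto
  qed
  let ?new = "{z \<in> V - {r}. z \<notin> ?Z \<and> joins D k z (topmost ?Z (par z))}"
  have join: "edge_joins k (est t (pedge z)) (L (pedge z)) \<longleftrightarrow> z \<in> ?new" if z: "z \<in> V - {r}" for z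
  proof (cases "z \<in> ?Z")
    case True
    then show ?thesis using etime[OF z] by (simp add: edge_joins_def)
  next
    case False
    have "in_minor ?Z (pedge z)" using topmost_par_neq[OF Z z False] by (auto simp: in_minor_def)
    then have "L (pedge z) (par z) = Some (False # topmost ?Z (par z))"
      using L[OF pedge_in(1)[OF z]] Y[OF par_in[OF z]] by simp
    then show ?thesis
      using False etime[OF z] upper_lower_ready[OF rd z] ready_simps(7)[OF rd pedge_in(1)[OF z]] z
      by (simp add: edge_joins_def)
  qed
  have no_join: "\<not> edge_joins k (est t e) (L e)" if "e \<in> E" "e \<notin> T" for e
    using that ready_simps(6)[OF rd that(1)] by (simp add: edge_joins_def)
  have "etime (est (Suc t) (pedge z)) = (if z \<in> merged D (Suc k) then merge_time D z else merge_steps D)"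
    if z: "z \<in> V - {r}" for z
  proof -
    have old: "etime (est t (pedge z)) = (if z \<in> ?Z then merge_time D z else merge_steps D)"
      using mg z by (simp add: merging_def)
    have "etime (est (Suc t) (pedge z)) =
        (if edge_joins k (est t (pedge z)) (L (pedge z)) then k else etime (est t (pedge z)))"
      using e[OF pedge_in(1)[OF z]] edge_step_ready[OF rd pedge_in(1)[OF z]] by simp
    moreover have "merge_time D z = k" if "z \<in> ?new"
    proof -
      have z': "z \<in> merged D (Suc k)" using that by simp
      have "merge_time D z < Suc k" using merged_iff_merge_time[OF z', of "Suc k"] z' by blast
      moreover have "\<not> merge_time D z < k" using merged_iff_merge_time[OF z', of k] that by blast
      ultimately show ?thesis by simp
    qed
    moreover have "z \<in> merged D (Suc k) \<longleftrightarrow> z \<in> ?Z \<or> z \<in> ?new" by simp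
    ultimately show ?thesis using join[OF z] old by (metis (no_types, lifting) mem_Collect_eq)
  qed
  moreover have "ntop (nst (Suc t) v) \<longleftrightarrow> v \<notin> merged D (Suc k)" if v: "v \<in> V" for v
  proof (cases "v \<in> ?Z")
    case True
    then show ?thesis using mg v n[OF v] node_step_ready[OF rd v] by (simp add: merging_def)
  next
    case False
    let ?h = "\<lambda>(e, u). edge_message (Merge k) (est t e) (L e) u"
    have nh: "?h p = [] \<or> \<not> hd (?h p)" for p by (cases p) auto
    have A': "case A v of None \<Rightarrow> incident ?Z v = {}
      | Some x \<Rightarrow> x \<in> ?h ` incident ?Z v \<and> (\<forall>p\<in>incident ?Z v. rank_le (?h p) x)"
      by (rule aggregates_opt_max_set[OF A[OF v] nh finite_incident])
    \<comment> \<open>Only the parent edge of the topmost node can answer \<open>[False]\<close>;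
      all other incident edges send \<open>[]\<close>, which ranks lower.\<close>
    have "A v = Some [False] \<longleftrightarrow> v \<in> ?new"
    proof
      assume "A v = Some [False]"
      then obtain e u where eu: "(e, u) \<in> incident ?Z v" "edge_message (Merge k) (est t e) (L e) u = [False]"
        using A' by force
      then have "edge_joins k (est t e) (L e)" "u = lower (est t e)" "e \<in> E" "topmost ?Z u = topmost ?Z v"
        by (auto simp: incident_def split: if_splits)
      moreover from this have "e \<in> T" using no_join by blast
      ultimately have "u \<in> ?new" "topmost ?Z u = topmost ?Z v"
        using join upper_lower_ready(2)[OF rd] by (auto elim!: tree_edge_cases)
      then show "v \<in> ?new" using False by (simp add: topmost_outside)
    next
      assume new: "v \<in> ?new"
      then have z: "v \<in> V - {r}" by simp
      have "in_minor ?Z (pedge v)" using topmost_par_neq[OF Z z False] by (auto simp: in_minor_def)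
      then have p: "(pedge v, v) \<in> incident ?Z v" using pedge_in(1)[OF z] by (simp add: incident_def)
      have "?h (pedge v, v) = [False]" using join[OF z] new upper_lower_ready(2)[OF rd z] by simp
      then obtain x where x: "A v = Some x" "x \<in> ?h ` incident ?Z v" "rank_le [False] x"
        using A' p by (cases "A v") force+
      then have "x = [] \<or> x = [False]" by (auto split: if_splits)
      then show "A v = Some [False]" using x by (auto simp: rank_le_def)
    qed
    moreover have "ntop (nst (Suc t) v) \<longleftrightarrow> ntop (nst t v) \<and> A v \<noteq> Some [False]"
      using n[OF v] node_step_ready[OF rd v] by simp
    ultimately show ?thesis using mg v False by (simp add: merging_def)
  qed
  ultimately show "merging D (Suc k) (Suc t)" unfolding merging_def by blast
  show "nval (nst (Suc t) v) = nval (nst t v)" if "v \<in> V" for v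
    using n[OF that] node_step_ready[OF rd that] by simp
qed

lemma merge_phase:
  assumes "ready D t (map Merge [k..<merge_steps D] @ is)" "merging D k t" "k \<le> merge_steps D"
  shows "merging D (merge_steps D) (t + (merge_steps D - k)) \<and>
    (\<forall>v\<in>V. nval (nst (t + (merge_steps D - k)) v) = nval (nst t v))"
  using assms
proof (induction "merge_steps D - k" arbitrary: k t)
  case (Suc n)
  then have k: "k < merge_steps D" by simp
  then have rd: "ready D t (Merge k # map Merge [Suc k..<merge_steps D] @ is)"
    using Suc.prems(1) by (simp add: upt_conv_Cons)
  have "n = merge_steps D - Suc k" "t + (merge_steps D - k) = Suc t + (merge_steps D - Suc k)"
    using Suc.hyps(2) by auto
  then show ?case
    using Suc.hyps(1)[OF _ ready_Suc[OF rd]] merge_round[OF rd Suc.prems(2) k] k by auto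
qed auto

definition timed :: "nat \<Rightarrow> nat \<Rightarrow> bool" where
  "timed D t \<longleftrightarrow> (\<forall>z\<in>V - {r}. etime (est t (pedge z)) = merge_time D z)"

subsection \<open>The summation phase\<close>

definition same :: "nat \<Rightarrow> nat \<Rightarrow> bool" where
  "same t t' \<longleftrightarrow> (\<forall>v\<in>V. nval (nst t' v) = nval (nst t v) \<and> nsize (nst t' v) = nsize (nst t v)) \<and>
     (\<forall>e\<in>E. etime (est t' e) = etime (est t e) \<and> esize (est t' e) = esize (est t e) \<and>
            eres (est t' e) = eres (est t e))"

lemma same_trans: "same t t' \<Longrightarrow> same t' t'' \<Longrightarrow> same t t''"
  by (simp add: same_def)

lemma same_timed: "same t t' \<Longrightarrow> timed D t \<Longrightarrow> timed D t'"
  using pedge_in(1) by (simp add: same_def timed_def)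

lemma same_sum_round:
  assumes rd: "ready D t (i # is)" and i: "i = Push k \<or> i = Pull k"
  shows "same t (Suc t)"
proof -
  have "nval (nst (Suc t) v) = nval (nst t v) \<and> nsize (nst (Suc t) v) = nsize (nst t v)" if v: "v \<in> V" for v
  proof -
    obtain x where "nst (Suc t) v = node_step (nst t v) x" using node_step_ex[OF v] by blast
    then show ?thesis using node_step_ready[OF rd v] i by (cases x) auto
  qed
  moreover have "etime (est (Suc t) e) = etime (est t e) \<and> esize (est (Suc t) e) = esize (est t e) \<and>
      eres (est (Suc t) e) = eres (est t e)" if e: "e \<in> E" for e
  proof -
    obtain l where "est (Suc t) e = edge_step (est t e) l" using edge_step_ex[OF e] by blast
    then show ?thesis using edge_step_ready[OF rd e] i by auto
  qed
  ultimately show ?thesis by (simp add: same_def)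
qed

lemma push_round:
  assumes rd: "ready D t (Push k # is)" and tm: "timed D t"
    and S: "\<And>z. z \<in> V - {r} \<Longrightarrow> k < merge_time D z \<Longrightarrow> esum (est t (pedge z)) = sum f (desc z) mod 2 ^ D"
  shows "v \<in> V \<Longrightarrow> npend (nst (Suc t) v) =
      (\<Sum>z\<in>{z \<in> V - {r}. par z = v \<and> k < merge_time D z}. sum f (desc z)) mod 2 ^ D"
    and "e \<in> E \<Longrightarrow> esum (est (Suc t) e) = esum (est t e)"
proof -
  have contr: "edge_contracts (Push k) (est t e) \<longleftrightarrow> e \<in> parent_edges {}" if "e \<in> E" for e by simp
  obtain Y A L where A: "\<And>v. v \<in> V \<Longrightarrow> aggregates_opt combine
       (image_mset (\<lambda>(e, u). edge_message (Push k) (est t e) (L e) u) (mset_set (incident {} v))) (A v)"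
    and n: "\<And>v. v \<in> V \<Longrightarrow> nst (Suc t) v = node_step (nst t v) (Y v, A v)"
    and e: "\<And>e. e \<in> E \<Longrightarrow> est (Suc t) e = edge_step (est t e) (L e)"
    by (rule round_cases[OF empty_subsetI ready_simps(1)[OF rd] contr]) blast+
  show "esum (est (Suc t) e) = esum (est t e)" if "e \<in> E" for e
    using e[OF that] edge_step_ready[OF rd that] by simp
  assume v: "v \<in> V"
  let ?Q = "\<lambda>e u. u = upper (est t e) \<and> k < etime (est t e)"
  let ?g = "\<lambda>(e, u). if e \<in> T \<and> ?Q e u then esum (est t e) else 0"
  have "(\<lambda>(e, u). edge_message (Push k) (est t e) (L e) u) p = True # enc D (?g p)"
    if "p \<in> incident {} v" for p
    using that ready_simps(6,7)[OF rd] by (cases p) (auto simp: incident_def)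
  from aggregates_opt_sum_set[OF A[OF v] this finite_incident]
  have "received (A v) = sum ?g (incident {} v) mod 2 ^ D" .
  also have "sum ?g (incident {} v) =
      (\<Sum>z\<in>{z \<in> V - {r}. v \<in> pedge z \<and> ?Q (pedge z) v}. esum (est t (pedge z)))"
    by (rule sum_incident_tree)
  also have "{z \<in> V - {r}. v \<in> pedge z \<and> ?Q (pedge z) v} = {z \<in> V - {r}. par z = v \<and> k < merge_time D z}"
  proof -
    have "(v \<in> pedge z \<and> ?Q (pedge z) v) = (par z = v \<and> k < merge_time D z)" if z: "z \<in> V - {r}" for z
    proof -
      have "etime (est t (pedge z)) = merge_time D z" using tm z by (simp add: timed_def)
      then show ?thesis unfolding upper_lower_ready(1)[OF rd z] by auto
    qed
    then show ?thesis by (intro Collect_cong) blast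
  qed
  also have "(\<Sum>z\<in>\<dots>. esum (est t (pedge z))) =
      (\<Sum>z\<in>{z \<in> V - {r}. par z = v \<and> k < merge_time D z}. sum f (desc z) mod 2 ^ D)"
    using S by (intro sum.cong) auto
  finally have "received (A v) =
      (\<Sum>z\<in>{z \<in> V - {r}. par z = v \<and> k < merge_time D z}. sum f (desc z)) mod 2 ^ D"
    by (simp add: mod_sum_eq)
  then show "npend (nst (Suc t) v) =
      (\<Sum>z\<in>{z \<in> V - {r}. par z = v \<and> k < merge_time D z}. sum f (desc z)) mod 2 ^ D"
    using n[OF v] node_step_ready[OF rd v] by simp
qed

lemma pull_round:
  assumes rd: "ready D t (Pull k # is)" and tm: "timed D t" and all: "merged D K = V - {r}"
    and val: "\<And>v. v \<in> V \<Longrightarrow> nval (nst t v) = f v"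
    and pend: "\<And>v. v \<in> V \<Longrightarrow> npend (nst t v) =
      (\<Sum>z\<in>{z \<in> V - {r}. par z = v \<and> k < merge_time D z}. sum f (desc z)) mod 2 ^ D"
    and z: "z \<in> V - {r}"
  shows "esum (est (Suc t) (pedge z)) =
    (if merge_time D z = k then sum f (desc z) mod 2 ^ D else esum (est t (pedge z)))"
proof -
  let ?Z = "merged D k"
  note Z = merged_subset[of D k]
  have "edge_contracts (Pull k) (est t (pedge z)) \<longleftrightarrow> z \<in> ?Z" if "z \<in> V - {r}" for z
    using upper_lower_ready[OF rd that] tm that merged_iff_merge_time[of z D K k] all by (simp add: timed_def)
  then have contr: "edge_contracts (Pull k) (est t e) \<longleftrightarrow> e \<in> parent_edges ?Z" if "e \<in> E" for e
    using contracts_iff[OF rd Z] that by blast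
  obtain Y A L where Y: "\<And>v. v \<in> V \<Longrightarrow> aggregates combine (image_mset (\<lambda>u. node_message (Pull k) (nst t u))
       (mset_set {u \<in> V. topmost ?Z u = topmost ?Z v})) (Y v)"
    and L: "\<And>e u. e \<in> E \<Longrightarrow> L e u = (if in_minor ?Z e \<and> u \<in> e then Some (Y u) else None)"
    and e: "\<And>e. e \<in> E \<Longrightarrow> est (Suc t) e = edge_step (est t e) (L e)"
    by (rule round_cases[OF Z ready_simps(1)[OF rd] contr]) blast+
  have step: "est (Suc t) (pedge z) = (edge_update (Pull k) (L (pedge z)) (est t (pedge z)))\<lparr>etodo := is\<rparr>"
    using e[OF pedge_in(1)[OF z]] edge_step_ready[OF rd pedge_in(1)[OF z]] by simp
  have time: "etime (est t (pedge z)) = merge_time D z" using tm z by (simp add: timed_def)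
  show ?thesis
  proof (cases "merge_time D z = k")
    case False
    then show ?thesis using step time by simp
  next
    case True
    \<comment> \<open>Before its own step \<open>z\<close> is still the name of its cluster, whose
      total the parent edge now reads.\<close>
    then have nz: "z \<notin> ?Z" using merged_iff_merge_time[of z D K k] all z by simp
    let ?S = "{u \<in> V. topmost ?Z u = z}"
    let ?P = "\<lambda>u. \<Sum>c\<in>{c \<in> V - {r}. par c = u \<and> k < merge_time D c}. sum f (desc c)"
    have zV: "z \<in> V" using z by simp
    have msg: "node_message (Pull k) (nst t u) = True # enc D (f u + ?P u mod 2 ^ D)" if "u \<in> ?S" for u
      using that ready_simps(4)[OF rd] val pend by simp
    have "finite ?S" using finite_V by simp
    with aggregates_sum_set[OF Y[OF zV, unfolded topmost_outside[OF nz]] msg]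
    have Yz: "Y z = True # enc D (\<Sum>u\<in>?S. f u + ?P u mod 2 ^ D)" by simp
    have "in_minor ?Z (pedge z)" using topmost_par_neq[OF Z z nz] by (auto simp: in_minor_def)
    then have "L (pedge z) z = Some (Y z)" using L[OF pedge_in(1)[OF z]] by simp
    then have "esum (est (Suc t) (pedge z)) = (\<Sum>u\<in>?S. f u + ?P u mod 2 ^ D) mod 2 ^ D"
      using step time True upper_lower_ready(2)[OF rd z] Yz by (simp add: dec_enc)
    \<comment> \<open>The pending amounts were reduced one node at a time; the outer reduction
      absorbs this.\<close>
    also have "\<dots> = (\<Sum>u\<in>?S. (f u + ?P u mod 2 ^ D) mod 2 ^ D) mod 2 ^ D" by (simp only: mod_sum_eq)
    also have "\<dots> = (\<Sum>u\<in>?S. (f u + ?P u) mod 2 ^ D) mod 2 ^ D" by (simp only: mod_add_right_eq)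
    also have "\<dots> = (\<Sum>u\<in>?S. f u + ?P u) mod 2 ^ D" by (simp only: mod_sum_eq)
    also have "(\<Sum>u\<in>?S. f u + ?P u) = sum f (desc z)"
      using sum_desc_merge[OF all z, of f] True by simp
    finally show ?thesis using True by simp
  qed
qed

text \<open>Induction on the number of steps still to be undone, with the sums of edges merged at
  step \<open>k\<close> or later already in place.\<close>

lemma sum_phase_aux:
  assumes "ready D t (sum_prog k @ is)" "timed D t" "merged D K = V - {r}"
    and "\<And>v. v \<in> V \<Longrightarrow> nval (nst t v) = f v"
    and "\<And>z. z \<in> V - {r} \<Longrightarrow> k \<le> merge_time D z \<Longrightarrow> esum (est t (pedge z)) = sum f (desc z) mod 2 ^ D"
  shows "same t (t + 2 * k) \<and> (\<forall>z\<in>V - {r}. esum (est (t + 2 * k) (pedge z)) = sum f (desc z) mod 2 ^ D)"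
  using assms
proof (induction k arbitrary: t)
  case 0
  then show ?case by (simp add: same_def)
next
  case (Suc k)
  have rd0: "ready D t (Push k # Pull k # sum_prog k @ is)" using Suc.prems(1) by (simp add: sum_prog_Suc)
  note rd1 = ready_Suc[OF rd0]
  note rd2 = ready_Suc[OF rd1]
  have s1: "same t (Suc t)" using same_sum_round[OF rd0] by blast
  have s2: "same (Suc t) (Suc (Suc t))" using same_sum_round[OF rd1] by blast
  note s = same_trans[OF s1 s2]
  have S: "esum (est t (pedge z)) = sum f (desc z) mod 2 ^ D" if "z \<in> V - {r}" "k < merge_time D z" for z
    using Suc.prems(5) that by simp
  have val1: "nval (nst (Suc t) v) = f v" if "v \<in> V" for v
    using s1 Suc.prems(4) that by (simp add: same_def)
  note pull = pull_round[OF rd1 same_timed[OF s1 Suc.prems(2)] Suc.prems(3) val1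
      push_round(1)[OF rd0 Suc.prems(2) S]]
  have "esum (est (Suc (Suc t)) (pedge z)) = sum f (desc z) mod 2 ^ D" if "z \<in> V - {r}" "k \<le> merge_time D z" for z
    using pull[OF _ _ _ _ that(1)] push_round(2)[OF rd0 Suc.prems(2) S pedge_in(1)[OF that(1)]] S[OF that(1)] that(2)
    by (cases "merge_time D z = k") simp_all
  moreover have "nval (nst (Suc (Suc t)) v) = f v" if "v \<in> V" for v
    using s Suc.prems(4) that by (simp add: same_def)
  ultimately have "same (Suc (Suc t)) (Suc (Suc t) + 2 * k) \<and>
      (\<forall>z\<in>V - {r}. esum (est (Suc (Suc t) + 2 * k) (pedge z)) = sum f (desc z) mod 2 ^ D)"
    using Suc.IH[OF rd2 same_timed[OF s Suc.prems(2)] Suc.prems(3)] by blast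
  then show ?case using same_trans[OF s] by simp
qed

lemma sum_phase:
  assumes rd: "ready D t (sum_prog (merge_steps D) @ is)" and tm: "timed D t"
    and all: "merged D (merge_steps D) = V - {r}"
  defines "t' \<equiv> t + 2 * merge_steps D"
  shows "ready D t' is" "same t t'" "timed D t'"
    and "z \<in> V - {r} \<Longrightarrow> esum (est t' (pedge z)) = (\<Sum>v\<in>desc z. nval (nst t v)) mod 2 ^ D"
proof -
  show "ready D t' is" using ready_drop[OF rd, of "2 * merge_steps D"] by (simp add: t'_def length_sum_prog)
  \<comment> \<open>No merge time reaches \<open>merge_steps D\<close>, so at the start no sum needs
    to be known.\<close>
  have no: False if "z \<in> V - {r}" "merge_steps D \<le> merge_time D z" for z
    using merged_iff_merge_time[of z D "merge_steps D" "merge_steps D"] all that by simp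
  have "same t t' \<and> (\<forall>z\<in>V - {r}. esum (est t' (pedge z)) = (\<Sum>v\<in>desc z. nval (nst t v)) mod 2 ^ D)"
    unfolding t'_def using sum_phase_aux[OF rd tm all, of "\<lambda>v. nval (nst t v)"] no by blast
  then show "same t t'" "timed D t'"
    "z \<in> V - {r} \<Longrightarrow> esum (est t' (pedge z)) = (\<Sum>v\<in>desc z. nval (nst t v)) mod 2 ^ D"
    using same_timed tm by blast+
qed

end

lemma int_less_power_iff: "int n < 2 ^ k \<longleftrightarrow> n < 2 ^ k"
  by (metis of_nat_less_iff of_nat_numeral of_nat_power)

lemma power_le_int_iff: "2 ^ k \<le> int n \<longleftrightarrow> 2 ^ k \<le> n"
  by (metis of_nat_le_iff of_nat_numeral of_nat_power)

context ma_run
begin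

subsection \<open>Distributing subtree sizes\<close>

lemma etime_Suc:
  assumes "ready D t (i # is)" "\<And>k. i \<noteq> Merge k" "e \<in> E"
  shows "etime (est (Suc t) e) = etime (est t e)"
proof -
  obtain l where "est (Suc t) e = edge_step (est t e) l" using edge_step_ex[OF assms(3)] by blast
  then show ?thesis
    using edge_step_ready[OF assms(1,3)] assms(2) ready_not_Announce[OF assms(1)] by (cases i) auto
qed

lemma timed_Suc:
  assumes "ready D t (i # is)" "\<And>k. i \<noteq> Merge k" "timed D t"
  shows "timed D (Suc t)"
  using etime_Suc[OF assms(1,2) pedge_in(1)] assms(3) by (simp add: timed_def)

lemma mod_subtree_size: "v \<in> V \<Longrightarrow> card V < 2 ^ D \<Longrightarrow> int (subtree_size v) mod 2 ^ D = int (subtree_size v)"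
proof -
  assume "card V < 2 ^ D"
  moreover have "subtree_size v \<le> card V"
    using card_mono[OF finite_V desc_subset] by (simp add: subtree_size_def)
  ultimately show ?thesis by (simp add: int_less_power_iff)
qed

text \<open>A node is the lower endpoint of its parent edge only, so the sum has one summand; for
  the root it is empty, which yields the dummy size 0.\<close>

lemma tell_node_round:
  assumes rd: "ready D t (Tell_Node # is)" and cV: "card V < 2 ^ D"
    and S: "\<And>z. z \<in> V - {r} \<Longrightarrow> esum (est t (pedge z)) = int (subtree_size z)" and v: "v \<in> V"
  shows "nsize (nst (Suc t) v) = int (subtree_size v)"
proof -
  have contr: "edge_contracts Tell_Node (est t e) \<longleftrightarrow> e \<in> parent_edges {}" if "e \<in> E" for e by simp
  obtain Y A L where A: "\<And>v. v \<in> V \<Longrightarrow> aggregates_opt combine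
       (image_mset (\<lambda>(e, u). edge_message Tell_Node (est t e) (L e) u) (mset_set (incident {} v))) (A v)"
    and n: "\<And>v. v \<in> V \<Longrightarrow> nst (Suc t) v = node_step (nst t v) (Y v, A v)"
    by (rule round_cases[OF empty_subsetI ready_simps(1)[OF rd] contr]) blast+
  let ?Q = "\<lambda>e u. u = lower (est t e)"
  let ?g = "\<lambda>(e, u). if e \<in> T \<and> ?Q e u then esum (est t e) else 0"
  have "(\<lambda>(e, u). edge_message Tell_Node (est t e) (L e) u) p = True # enc D (?g p)"
    if "p \<in> incident {} v" for p
    using that ready_simps(6,7)[OF rd] by (cases p) (auto simp: incident_def)
  from aggregates_opt_sum_set[OF A[OF v] this finite_incident]
  have "received (A v) = sum ?g (incident {} v) mod 2 ^ D" .
  also have "sum ?g (incident {} v) =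
      (\<Sum>z\<in>{z \<in> V - {r}. v \<in> pedge z \<and> ?Q (pedge z) v}. esum (est t (pedge z)))"
    by (rule sum_incident_tree)
  also have "{z \<in> V - {r}. v \<in> pedge z \<and> ?Q (pedge z) v} = (if v = r then {} else {v})"
  proof -
    have "(v \<in> pedge z \<and> ?Q (pedge z) v) = (z = v)" if z: "z \<in> V - {r}" for z
      unfolding upper_lower_ready(2)[OF rd z] by auto
    then have "{z \<in> V - {r}. v \<in> pedge z \<and> ?Q (pedge z) v} = {z \<in> V - {r}. z = v}"
      by (intro Collect_cong) blast
    then show ?thesis using v by auto
  qed
  also have "(\<Sum>z\<in>\<dots>. esum (est t (pedge z))) = int (subtree_size v)"
    using S[of v] v by (auto simp: subtree_size_def)
  also have "int (subtree_size v) mod 2 ^ D = int (subtree_size v)" using mod_subtree_size v cV .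
  finally show ?thesis using n[OF v] node_step_ready[OF rd v] by simp
qed

definition sized :: "nat \<Rightarrow> bool" where
  "sized t \<longleftrightarrow> (\<forall>v\<in>V. nsize (nst t v) = int (subtree_size v)) \<and>
     (\<forall>e\<in>E. \<forall>u\<in>e. esize (est t e) u = int (subtree_size u))"

lemma tell_edge_round:
  assumes rd: "ready D t (Tell_Edge # is)" and cV: "card V < 2 ^ D"
    and S: "\<And>v. v \<in> V \<Longrightarrow> nsize (nst t v) = int (subtree_size v)"
  shows "sized (Suc t)"
proof -
  have contr: "edge_contracts Tell_Edge (est t e) \<longleftrightarrow> e \<in> parent_edges {}" if "e \<in> E" for e by simp
  obtain Y A L where Y: "\<And>v. v \<in> V \<Longrightarrow> aggregates combine (image_mset (\<lambda>u. node_message Tell_Edge (nst t u))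
       (mset_set {u \<in> V. topmost {} u = topmost {} v})) (Y v)"
    and L: "\<And>e u. e \<in> E \<Longrightarrow> L e u = (if in_minor {} e \<and> u \<in> e then Some (Y u) else None)"
    and n: "\<And>v. v \<in> V \<Longrightarrow> nst (Suc t) v = node_step (nst t v) (Y v, A v)"
    and e: "\<And>e. e \<in> E \<Longrightarrow> est (Suc t) e = edge_step (est t e) (L e)"
    by (rule round_cases[OF empty_subsetI ready_simps(1)[OF rd] contr]) blast+
  have Y: "Y v = True # enc D (int (subtree_size v))" if v: "v \<in> V" for v
  proof -
    have S: "{u \<in> V. topmost {} u = topmost {} v} = {v}" using v by (auto simp: topmost_outside)
    have "aggregates combine (image_mset (\<lambda>u. node_message Tell_Edge (nst t u)) (mset_set {v})) (Y v)"
      using Y[OF v] unfolding S .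
    then have "Y v = True # enc D (\<Sum>v\<in>{v}. int (subtree_size v))"
      by (rule aggregates_sum_set) (use assms(3) ready_simps(4)[OF rd] v in auto)
    then show ?thesis by simp
  qed
  have "esize (est (Suc t) e) u = int (subtree_size u)" if eu: "e \<in> E" "u \<in> e" for e u
  proof -
    have u: "u \<in> V" using edges eu by blast
    have "L e u = Some (True # enc D (int (subtree_size u)))"
      using L[OF eu(1)] in_minor_empty[OF eu(1)] eu(2) Y[OF u] by simp
    then show ?thesis using e[OF eu(1)] edge_step_ready[OF rd eu(1)] mod_subtree_size[OF u cV]
      by (simp add: dec_enc)
  qed
  moreover have "nsize (nst (Suc t) v) = int (subtree_size v)" if "v \<in> V" for v
    using n[OF that] node_step_ready[OF rd that] S[OF that] by simp
  ultimately show ?thesis by (simp add: sized_def)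
qed

subsection \<open>The size class phases\<close>

lemma same_sized: "same t t' \<Longrightarrow> sized t \<Longrightarrow> sized t'"
  by (simp add: same_def sized_def)

lemma class_round_keeps:
  assumes rd: "ready D t (i # is)" and i: "i = Separate j \<or> i = Charge j \<or> i = Record j"
  shows "sized t \<Longrightarrow> sized (Suc t)"
    and "e \<in> E \<Longrightarrow> i \<noteq> Record j \<Longrightarrow> eres (est (Suc t) e) = eres (est t e)"
proof -
  have n: "nsize (nst (Suc t) v) = nsize (nst t v)" if v: "v \<in> V" for v
  proof -
    obtain x where "nst (Suc t) v = node_step (nst t v) x" using node_step_ex[OF v] by blast
    then show ?thesis using node_step_ready[OF rd v] i by (cases x) auto
  qed
  have e: "esize (est (Suc t) e) = esize (est t e) \<and> (i \<noteq> Record j \<longrightarrow> eres (est (Suc t) e) = eres (est t e))"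
    if e: "e \<in> E" for e
  proof -
    obtain l where "est (Suc t) e = edge_step (est t e) l" using edge_step_ex[OF e] by blast
    then show ?thesis using edge_step_ready[OF rd e] i by auto
  qed
  show "sized t \<Longrightarrow> sized (Suc t)" using n e by (simp add: sized_def)
  show "e \<in> E \<Longrightarrow> i \<noteq> Record j \<Longrightarrow> eres (est (Suc t) e) = eres (est t e)" using e by blast
qed

lemma sized_ends:
  assumes "sized t" "z \<in> V - {r}"
  shows "esize (est t (pedge z)) z = int (subtree_size z)" "esize (est t (pedge z)) (par z) = int (subtree_size (par z))"
  using assms pedge_in(1)[OF assms(2)] by (auto simp: sized_def)

text \<open>An edge learns something only if it survives in the minor, so receipt alone answers the
  question.\<close>

lemma separate_round:
  assumes rd: "ready D t (Separate j # is)" and sz: "sized t" and e: "e \<in> E"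
  shows "esep (est (Suc t) e) \<longleftrightarrow> in_minor (small_parent j) e"
proof -
  note Z = small_parent_subset[of j]
  have "edge_contracts (Separate j) (est t (pedge z)) \<longleftrightarrow> z \<in> small_parent j" if z: "z \<in> V - {r}" for z
    using z upper_lower_ready[OF rd z] sized_ends[OF sz z] int_less_power_iff[of _ "Suc j"]
    by (simp add: small_parent_def)
  then have contr: "edge_contracts (Separate j) (est t e) \<longleftrightarrow> e \<in> parent_edges (small_parent j)"
    if "e \<in> E" for e
    using contracts_iff[OF rd Z] that by blast
  obtain Y A L where L: "\<And>e u. e \<in> E \<Longrightarrow> L e u = (if in_minor (small_parent j) e \<and> u \<in> e then Some (Y u) else None)"
    and step: "\<And>e. e \<in> E \<Longrightarrow> est (Suc t) e = edge_step (est t e) (L e)"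
    by (rule round_cases[OF Z ready_simps(1)[OF rd] contr]) blast+
  have "e \<noteq> {}" using edges[OF e] by auto
  then show ?thesis using step[OF e] edge_step_ready[OF rd e] L[OF e] by auto
qed

text \<open>Children of the root have a parent of dummy size 0 and are not contracted, so the root
  stays alone in its supernode.\<close>

lemma topmost_hanging_root:
  assumes "v \<in> V" "topmost (hanging j) v = r"
  shows "v = r"
  using hanging_subset[of j] assms
proof (induction v rule: topmost_induct)
  case (inside v)
  then have "par v = r" using topmost_inside[OF hanging_subset, of v j] by simp
  then show ?case using inside by (simp add: hanging_def small_parent_def subtree_size_def)
qed (simp add: topmost_outside)

lemma charge_round:
  assumes rd: "ready D t (Charge j # is)" and sz: "sized t" and cV: "card V < 2 ^ D"
    and sep: "\<And>e. e \<in> E \<Longrightarrow> esep (est t e) \<longleftrightarrow> in_minor (small_parent j) e" and v: "v \<in> V"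
  shows "nval (nst (Suc t) v) = class_value E w j v mod 2 ^ D"
proof -
  let ?Z = "hanging j"
  note Z = hanging_subset[of j]
  have "edge_contracts (Charge j) (est t (pedge z)) \<longleftrightarrow> z \<in> ?Z" if z: "z \<in> V - {r}" for z
    using z upper_lower_ready[OF rd z] sized_ends[OF sz z] int_less_power_iff[of _ "Suc j"]
      int_less_power_iff[of _ j]
    by (simp add: small_parent_def hanging_def)
  then have contr: "edge_contracts (Charge j) (est t e) \<longleftrightarrow> e \<in> parent_edges ?Z" if "e \<in> E" for e
    using contracts_iff[OF rd Z] that by blast
  obtain Y A L where Y: "\<And>v. v \<in> V \<Longrightarrow> aggregates combine (image_mset (\<lambda>u. node_message (Charge j) (nst t u))
       (mset_set {u \<in> V. topmost ?Z u = topmost ?Z v})) (Y v)"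
    and A: "\<And>v. v \<in> V \<Longrightarrow> aggregates_opt combine
       (image_mset (\<lambda>(e, u). edge_message (Charge j) (est t e) (L e) u) (mset_set (incident ?Z v))) (A v)"
    and L: "\<And>e u. e \<in> E \<Longrightarrow> L e u = (if in_minor ?Z e \<and> u \<in> e then Some (Y u) else None)"
    and n: "\<And>v. v \<in> V \<Longrightarrow> nst (Suc t) v = node_step (nst t v) (Y v, A v)"
    by (rule round_cases[OF Z ready_simps(1)[OF rd] contr]) blast+
  have msg: "node_message (Charge j) (nst t u) = False # enc D (int (subtree_size u))" if "u \<in> V" for u
    using ready_simps(4)[OF rd that] sz that by (simp add: sized_def)
  have dec_size: "dec (enc D (int (subtree_size u))) = int (subtree_size u)" if "u \<in> V" for u
    using mod_subtree_size[OF that cV] by (simp add: dec_enc)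
  \<comment> \<open>The topmost node has the largest subtree of its supernode, and equally long
    encodings are ranked by value; thus edges learn the sizes of the path nodes.\<close>
  have Y: "dec (tl (Y v)) = int (subtree_size (topmost ?Z v))" if v: "v \<in> V" for v
  proof -
    let ?S = "{u \<in> V. topmost ?Z u = topmost ?Z v}" and ?q = "topmost ?Z v"
    have fin: "finite ?S" using finite_V by simp
    have max: "Y v \<in> (\<lambda>u. node_message (Charge j) (nst t u)) ` ?S"
      "\<And>u. u \<in> ?S \<Longrightarrow> rank_le (node_message (Charge j) (nst t u)) (Y v)"
      using aggregates_max_set[OF Y[OF v] _ fin] msg by auto
    have q: "?q \<in> ?S" using topmost_props[OF Z v] by (simp add: topmost_outside)
    obtain u where u: "u \<in> ?S" "Y v = False # enc D (int (subtree_size u))" using max(1) msg by auto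
    have "rank_le (False # enc D (int (subtree_size ?q))) (Y v)" using max(2)[OF q] msg q by simp
    then have "subtree_size ?q \<le> subtree_size u"
      using u q dec_size[of u] dec_size[of ?q] by (simp add: rank_le_def dec_def)
    moreover have "subtree_size u \<le> subtree_size ?q"
    proof (cases "?q = r")
      case True
      then show ?thesis using topmost_hanging_root[of u j] u(1) by simp
    next
      case False
      have "u \<in> desc (topmost ?Z u)" using topmost_props(3)[OF Z, of u] u(1) by blast
      then have "u \<in> desc ?q" using u(1) by simp
      then show ?thesis using False by (rule subtree_size_mono)
    qed
    ultimately show ?thesis using u dec_size[of u] by simp
  qed
  have emsg: "(\<lambda>(e, u). edge_message (Charge j) (est t e) (L e) u) p =
      True # enc D ((\<lambda>(e, u). signed_weight w j e u) p)" if p: "p \<in> incident ?Z v" for p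
  proof -
    obtain e u where eu: "p = (e, u)" by fastforce
    then have e: "e \<in> E" "in_minor ?Z e" "u \<in> e" using p by (auto simp: incident_def)
    then have eV: "e \<subseteq> V" using edges by blast
    have "dec (tl (the (L e x))) = int (subtree_size (topmost ?Z x))" if "x \<in> e" for x
      using L[OF e(1)] e(2) that eV Y by auto
    then show ?thesis using e eu sep[OF e(1)] ready_simps(6,7)[OF rd e(1)]
      by (auto simp: signed_weight_def)
  qed
  from aggregates_opt_sum_set[OF A[OF v] this finite_incident]
  have "received (A v) = (\<Sum>(e, u)\<in>incident ?Z v. signed_weight w j e u) mod 2 ^ D" .
  moreover have "2 ^ j \<le> nsize (nst t v) \<and> nsize (nst t v) < 2 ^ Suc j \<longleftrightarrow> in_class j v"
    using sz v unfolding sized_def in_class_def by (simp only: int_less_power_iff power_le_int_iff)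
  ultimately show ?thesis using n[OF v] node_step_ready[OF rd v]
    by (auto simp: class_value_def incident_def)
qed

definition cut_value :: "node \<Rightarrow> nat" where
  "cut_value z = (\<Sum>e\<in>{e \<in> E. card (e \<inter> desc z) = 1}. w e)"

definition results :: "nat \<Rightarrow> nat \<Rightarrow> bool" where
  "results j t \<longleftrightarrow> (\<forall>z\<in>V - {r}. subtree_size z < 2 ^ j \<longrightarrow> eres (est t (pedge z)) = int (cut_value z))"

lemma record_round:
  assumes rd: "ready D t (Record j # is)" and sz: "sized t" and res: "results j t"
    and S: "\<And>z. z \<in> V - {r} \<Longrightarrow> in_class j z \<Longrightarrow> esum (est t (pedge z)) = int (cut_value z)"
  shows "results (Suc j) (Suc t)"
  unfolding results_def
proof (intro ballI impI)
  fix z assume z: "z \<in> V - {r}" and size: "subtree_size z < 2 ^ Suc j"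
  obtain l where l: "est (Suc t) (pedge z) = edge_step (est t (pedge z)) l"
    using edge_step_ex[OF pedge_in(1)[OF z]] by blast
  have "2 ^ j \<le> esize (est t (pedge z)) (lower (est t (pedge z))) \<and>
      esize (est t (pedge z)) (lower (est t (pedge z))) < 2 ^ Suc j \<longleftrightarrow> in_class j z"
    unfolding upper_lower_ready(2)[OF rd z] sized_ends(1)[OF sz z] in_class_def
      int_less_power_iff power_le_int_iff by simp
  then have "eres (est (Suc t) (pedge z)) =
      (if in_class j z then esum (est t (pedge z)) else eres (est t (pedge z)))"
    using l edge_step_ready[OF rd pedge_in(1)[OF z]] by simp
  moreover have "subtree_size z < 2 ^ j" if "\<not> in_class j z" using that size by (auto simp: in_class_def)
  ultimately show "eres (est (Suc t) (pedge z)) = int (cut_value z)"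
    using S[OF z] res z by (auto simp: results_def)
qed

lemma class_phase:
  assumes rd: "ready D t (class_prog D j @ is)" and tm: "timed D t" and sz: "sized t" and res: "results j t"
    and all: "merged D (merge_steps D) = V - {r}" and cV: "card V < 2 ^ D" and W: "sum w E < 2 ^ D"
  defines "t' \<equiv> t + (3 + 2 * merge_steps D)"
  shows "ready D t' is" "timed D t'" "sized t'" "results (Suc j) t'"
proof -
  have rd0: "ready D t (Separate j # Charge j # sum_prog (merge_steps D) @ Record j # is)"
    using rd by (simp add: class_prog_def)
  note rd1 = ready_Suc[OF rd0]
  note rd2 = ready_Suc[OF rd1]
  note tm1 = timed_Suc[OF rd0 _ tm, simplified]
  note tm2 = timed_Suc[OF rd1 _ tm1, simplified]
  have sz1: "sized (Suc t)" using class_round_keeps(1)[OF rd0 _ sz] by blast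
  have sz2: "sized (Suc (Suc t))" using class_round_keeps(1)[OF rd1 _ sz1] by blast
  let ?t3 = "Suc (Suc t) + 2 * merge_steps D"
  note sum = sum_phase[OF rd2 tm2 all]
  have val: "nval (nst (Suc (Suc t)) v) = class_value E w j v mod 2 ^ D" if "v \<in> V" for v
    using charge_round[OF rd1 sz1 cV separate_round[OF rd0 sz] that] .
  have esum: "esum (est ?t3 (pedge z)) = int (cut_value z)" if z: "z \<in> V - {r}" and cls: "in_class j z" for z
  proof -
    have "esum (est ?t3 (pedge z)) = (\<Sum>v\<in>desc z. class_value E w j v mod 2 ^ D) mod 2 ^ D"
      unfolding sum(4)[OF z] using val desc_subset[of z]
      by (intro arg_cong[where f = "\<lambda>x. x mod 2 ^ D"] sum.cong) auto
    also have "\<dots> = (\<Sum>v\<in>desc z. class_value E w j v) mod 2 ^ D" by (rule mod_sum_eq)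
    also have "(\<Sum>v\<in>desc z. class_value E w j v) = int (cut_value z)"
      unfolding cut_value_def using z cls by (intro sum_class_value finite_E edges) auto
    \<comment> \<open>A cut weighs at most as much as all edges together, so the reduction loses
      nothing.\<close>
    also have "int (cut_value z) mod 2 ^ D = int (cut_value z)"
    proof -
      have "cut_value z \<le> sum w E" unfolding cut_value_def by (rule sum_mono2) (auto simp: finite_E)
      then show ?thesis using W by (simp add: int_less_power_iff)
    qed
    finally show ?thesis .
  qed
  have sz3: "sized ?t3" using same_sized[OF sum(2) sz2] .
  have "eres (est ?t3 e) = eres (est t e)" if e: "e \<in> E" for e
    using class_round_keeps(2)[OF rd0 _ e] class_round_keeps(2)[OF rd1 _ e] sum(2) e by (simp add: same_def)
  then have res3: "results j ?t3" using res pedge_in(1) by (simp add: results_def)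
  have t': "t' = Suc ?t3" by (simp add: t'_def)
  show "ready D t' is" unfolding t' using ready_Suc[OF sum(1)] .
  show "timed D t'" unfolding t' using timed_Suc[OF sum(1) _ sum(3)] by simp
  show "sized t'" unfolding t' using class_round_keeps(1)[OF sum(1) _ sz3] by blast
  show "results (Suc j) t'" unfolding t' using record_round[OF sum(1) sz3 res3 esum] .
qed

lemma all_class_phases:
  assumes "ready D t (concat (map (class_prog D) [j..<D]))" "timed D t" "sized t" "results j t" "j \<le> D"
    and "merged D (merge_steps D) = V - {r}" "card V < 2 ^ D" "sum w E < 2 ^ D"
  shows "ready D (t + (D - j) * (3 + 2 * merge_steps D)) [] \<and>
    results D (t + (D - j) * (3 + 2 * merge_steps D))"
  using assms(1-5)
proof (induction "D - j" arbitrary: j t)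
  case 0
  then show ?case by simp
next
  case (Suc n)
  then have j: "j < D" by simp
  then have rd: "ready D t (class_prog D j @ concat (map (class_prog D) [Suc j..<D]))"
    using Suc.prems(1) by (simp add: upt_conv_Cons)
  note phase = class_phase[OF rd Suc.prems(2-4) assms(6-8)]
  have "D - j = Suc (D - Suc j)" using j by simp
  then have eq: "t + (D - j) * (3 + 2 * merge_steps D) =
      t + (3 + 2 * merge_steps D) + (D - Suc j) * (3 + 2 * merge_steps D)" by simp
  have "n = D - Suc j" using Suc.hyps(2) by simp
  then show ?case unfolding eq using Suc.hyps(1)[OF _ phase] j by simp
qed

lemma final_results:
  assumes rd: "ready D 3 (prog D)"
    and init: "\<And>v. v \<in> V \<Longrightarrow> ntop (nst 3 v) \<and> nval (nst 3 v) = 1"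
      "\<And>e. e \<in> E \<Longrightarrow> etime (est 3 e) = merge_steps D"
    and len: "\<And>v. v \<in> V \<Longrightarrow> length v \<le> D" and cV: "card V < 2 ^ D" and W: "sum w E < 2 ^ D"
    and z: "z \<in> V - {r}"
  shows "eres (est (run_length D) (pedge z)) = int (cut_value z)"
proof -
  let ?K = "merge_steps D"
  have all: "merged D ?K = V - {r}" unfolding merge_steps_def using all_merged[OF len] cV by simp
  have m0: "merging D 0 3" using init pedge_in(1) by (simp add: merging_def)
  define is1 where "is1 = Tell_Node # Tell_Edge # concat (map (class_prog D) [0..<D])"
  have rd0: "ready D 3 (map Merge [0..<?K] @ sum_prog ?K @ is1)" using rd by (simp add: prog_def is1_def)
  have rd1: "ready D (3 + ?K) (sum_prog ?K @ is1)" using ready_drop[OF rd0, of ?K] by simp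
  have "merging D ?K (3 + ?K)" and val: "\<And>v. v \<in> V \<Longrightarrow> nval (nst (3 + ?K) v) = 1"
    using merge_phase[OF rd0 m0] init by auto
  then have tm: "timed D (3 + ?K)" by (simp add: merging_def timed_def all)
  let ?t = "3 + ?K + 2 * ?K"
  note sum = sum_phase[OF rd1 tm all]
  \<comment> \<open>All node values are still 1, so the first summation counts descendants.\<close>
  have S: "esum (est ?t (pedge z)) = int (subtree_size z)" if z: "z \<in> V - {r}" for z
  proof -
    have "esum (est ?t (pedge z)) = (\<Sum>v\<in>desc z. 1) mod 2 ^ D"
      unfolding sum(4)[OF z] using val desc_subset[of z]
      by (intro arg_cong[where f = "\<lambda>x. x mod 2 ^ D"] sum.cong) auto
    also have "(\<Sum>v\<in>desc z. 1 :: int) = int (subtree_size z)" using z by (simp add: subtree_size_def)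
    also have "int (subtree_size z) mod 2 ^ D = int (subtree_size z)" using mod_subtree_size[OF _ cV] z by simp
    finally show ?thesis .
  qed
  note rd2 = sum(1)[unfolded is1_def]
  note rd3 = ready_Suc[OF rd2]
  note rd4 = ready_Suc[OF rd3]
  have sz: "sized (Suc (Suc ?t))" using tell_edge_round[OF rd3 cV tell_node_round[OF rd2 cV S]] .
  have tm4: "timed D (Suc (Suc ?t))"
    using timed_Suc[OF rd3 _ timed_Suc[OF rd2 _ sum(3)]] by simp
  have "results 0 (Suc (Suc ?t))"
    unfolding results_def using subtree_size_pos by (metis less_one nat_less_le power_0)
  then have "results D (Suc (Suc ?t) + (D - 0) * (3 + 2 * ?K))"
    using all_class_phases[OF rd4 tm4 sz _ _ all cV W] by blast
  moreover have "run_length D = Suc (Suc ?t) + (D - 0) * (3 + 2 * ?K)" by (simp add: run_length_eq)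
  ultimately have "results D (run_length D)" by simp
  moreover have "subtree_size z < 2 ^ D"
    using card_mono[OF finite_V desc_subset] cV z by (auto simp: subtree_size_def intro: le_less_trans)
  ultimately show ?thesis using z by (simp add: results_def)
qed

end

section \<open>Bit lengths: sufficient width, message bounds and decision times\<close>

lemma less_power_bit_length: "n < 2 ^ bit_length n"
  unfolding bit_length_def by (rule LeastI[of _ n]) simp

lemma bit_length_le: "n < 2 ^ b \<Longrightarrow> bit_length n \<le> b"
  unfolding bit_length_def by (rule Least_le)

lemma bit_length_mono: "n \<le> m \<Longrightarrow> bit_length n \<le> bit_length m"
  using less_power_bit_length[of m] by (intro bit_length_le) simp

context ma_run
begin

lemma root_has_child:
  assumes "v \<in> V - {r}"
  shows "\<exists>z\<in>V - {r}. par z = r"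
proof (rule ccontr)
  assume n: "\<not> ?thesis"
  have "v = r" if "v \<in> V" for v
    using that by (induction v rule: parent_induct) (use n in auto)
  then show False using assms by blast
qed

lemma node_in_edge:
  assumes "V \<noteq> {r}" "v \<in> V"
  shows "\<exists>e\<in>E. v \<in> e"
proof (cases "v = r")
  case False
  then show ?thesis using assms pedge_in(1)[of v] by auto
next
  case True
  obtain x where "x \<in> V - {r}" using assms root_in by auto
  then obtain z where "z \<in> V - {r}" "par z = r" using root_has_child by blast
  then show ?thesis using True pedge_in(1)[of z] by auto
qed

text \<open>Origin of \<open>3 * m + 3\<close>: fewer than \<open>2 ^ (m + 1)\<close> identifiers
  have length at most \<open>m\<close>, so there are at most \<open>2 ^ (2 * m + 2)\<close> edges,
  each of weight at most \<open>2 ^ m\<close>. A lone root has no edge to report its identifier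
  length, but also no cut to compute.\<close>

lemma width_suffices:
  assumes ne: "V \<noteq> {r}" and m: "\<And>e. e \<in> E \<Longrightarrow> probe_length (inp e) \<le> m"
  shows "v \<in> V \<Longrightarrow> length v \<le> width m" and "card V < 2 ^ width m" and "sum w E < 2 ^ width m"
proof -
  have len: "length v \<le> m" if v: "v \<in> V" for v
  proof -
    obtain e where e: "e \<in> E" "v \<in> e" using node_in_edge[OF ne v] by blast
    then have "length v \<le> (\<Sum>u\<in>e. length u)" using finite_edge by (intro member_le_sum) auto
    then show ?thesis using m[OF e(1)] by (simp add: probe_length_def)
  qed
  then show "length v \<le> width m" if "v \<in> V" using that by (fastforce simp: width_def)
  have wt: "w e \<le> 2 ^ m" if e: "e \<in> E" for e
  proof -
    have "w e < 2 ^ bit_length (w e)" by (rule less_power_bit_length)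
    also have "\<dots> \<le> 2 ^ m" using m[OF e] by (intro power_increasing) (auto simp: probe_length_def)
    finally show ?thesis by simp
  qed
  have "card V \<le> card {xs :: bool list. set xs \<subseteq> UNIV \<and> length xs \<le> m}"
    using len by (intro card_mono finite_lists_length_le) auto
  also have "\<dots> = (\<Sum>i\<le>m. 2 ^ i)" by (subst card_lists_length_le) auto
  also have "\<dots> < 2 ^ Suc m" by (induction m) auto
  finally have cV: "card V < 2 ^ Suc m" .
  also have "(2::nat) ^ Suc m \<le> 2 ^ width m" by (intro power_increasing) (auto simp: width_def)
  finally show "card V < 2 ^ width m" .
  have "E \<subseteq> (\<lambda>(u, v). {u, v}) ` (V \<times> V)" by (auto elim!: edge_cases)
  then have "card E \<le> card V * card V"
    using surj_card_le[of "V \<times> V" E] finite_V by (simp add: card_cartesian_product)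
  also have "\<dots> \<le> 2 ^ Suc m * 2 ^ Suc m" using cV by (intro mult_mono) auto
  finally have cE: "card E \<le> 2 ^ Suc m * 2 ^ Suc m" .
  have "sum w E \<le> card E * 2 ^ m" using sum_bounded_above[of E w "2 ^ m"] wt by simp
  also have "\<dots> \<le> 2 ^ Suc m * 2 ^ Suc m * 2 ^ m" using cE by (intro mult_mono) auto
  also have "\<dots> = 2 ^ (3 * m + 2)" by (simp add: power_add[symmetric] mult_ac flip: power_Suc)
  also have "\<dots> < (2::nat) ^ width m" by (intro power_strict_increasing) (auto simp: width_def)
  finally show "sum w E < 2 ^ width m" .
qed

lemma node_val_at:
  "node_val cut_algorithm (v, fst (c t) v) =
     (if ntodo (nst t v) = [] then [] else node_message (hd (ntodo (nst t v))) (nst t v))"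
  by (simp add: cut_algorithm_def Let_def nst_def)

lemma edge_val_at:
  "edge_val cut_algorithm (inp e, snd (c t) e) l v =
     (if etodo (est t e) = [] then [] else edge_message (hd (etodo (est t e))) (est t e) l v)"
  by (simp add: cut_algorithm_def Let_def est_def)

lemma edge_output_at:
  "edge_output cut_algorithm (inp e, snd (c t) e) =
     (if etodo (est t e) = [] then Some (nat (eres (est t e))) else None)"
  by (simp add: cut_algorithm_def Let_def est_def)

lemma node_message_ready:
  assumes "ready D t (i # is)" "v \<in> V"
  shows "length (node_message i (nst t v)) \<le> Suc (D + length v)"
proof -
  have "i \<notin> set setup_prog" "nid (nst t v) = v" "nwidth (nst t v) = D" using assms by (auto simp: ready_def)
  then show ?thesis by (cases i) (auto simp: setup_prog_def)
qed

lemma edge_message_ready: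
  assumes "ready D t (i # is)" "e \<in> E"
  shows "length (edge_message i (est t e) l v) \<le> Suc D"
proof -
  have "i \<notin> set setup_prog" "ewidth (est t e) = D" using assms by (auto simp: ready_def)
  then show ?thesis by (cases i) (auto simp: setup_prog_def)
qed

text \<open>The bound adds up one tag bit, an encoded number, and an identifier; the unary messages
  of the setup also fit since \<open>M \<le> width M\<close>.\<close>

lemma message_bounds:
  assumes M: "\<And>e. e \<in> E \<Longrightarrow> probe_length (inp e) \<le> M" and len: "\<And>v. v \<in> V \<Longrightarrow> length v \<le> I"
  shows "round_bounded cut_algorithm V E inp (Suc (width M + I)) (c t) (y t)"
proof -
  obtain m where m: "m = 0 \<or> (\<exists>e\<in>E. m = probe_length (inp e))"
    and rd: "ready (width m) 3 (prog (width m))"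
    and un: "\<And>v. v \<in> V \<Longrightarrow> length (nunary (nst 2 v)) = m"
    and td2: "todo 2 [Announce]"
    by (rule after_setup) blast
  have mM: "m \<le> M" using m M by auto
  have D: "width m \<le> width M" and MD: "M \<le> width M" using mM by (auto simp: width_def)
  consider "t = 0" | "t = 1" | "t = 2" | "t \<ge> 3" by linarith
  then have "(\<forall>v\<in>V. length (node_val cut_algorithm (v, fst (c t) v)) \<le> Suc (width M + I)) \<and>
      (\<forall>e\<in>E. \<forall>l v. length (edge_val cut_algorithm (inp e, snd (c t) e) l v) \<le> Suc (width M + I))"
  proof cases
    case 1
    then show ?thesis using M MD
      by (auto simp: node_val_at edge_val_at init_states node_init_def edge_init_def setup_prog_def
          intro: le_SucI trans_le_add1 order_trans)
  next
    case 2
    have "length (nunary (nst 1 v)) \<le> M \<and> ntodo (nst 1 v) = [Gather, Announce]" if "v \<in> V" for v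
      using after_probe(2)[OF that] M by auto
    then have "length (node_val cut_algorithm (v, fst (c t) v)) \<le> M" if "v \<in> V" for v
      using that unfolding node_val_at 2 by simp
    moreover have "edge_val cut_algorithm (inp e, snd (c t) e) l v = []" if "e \<in> E" for e l v
      using after_probe(3)[OF root_in that] unfolding edge_val_at 2 by simp
    ultimately show ?thesis using MD by (auto intro!: le_SucI trans_le_add1 intro: order_trans)
  next
    case 3
    have "length (node_val cut_algorithm (v, fst (c t) v)) \<le> M" if "v \<in> V" for v
      using that un mM todo_simps(1)[OF td2] unfolding node_val_at 3 by simp
    moreover have "edge_val cut_algorithm (inp e, snd (c t) e) l v = []" if "e \<in> E" for e l v
      using that todo_simps(2)[OF td2] unfolding edge_val_at 3 by simp
    ultimately show ?thesis using MD by (auto intro!: le_SucI trans_le_add1 intro: order_trans)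
  next
    case 4
    define js where "js = drop (t - 3) (prog (width m))"
    have rdt: "ready (width m) t js" using ready_drop[OF rd, of "t - 3"] 4 by (simp add: js_def)
    show ?thesis
    proof (cases js)
      case Nil
      then show ?thesis using ready_simps(2,5)[OF rdt] by (simp add: node_val_at edge_val_at)
    next
      case (Cons i is')
      note rdt = rdt[unfolded Cons]
      have "length (node_val cut_algorithm (v, fst (c t) v)) \<le> Suc (width M + I)" if "v \<in> V" for v
        using node_message_ready[OF rdt that] len[OF that] D ready_simps(2)[OF rdt that]
        unfolding node_val_at by simp
      moreover have "length (edge_val cut_algorithm (inp e, snd (c t) e) l v) \<le> Suc (width M + I)"
        if "e \<in> E" for e l v
        using edge_message_ready[OF rdt that, of l v] D ready_simps(5)[OF rdt that]
        unfolding edge_val_at by simp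
      ultimately show ?thesis by blast
    qed
  qed
  then show ?thesis by (auto simp: round_bounded_def Let_def minor_edges_def)
qed

text \<open>The width agreed upon depends on the actual input and may be smaller than the a priori
  bound, hence the existential \<open>D\<close>.\<close>

lemma tree_edges_decide:
  assumes M: "\<And>e. e \<in> E \<Longrightarrow> probe_length (inp e) \<le> M" and z: "z \<in> V - {r}"
  shows "\<exists>D\<le>width M. decides cut_algorithm inp c (pedge z) (run_length D) (cut_value z)"
proof -
  have e: "pedge z \<in> E" using pedge_in(1)[OF z] .
  obtain m where m: "m = 0 \<or> (\<exists>e\<in>E. m = probe_length (inp e))"
    and m_ge: "\<And>e. e \<in> E \<Longrightarrow> probe_length (inp e) \<le> m"
    and rd: "ready (width m) 3 (prog (width m))"
    and init: "\<And>v. v \<in> V \<Longrightarrow> ntop (nst 3 v) \<and> nval (nst 3 v) = 1"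
      "\<And>e. e \<in> E \<Longrightarrow> etime (est 3 e) = merge_steps (width m)"
    and td2: "todo 2 [Announce]"
    by (rule after_setup) blast
  let ?D = "width m"
  have "V \<noteq> {r}" using z by auto
  note suff = width_suffices[OF this m_ge]
  have res: "eres (est (run_length ?D) (pedge z)) = int (cut_value z)"
    by (rule final_results[OF rd init suff z])
  have "ready ?D (run_length ?D) []"
    using ready_drop[OF rd, of "length (prog ?D)"] by (simp add: run_length_def)
  then have "edge_output cut_algorithm (inp (pedge z), snd (c (run_length ?D)) (pedge z)) = Some (cut_value z)"
    using res ready_simps(5)[OF _ e] by (simp add: edge_output_at)
  moreover have "edge_output cut_algorithm (inp (pedge z), snd (c t) (pedge z)) = None"
    if t: "t < run_length ?D" for t
  proof -
    consider "t = 0" | "t = 1" | "t = 2" | "t \<ge> 3" by linarith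
    then have "etodo (est t (pedge z)) \<noteq> []"
    proof cases
      case 1
      then show ?thesis by (simp add: init_states edge_init_def setup_prog_def)
    next
      case 2
      then show ?thesis using after_probe(3)[OF root_in e] by simp
    next
      case 3
      then show ?thesis using todo_simps(2)[OF td2 e] by simp
    next
      case 4
      then have "ready ?D t (drop (t - 3) (prog ?D))" using ready_drop[OF rd, of "t - 3"] by simp
      then show ?thesis using ready_simps(5)[OF _ e] t 4 by (auto simp: run_length_def)
    qed
    then show ?thesis by (simp add: edge_output_at)
  qed
  moreover have "?D \<le> width M" using m M by (auto simp: width_def)
  ultimately show ?thesis unfolding decides_def by blast
qed

end

subsection \<open>Asymptotics\<close>

text \<open>Holds from \<open>n = 3\<close> on, and lets powers of \<open>ln\<close> be compared by
  their exponents.\<close>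

lemma ln_ge_one: "\<forall>\<^sub>F n in at_top. 1 \<le> ln (real n)"
proof -
  have "\<forall>\<^sub>F n::nat in at_top. 3 \<le> n" by (rule eventually_ge_at_top)
  then show ?thesis
  proof eventually_elim
    case (elim n)
    have "exp 1 \<le> real n" using exp_le elim by linarith
    then show ?case using elim by (simp add: ln_ge_iff)
  qed
qed

lemma soft_O1I:
  assumes "\<forall>\<^sub>F n in at_top. real (f n) \<le> C * ln (real n) ^ k"
  shows "soft_O1 f"
proof -
  have "(\<lambda>n. real (f n)) \<in> O(\<lambda>n. ln (real n) ^ k)"
  proof (rule bigoI)
    show "\<forall>\<^sub>F n in at_top. norm (real (f n)) \<le> C * norm (ln (real n) ^ k)"
      using assms ln_ge_one by eventually_elim simp
  qed
  then show ?thesis by (auto simp: soft_O1_def)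
qed

lemma soft_O1E:
  assumes "soft_O1 f"
  obtains C k where "0 < C" "\<forall>\<^sub>F n in at_top. real (f n) \<le> C * ln (real n) ^ k"
proof -
  obtain k where "(\<lambda>n. real (f n)) \<in> O(\<lambda>n. ln (real n) ^ k)" using assms by (auto simp: soft_O1_def)
  then obtain C where C: "0 < C" "\<forall>\<^sub>F n in at_top. norm (real (f n)) \<le> C * norm (ln (real n) ^ k)"
    by (elim landau_o.bigE)
  from C(2) ln_ge_one have "\<forall>\<^sub>F n in at_top. real (f n) \<le> C * ln (real n) ^ k"
    by eventually_elim simp
  then show ?thesis using that C(1) by blast
qed

lemma soft_O1_const: "soft_O1 (\<lambda>_. c)"
  by (rule soft_O1I[of _ "real c" 0]) simp

lemma soft_O1_mult:
  assumes "soft_O1 f" "soft_O1 g"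
  shows "soft_O1 (\<lambda>n. f n * g n)"
proof -
  obtain C k where f: "0 < C" "\<forall>\<^sub>F n in at_top. real (f n) \<le> C * ln (real n) ^ k" using assms(1) by (rule soft_O1E)
  obtain B l where g: "0 < B" "\<forall>\<^sub>F n in at_top. real (g n) \<le> B * ln (real n) ^ l" using assms(2) by (rule soft_O1E)
  show ?thesis
  proof (rule soft_O1I)
    show "\<forall>\<^sub>F n in at_top. real (f n * g n) \<le> (C * B) * ln (real n) ^ (k + l)"
      using f(2) g(2) ln_ge_one
    proof eventually_elim
      case (elim n)
      have "real (f n) * real (g n) \<le> (C * ln (real n) ^ k) * (B * ln (real n) ^ l)"
        using elim by (intro mult_mono) auto
      then show ?case by (simp add: power_add mult_ac)
    qed
  qed
qed

lemma soft_O1_add: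
  assumes "soft_O1 f" "soft_O1 g"
  shows "soft_O1 (\<lambda>n. f n + g n)"
proof -
  obtain C k where f: "0 < C" "\<forall>\<^sub>F n in at_top. real (f n) \<le> C * ln (real n) ^ k" using assms(1) by (rule soft_O1E)
  obtain B l where g: "0 < B" "\<forall>\<^sub>F n in at_top. real (g n) \<le> B * ln (real n) ^ l" using assms(2) by (rule soft_O1E)
  show ?thesis
  proof (rule soft_O1I)
    show "\<forall>\<^sub>F n in at_top. real (f n + g n) \<le> (C + B) * ln (real n) ^ (k + l)"
      using f(2) g(2) ln_ge_one
    proof eventually_elim
      case (elim n)
      have "C * ln (real n) ^ k \<le> C * ln (real n) ^ (k + l)" "B * ln (real n) ^ l \<le> B * ln (real n) ^ (k + l)"
        using elim f(1) g(1) by (auto intro!: mult_left_mono power_increasing)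
      then show ?case using elim by (simp add: algebra_simps)
    qed
  qed
qed

lemma soft_O1_bit_length_of_poly:
  assumes "poly_bounded W"
  shows "soft_O1 (\<lambda>n. bit_length (W n))"
proof -
  obtain k where "(\<lambda>n. real (W n)) \<in> O(\<lambda>n. real n ^ k)" using assms by (auto simp: poly_bounded_def)
  then obtain C where C: "0 < C" "\<forall>\<^sub>F n in at_top. norm (real (W n)) \<le> C * norm (real n ^ k)"
    by (elim landau_o.bigE)
  define b where "b = nat \<lceil>log 2 C\<rceil>"
  have "log 2 C \<le> real b" unfolding b_def by linarith
  then have b: "C \<le> 2 ^ b" using C(1) by (simp add: log_le_iff powr_realpow)
  show ?thesis
  proof (rule soft_O1I)
    \<comment> \<open>\<open>b\<close> absorbs the constant \<open>C\<close>. The 3 comes from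
      \<open>j \<le> 1 + log 2 n \<le> 1 + 2 * ln n\<close> together with
      \<open>1 \<le> ln n\<close>, using \<open>ln 2 \<ge> 1 / 2\<close>.\<close>
    show "\<forall>\<^sub>F n in at_top. real (bit_length (W n)) \<le> (real b + 2 + 3 * real k) * ln (real n) ^ 1"
      using C(2) ln_ge_one eventually_gt_at_top[of 0]
    proof eventually_elim
      case (elim n)
      define j where "j = nat \<lceil>log 2 (real n)\<rceil>"
      have j: "log 2 (real n) \<le> real j" "real j \<le> 1 + log 2 (real n)"
        using elim by (auto simp: j_def) linarith+
      have "real n \<le> 2 ^ j" using j(1) elim by (simp add: log_le_iff powr_realpow)
      then have "real n ^ k \<le> 2 ^ (j * k)" unfolding power_mult by (intro power_mono) auto
      then have "C * real n ^ k \<le> 2 ^ b * 2 ^ (j * k)" using b C(1) by (intro mult_mono) auto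
      moreover have "real (W n) \<le> C * real n ^ k" using elim by simp
      moreover have "0 < (2::real) ^ b * 2 ^ (j * k)" by simp
      ultimately have "real (W n) < 2 * (2 ^ b * 2 ^ (j * k))" by linarith
      then have "real (W n) < 2 ^ (b + j * k + 1)" by (simp add: power_add)
      then have "W n < 2 ^ (b + j * k + 1)" by (metis of_nat_less_iff of_nat_numeral of_nat_power)
      then have "bit_length (W n) \<le> b + j * k + 1" by (rule bit_length_le)
      then have "real (bit_length (W n)) \<le> real b + real j * real k + 1" by (metis of_nat_1 of_nat_add of_nat_le_iff of_nat_mult)
      moreover have "real j * real k \<le> (3 * ln (real n)) * real k"
      proof (intro mult_right_mono)
        have "1 / 2 \<le> ln (2::real)" using ln_le_minus_one[of "1 / 2 :: real"] by (simp add: ln_div)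
        then have "log 2 (real n) * (1 / 2) \<le> log 2 (real n) * ln 2"
          using elim by (intro mult_left_mono) auto
        then have "log 2 (real n) * (1 / 2) \<le> ln (real n)" by (simp add: log_def)
        then show "real j \<le> 3 * ln (real n)" using j(2) elim by linarith
      qed simp
      moreover have "real b * 1 \<le> real b * ln (real n)" using elim by (intro mult_left_mono) auto
      ultimately show ?case using elim by (simp add: algebra_simps)
    qed
  qed
qed

theorem theorem5p1:
  "\<exists>A. valid_algorithm A \<and>
     (\<forall>I W. soft_O1 I \<and> poly_bounded W \<longrightarrow>
       (\<exists>R B. soft_O1 R \<and> soft_O1 B \<and>
         (\<forall>V E w T r.
            simple_graph V E \<and> connected_graph V E \<and>
            (\<forall>v\<in>V. length v \<le> I (card V)) \<and>
            (\<forall>e\<in>E. 0 < w e \<and> w e \<le> W (card V)) \<and>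
            spanning_tree V E T \<and> r \<in> V \<longrightarrow>
            (\<forall>c y a. ma_execution A V E (edge_input_of w T r) c y a \<longrightarrow>
               (\<forall>t<R (card V).
                  round_bounded A V E (edge_input_of w T r) (B (card V)) (c t) (y t)) \<and>
               (\<forall>e\<in>T. \<exists>t\<le>R (card V).
                  decides A (edge_input_of w T r) c e t (Cut T E w e))))))"
proof (intro exI[of _ cut_algorithm] conjI allI impI valid_cut_algorithm)
  fix I W :: "nat \<Rightarrow> nat"
  assume IW: "soft_O1 I \<and> poly_bounded W"
  \<comment> \<open>Bounds every \<open>probe_length\<close>; the factor 2 is for the two
    endpoints.\<close>
  define M where "M n = bit_length (W n) + 2 * I n" for n
  define R where "R n = run_length (width (M n))" for n
  define B where "B n = Suc (width (M n) + I n)" for n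
  have M: "soft_O1 M"
    unfolding M_def using IW by (intro soft_O1_add soft_O1_mult soft_O1_const soft_O1_bit_length_of_poly) auto
  then have "soft_O1 R"
    unfolding R_def run_length_eq merge_steps_def width_def
    by (intro soft_O1_add soft_O1_mult soft_O1_const)
  moreover have "soft_O1 (\<lambda>n. 1 + (width (M n) + I n))"
    unfolding width_def using M IW by (intro soft_O1_add soft_O1_mult soft_O1_const) auto
  then have "soft_O1 B" by (simp add: B_def[abs_def])
  moreover have "(\<forall>t<R (card V).
          round_bounded cut_algorithm V E (edge_input_of w T r) (B (card V)) (c t) (y t)) \<and>
       (\<forall>e\<in>T. \<exists>t\<le>R (card V). decides cut_algorithm (edge_input_of w T r) c e t (Cut T E w e))"
    if G: "simple_graph V E \<and> connected_graph V E \<and>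
        (\<forall>v\<in>V. length v \<le> I (card V)) \<and>
        (\<forall>e\<in>E. 0 < w e \<and> w e \<le> W (card V)) \<and> spanning_tree V E T \<and> r \<in> V"
      and exec: "ma_execution cut_algorithm V E (edge_input_of w T r) c y a"
    for V E w T r c y a
  proof -
    have edges: "e \<subseteq> V \<and> card e = 2" if "e \<in> E" for e using G that by (auto simp: simple_graph_def)
    obtain par where rt: "rooted_tree V r par (tree_dist T r)"
      and T: "T = (\<lambda>z. {z, par z}) ` (V - {r})"
      and up: "\<And>z. z \<in> V - {r} \<Longrightarrow> upper_end T r {z, par z} = par z"
      and cut: "\<And>z w. z \<in> V - {r} \<Longrightarrow> Cut T E w {z, par z} =
           (\<Sum>f\<in>{f \<in> E. card (f \<inter> rooted_tree.desc V r par z) = 1}. w f)"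
      using spanning_tree_rooted[of V E T r] G by blast
    interpret rooted_tree V r par "tree_dist T r" by (rule rt)
    interpret ma_run V r par "tree_dist T r" E T w c y a
      using edges T up exec G by unfold_locales (auto simp: spanning_tree_def)
    have probe: "probe_length (inp e) \<le> M (card V)" if e: "e \<in> E" for e
    proof -
      have "(\<Sum>v\<in>e. length v) \<le> of_nat (card e) * I (card V)"
        using G edges[OF e] by (intro sum_bounded_above) auto
      moreover have "bit_length (w e) \<le> bit_length (W (card V))" using G e by (intro bit_length_mono) auto
      ultimately show ?thesis using edges[OF e] by (simp add: probe_length_def M_def)
    qed
    have "round_bounded cut_algorithm V E inp (B (card V)) (c t) (y t)" for t
      unfolding B_def using G by (intro message_bounds probe) auto
    moreover have "\<exists>t\<le>R (card V). decides cut_algorithm inp c e t (Cut T E w e)" if e: "e \<in> T" for e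
    proof -
      obtain z where z: "z \<in> V - {r}" "e = {z, par z}" using e T by blast
      obtain D where "D \<le> width (M (card V))" "decides cut_algorithm inp c e (run_length D) (cut_value z)"
        using tree_edges_decide[OF probe z(1)] z(2) by blast
      then show ?thesis using run_length_mono[of D] cut[OF z(1), of w] z(2) by (auto simp: R_def cut_value_def)
    qed
    ultimately show ?thesis by blast
  qed
  ultimately show "\<exists>R B. soft_O1 R \<and> soft_O1 B \<and>
         (\<forall>V E w T r.
            simple_graph V E \<and> connected_graph V E \<and>
            (\<forall>v\<in>V. length v \<le> I (card V)) \<and>
            (\<forall>e\<in>E. 0 < w e \<and> w e \<le> W (card V)) \<and>
            spanning_tree V E T \<and> r \<in> V \<longrightarrow>
            (\<forall>c y a. ma_execution cut_algorithm V E (edge_input_of w T r) c y a \<longrightarrow>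
               (\<forall>t<R (card V).
                  round_bounded cut_algorithm V E (edge_input_of w T r) (B (card V)) (c t) (y t)) \<and>
               (\<forall>e\<in>T. \<exists>t\<le>R (card V).
                  decides cut_algorithm (edge_input_of w T r) c e t (Cut T E w e))))"
    by (intro exI[of _ R] exI[of _ B]) blast
qed

end
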